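(* There exist absolute constants $c,c'>0$ such that the following holds. Let $K\subseteq\mathbb{R}^n$ be a symmetric convex body of volume one and let $k$ be an integer with $1\leq k<(n-1)/4$. Then a Haar-distributed random subspace $F\in G_{n,k}$ satisfies $$ r(P_FK)\geq c\max\left\{\frac n{w(K)},\frac1{M(K)}\right\} $$ with probability at least $1-e^{-c'k}$.
   Context: A convex body in $\mathbb{R}^n$ is a compact convex set with nonempty interior; it is symmetric if $K=-K$. $G_{n,k}$ is the Grassmannian of $k$-dimensional linear subspaces of $\mathbb{R}^n$ with its rotationally invariant (Haar) probability measure, $P_F$ is the orthogonal projection onto $F$, $B_F=B_2^n\cap F$ is the Euclidean unit ball of $F$, and $r(P_FK)=\max\{r>0:rB_F\subseteq P_FK\}$ is the inradius of $P_FK$ in $F$. With $\sigma$ the rotationally invariant probability measure on $S^{n-1}$, $w(K)=\int_{S^{n-1}}h_K\,d\sigma$ where $h_K(x)=\sup_{y\in K}\langle x,y\rangle$, and $M(K)=\int_{S^{n-1}}p_K\,d\sigma$ where $p_K(x)=\inf\{t>0:x\in tK\}$. *)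

theory Defs
  imports "HOL-Probability.Probability"
begin

text \<open>
  The constants of the theorem do not depend on the dimension, so the spaces \<open>\<real>\<^sup>n\<close> for all \<open>n\<close>
  must live in a single type. The ambient type is the space of finitely supported real
  sequences with its Euclidean inner product; \<open>\<real>\<^sup>n\<close> is the subspace of the sequences supported
  in \<open>{0, \<dots>, n - 1}\<close>, on which inner product, norm and topology are the Euclidean ones.
\<close>

typedef fsvec = "{f :: nat \<Rightarrow> real. finite {i. f i \<noteq> 0}}"
  morphisms coord Abs_fsvec
  by (rule exI[of _ "\<lambda>_. 0"]) simp

lemma finite_coord [simp]: "finite {i. coord x i \<noteq> 0}"
  using coord[of x] by simp

lemma fsvec_eqI: "(\<And>i. coord x i = coord y i) \<Longrightarrow> x = y"
  by (simp add: coord_inject[symmetric] fun_eq_iff)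

instantiation fsvec :: real_vector
begin

definition "0 = Abs_fsvec (\<lambda>_. 0)"
definition "x + y = Abs_fsvec (\<lambda>i. coord x i + coord y i)"
definition "- x = Abs_fsvec (\<lambda>i. - coord x i)"
definition "x - y = Abs_fsvec (\<lambda>i. coord x i - coord y i)"
definition "r *\<^sub>R x = Abs_fsvec (\<lambda>i. r * coord x i)"

lemma coord_zero [simp]: "coord 0 i = 0"
  by (simp add: zero_fsvec_def Abs_fsvec_inverse)

lemma coord_add [simp]: "coord (x + y) i = coord x i + coord y i"
proof -
  have "finite {i. coord x i + coord y i \<noteq> 0}"
    by (rule finite_subset[of _ "{i. coord x i \<noteq> 0} \<union> {i. coord y i \<noteq> 0}"]) auto
  then show ?thesis by (simp add: plus_fsvec_def Abs_fsvec_inverse)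
qed

lemma coord_minus [simp]: "coord (- x) i = - coord x i"
  by (simp add: uminus_fsvec_def Abs_fsvec_inverse)

lemma coord_diff [simp]: "coord (x - y) i = coord x i - coord y i"
proof -
  have "finite {i. coord x i - coord y i \<noteq> 0}"
    by (rule finite_subset[of _ "{i. coord x i \<noteq> 0} \<union> {i. coord y i \<noteq> 0}"]) auto
  then show ?thesis by (simp add: minus_fsvec_def Abs_fsvec_inverse)
qed

lemma coord_scaleR [simp]: "coord (r *\<^sub>R x) i = r * coord x i"
proof -
  have "finite {i. r * coord x i \<noteq> 0}"
    by (rule finite_subset[of _ "{i. coord x i \<noteq> 0}"]) auto
  then show ?thesis by (simp add: scaleR_fsvec_def Abs_fsvec_inverse)
qed

instance
  by standard (auto intro!: fsvec_eqI simp: algebra_simps)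

end

instantiation fsvec :: real_inner
begin

definition "x \<bullet> y = (\<Sum>i | coord x i \<noteq> 0. coord x i * coord y i)"
definition "norm (x :: fsvec) = sqrt (x \<bullet> x)"
definition "dist (x :: fsvec) y = norm (x - y)"
definition "sgn (x :: fsvec) = x /\<^sub>R norm x"
definition "uniformity = (INF e\<in>{0<..}. principal {(x :: fsvec, y). dist x y < e})"
definition "open (U :: fsvec set) \<longleftrightarrow>
  (\<forall>x\<in>U. eventually (\<lambda>(x', y). x' = x \<longrightarrow> y \<in> U) uniformity)"

lemma inner_fsvec_superset:
  assumes "finite I" "{i. coord x i \<noteq> 0} \<subseteq> I"
  shows "x \<bullet> y = (\<Sum>i\<in>I. coord x i * coord y i)"
  unfolding inner_fsvec_def using assms by (intro sum.mono_neutral_left) auto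

instance
proof
  fix x y z :: fsvec and r :: real
  let ?I = "{i. coord x i \<noteq> 0} \<union> {i. coord y i \<noteq> 0}"
  have I: "finite ?I" by simp
  show "x \<bullet> y = y \<bullet> x"
    by (subst (1 2) inner_fsvec_superset[OF I]) (auto simp: mult.commute)
  show "(x + y) \<bullet> z = x \<bullet> z + y \<bullet> z"
    by (subst (1 2 3) inner_fsvec_superset[OF I]) (auto simp: algebra_simps sum.distrib)
  show "(r *\<^sub>R x) \<bullet> y = r * (x \<bullet> y)"
    by (subst (1 2) inner_fsvec_superset[OF I]) (auto simp: algebra_simps sum_distrib_left)
  show "0 \<le> x \<bullet> x"
    unfolding inner_fsvec_def by (intro sum_nonneg) auto
  show "x \<bullet> x = 0 \<longleftrightarrow> x = 0"
    by (auto simp: inner_fsvec_def sum_nonneg_eq_0_iff intro: fsvec_eqI)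
qed (simp_all add: norm_fsvec_def dist_fsvec_def sgn_fsvec_def uniformity_fsvec_def open_fsvec_def)

end

definition Rn :: "nat \<Rightarrow> fsvec set" where
  "Rn n = {x. \<forall>i\<ge>n. coord x i = 0}"

lemma inner_Rn: "x \<in> Rn n \<Longrightarrow> x \<bullet> y = (\<Sum>i<n. coord x i * coord y i)"
  by (rule inner_fsvec_superset) (auto simp: Rn_def intro: leI)

lemma subspace_Rn: "subspace (Rn n)"
  by (auto simp: subspace_def Rn_def)

lemma coords_surj_Rn: "\<exists>x\<in>Rn n. \<forall>i<n. coord x i = f i"
proof -
  have "finite {i. (if i < n then f i else 0) \<noteq> 0}"
    by (rule finite_subset[of _ "{..<n}"]) (auto split: if_splits)
  then show ?thesis
    by (intro bexI[of _ "Abs_fsvec (\<lambda>i. if i < n then f i else 0)"])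
       (auto simp: Abs_fsvec_inverse Rn_def)
qed

definition unit_sphere :: "nat \<Rightarrow> fsvec set" where
  "unit_sphere n = sphere 0 1 \<inter> Rn n"

definition vol_Rn :: "nat \<Rightarrow> fsvec set \<Rightarrow> real" where
  "vol_Rn n K = measure (\<Pi>\<^sub>M i\<in>{..<n}. lborel) ((\<lambda>x. \<lambda>i\<in>{..<n}. coord x i) ` K)"

definition convex_body :: "nat \<Rightarrow> fsvec set \<Rightarrow> bool" where
  "convex_body n K \<longleftrightarrow>
     K \<subseteq> Rn n \<and> compact K \<and> convex K \<and> top_of_set (Rn n) interior_of K \<noteq> {}"

definition symmetric_set :: "fsvec set \<Rightarrow> bool" where
  "symmetric_set K \<longleftrightarrow> K = uminus ` K"

text \<open>Orthogonal maps of \<open>\<real>\<^sup>n\<close>; the behaviour outside \<open>\<real>\<^sup>n\<close> is irrelevant below, and every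
  orthogonal map of \<open>\<real>\<^sup>n\<close> extends by the identity on the remaining coordinates.\<close>

definition orthogonal_group :: "nat \<Rightarrow> (fsvec \<Rightarrow> fsvec) set" where
  "orthogonal_group n = {U. orthogonal_transformation U \<and> U ` Rn n = Rn n}"

text \<open>The rotation invariant probability measures on the sphere and on the Grassmannian are
  unique, so they are given by their defining properties.\<close>

definition uniform_sphere_measure :: "nat \<Rightarrow> fsvec measure \<Rightarrow> bool" where
  "uniform_sphere_measure n \<sigma> \<longleftrightarrow>
     prob_space \<sigma> \<and> sets \<sigma> = sets (restrict_space borel (unit_sphere n)) \<and>
     (\<forall>U\<in>orthogonal_group n. distr \<sigma> \<sigma> U = \<sigma>)"

definition support_fun :: "fsvec set \<Rightarrow> fsvec \<Rightarrow> real" where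
  "support_fun K x = (SUP y\<in>K. x \<bullet> y)"

definition gauge_fun :: "fsvec set \<Rightarrow> fsvec \<Rightarrow> real" where
  "gauge_fun K x = Inf {t. t > 0 \<and> x \<in> (*\<^sub>R) t ` K}"

text \<open>\<open>w(K)\<close> and \<open>M(K)\<close>; the argument \<open>\<sigma>\<close> is the uniform measure on the sphere.\<close>

definition mean_w :: "fsvec measure \<Rightarrow> fsvec set \<Rightarrow> real" where
  "mean_w \<sigma> K = (LINT x|\<sigma>. support_fun K x)"

definition mean_M :: "fsvec measure \<Rightarrow> fsvec set \<Rightarrow> real" where
  "mean_M \<sigma> K = (LINT x|\<sigma>. gauge_fun K x)"

definition grassmannian :: "nat \<Rightarrow> nat \<Rightarrow> fsvec set set" where
  "grassmannian n k = {F. subspace F \<and> F \<subseteq> Rn n \<and> dim F = k}"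

definition orth_proj :: "fsvec set \<Rightarrow> fsvec \<Rightarrow> fsvec" where
  "orth_proj F x = (THE y. y \<in> F \<and> (\<forall>z\<in>F. orthogonal (x - y) z))"

text \<open>The usual topology of the Grassmannian, from the metric
  \<open>\<parallel>P\<^sub>E - P\<^sub>F\<parallel>\<close> (operator norm on \<open>\<real>\<^sup>n\<close>), and its Borel \<open>\<sigma>\<close>-algebra.\<close>

definition grassmannian_dist :: "nat \<Rightarrow> fsvec set \<Rightarrow> fsvec set \<Rightarrow> real" where
  "grassmannian_dist n E F = (SUP x\<in>cball 0 1 \<inter> Rn n. norm (orth_proj E x - orth_proj F x))"

definition grassmannian_borel :: "nat \<Rightarrow> nat \<Rightarrow> fsvec set measure" where
  "grassmannian_borel n k = sigma (grassmannian n k)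
     {A. A \<subseteq> grassmannian n k \<and>
         (\<forall>E\<in>A. \<exists>e>0. \<forall>F\<in>grassmannian n k. grassmannian_dist n E F < e \<longrightarrow> F \<in> A)}"

definition haar_grassmannian :: "nat \<Rightarrow> nat \<Rightarrow> fsvec set measure \<Rightarrow> bool" where
  "haar_grassmannian n k \<mu> \<longleftrightarrow>
     prob_space \<mu> \<and> sets \<mu> = sets (grassmannian_borel n k) \<and>
     (\<forall>U\<in>orthogonal_group n. distr \<mu> \<mu> ((`) U) = \<mu>)"

text \<open>For \<open>L\<close> compact and \<open>0\<close> interior to \<open>L\<close> in \<open>F \<noteq> {0}\<close> the supremum is a maximum.\<close>

definition inradius :: "fsvec set \<Rightarrow> fsvec set \<Rightarrow> real" where
  "inradius F L = Sup {r. r > 0 \<and> (*\<^sub>R) r ` (cball 0 1 \<inter> F) \<subseteq> L}"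

end

(*
  For a symmetric body K let h be its support function; r(P_F K) is the minimum of h on the unit
  sphere of F. If L is a symmetric subset of K inside the ball of radius rho, then h dominates h_L,
  which is rho-Lipschitz, so a point of the unit sphere of F with h_L < t carries a cap of radius
  t/rho, hence of measure at least (t/(3 rho))^k, on which h_L < 2t. Averaging over F turns the
  measure of {h_L <= 2t} on the spheres of the subspaces into its measure on S^(n-1), which is
  at most |2t L^o| / |B| in polar coordinates, hence at most (C t / (sqrt n |L|^(1/n)))^n by the
  Blaschke-Santalo inequality (up to a factor C^n). For n >= 2k Markov's inequality gives
  r(P_F K) >= c n |L|^(2/n) / rho with probability at least 1 - 4^(-k).

  Both bounds follow by taking L to be K cut with the ball of radius rho, rho = 1/M(K) or rho = w(K).
  For rho = 1/M(K), polar coordinates and Markov's inequality for the gauge bound |L| from below.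
  For rho = w(K), averaging |K cut with x + rho B| over x, where x = 0 is the worst case by
  Brunn-Minkowski, reduces the claim to |K + rho B| <= C^n rho^n |B|, which is Santalo again.
*)
theory Submission
  imports Defs
begin

section \<open>The Prekopa-Leindler inequality\<close>

text \<open>The exponents decide the argument: the polar volume shrinks like \<open>t ^ n\<close>,
  while the caps only cost \<open>t ^ k\<close>. For \<open>n >= 2 k\<close> a smaller threshold
  therefore gains more than it loses, and making it small by an absolute factor absorbs every
  constant of the form \<open>C ^ n\<close>. So volumes may be estimated crudely: Santalo holds with
  \<open>4 * exp 7\<close> per dimension, and a ball is only compared with its inscribed cube.

  The measures on the sphere and the Grassmannian are known only through their invariance, so
  uniqueness is the tool for computing with them: an invariant probability on the sphere is the cone
  measure (polar coordinates), and it is also the law of the normalised projection of a random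
  vector to a random subspace (averaging over \<open>F\<close>).

  Measurability dictates the form of the inequalities: midpoint sets and Minkowski sums of Borel
  sets need not be Borel, so they are replaced by measurable supersets, mostly polars, which are
  intersections of closed half-spaces.

  Which term of the maximum is larger depends on \<open>K\<close> and not on \<open>F\<close>; each
  body needs only one of the two bounds, and no union bound occurs.\<close>

lemma emeasure_lborel_translation:
  fixes A :: "real set"
  assumes "A \<in> sets borel"
  shows "(+) c ` A \<in> sets borel" "emeasure lborel ((+) c ` A) = emeasure lborel A"
proof -
  have eq: "(+) c ` A = (\<lambda>x. x - c) -` A \<inter> space borel"
    by (force simp: image_iff)
  show *: "(+) c ` A \<in> sets borel"
    unfolding eq using assms by measurable
  show "emeasure lborel ((+) c ` A) = emeasure lborel A"
    using emeasure_lebesgue_affine[of 1 c A] assms *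
    by (simp add: add.commute[of _ c] cong: image_cong_simp)
qed

lemma emeasure_lborel_scaling:
  fixes A :: "real set"
  assumes "A \<in> sets borel" "c \<noteq> 0"
  shows "(*) c ` A \<in> sets borel" "emeasure lborel ((*) c ` A) = ennreal \<bar>c\<bar> * emeasure lborel A"
proof -
  have eq: "(*) c ` A = (\<lambda>x. x / c) -` A \<inter> space borel"
    using assms(2) by (force simp: image_iff)
  show *: "(*) c ` A \<in> sets borel"
    unfolding eq using assms by measurable
  show "emeasure lborel ((*) c ` A) = ennreal \<bar>c\<bar> * emeasure lborel A"
    using emeasure_lebesgue_affine[of c 0 A] assms *
    by (simp cong: image_cong_simp)
qed

text \<open>With \<open>p = Max A\<close> and \<open>q = Min B\<close>, the translates
  \<open>q + A\<close> and \<open>p + B\<close> both lie in \<open>2 C\<close> and meet in at most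
  the point \<open>p + q\<close>, so their lengths add up.\<close>

lemma emeasure_lborel_midpoint_compact:
  fixes A B C :: "real set"
  assumes "compact A" "compact B" "A \<noteq> {}" "B \<noteq> {}"
    and C: "C \<in> sets borel"
    and mid: "\<And>a b. a \<in> A \<Longrightarrow> b \<in> B \<Longrightarrow> (a + b) / 2 \<in> C"
  shows "emeasure lborel A + emeasure lborel B \<le> 2 * emeasure lborel C"
proof -
  obtain p where p: "p \<in> A" "\<And>x. x \<in> A \<Longrightarrow> x \<le> p"
    using compact_attains_sup[OF assms(1,3)] by auto
  obtain q where q: "q \<in> B" "\<And>x. x \<in> B \<Longrightarrow> q \<le> x"
    using compact_attains_inf[OF assms(2,4)] by auto
  have AB: "A \<in> sets borel" "B \<in> sets borel"
    using assms(1,2) by (auto intro: borel_compact)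
  let ?A = "(+) q ` A" and ?B = "(+) p ` B" and ?C = "(*) 2 ` C"
  have sub: "?A \<union> ?B \<subseteq> ?C"
  proof
    fix x assume "x \<in> ?A \<union> ?B"
    then have "x / 2 \<in> C"
      using mid[OF _ q(1)] mid[OF p(1)] by (auto simp: add.commute)
    then show "x \<in> ?C"
      by (intro image_eqI[of _ _ "x / 2"]) auto
  qed
  have [simp]: "emeasure lborel (?A \<inter> ?B) = 0"
  proof -
    have "?A \<inter> ?B \<subseteq> {p + q}"
      using p(2) q(2) by fastforce
    then show ?thesis
      using emeasure_mono[of "?A \<inter> ?B" "{p + q}" lborel] by simp
  qed
  have "emeasure lborel A + emeasure lborel B = emeasure lborel ?A + emeasure lborel ?B"
    using AB by (simp add: emeasure_lborel_translation)
  also have "\<dots> = emeasure lborel (?A \<union> ?B)"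
    using emeasure_Un_Int[of ?A lborel ?B] AB emeasure_lborel_translation(1) by simp
  also have "\<dots> \<le> emeasure lborel ?C"
    using sub C emeasure_lborel_scaling(1)[of C 2] by (intro emeasure_mono) auto
  finally show ?thesis
    using C by (simp add: emeasure_lborel_scaling)
qed

lemma lborel_inner_compact:
  fixes A :: "real set"
  assumes A: "A \<in> sets borel" "A \<noteq> {}" "bounded A" and e: "e > 0"
  obtains T where "compact T" "T \<noteq> {}" "T \<subseteq> A" "emeasure lborel A \<le> emeasure lborel T + ennreal e"
proof -
  have "A \<in> sets lebesgue" using A(1) by simp
  then obtain T where T: "closed T" "T \<subseteq> A" "emeasure lebesgue (A - T) < ennreal e"
    using e by (rule sets_lebesgue_inner_closed) blast
  \<comment> \<open>Adding a point keeps the approximating set nonempty even when \<open>T\<close>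
    is empty; the compact case needs nonempty sets.\<close>
  obtain a where a: "a \<in> A" using A by auto
  let ?T = "insert a T"
  have T': "compact ?T"
    using bounded_subset[OF A(3) T(2)] T(1) by (simp add: compact_eq_bounded_closed)
  have [measurable]: "?T \<in> sets borel" "A \<in> sets borel"
    using T' A(1) by (auto intro: borel_compact)
  have "?T \<union> (A - ?T) = A"
    using T a by auto
  then have "emeasure lborel A \<le> emeasure lborel ?T + emeasure lborel (A - ?T)"
    using emeasure_subadditive[of ?T lborel "A - ?T"] by simp
  also have "emeasure lborel (A - ?T) \<le> emeasure lborel (A - T)"
    using A T by (intro emeasure_mono) (auto intro: borel_closed)
  also have "emeasure lborel (A - T) \<le> ennreal e"
    using T A by (auto intro: borel_closed)
  finally show ?thesis
    using that[of ?T] T' T a by (auto simp: add_left_mono)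
qed

text \<open>The midpoint set of two Borel sets need not be Borel, hence the separate set
  \<open>C\<close>. Inner regularity gives the bounded case, exhaustion by intervals the
  rest.\<close>

lemma emeasure_lborel_midpoint:
  fixes A B C :: "real set"
  assumes A: "A \<in> sets borel" "A \<noteq> {}" and B: "B \<in> sets borel" "B \<noteq> {}"
    and C: "C \<in> sets borel"
    and mid: "\<And>a b. a \<in> A \<Longrightarrow> b \<in> B \<Longrightarrow> (a + b) / 2 \<in> C"
  shows "emeasure lborel A + emeasure lborel B \<le> 2 * emeasure lborel C"
proof -
  have bdd: "emeasure lborel A' + emeasure lborel B' \<le> 2 * emeasure lborel C"
    if A': "A' \<in> sets borel" "A' \<noteq> {}" "bounded A'" "A' \<subseteq> A"
      and B': "B' \<in> sets borel" "B' \<noteq> {}" "bounded B'" "B' \<subseteq> B" for A' B'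
  proof (rule ennreal_le_epsilon)
    fix e :: real assume e: "0 < e"
    obtain S where S: "compact S" "S \<noteq> {}" "S \<subseteq> A'" "emeasure lborel A' \<le> emeasure lborel S + ennreal (e/2)"
      using lborel_inner_compact[OF A'(1-3), of "e/2"] e by auto
    obtain T where T: "compact T" "T \<noteq> {}" "T \<subseteq> B'" "emeasure lborel B' \<le> emeasure lborel T + ennreal (e/2)"
      using lborel_inner_compact[OF B'(1-3), of "e/2"] e by auto
    have "emeasure lborel A' + emeasure lborel B'
      \<le> (emeasure lborel S + ennreal (e/2)) + (emeasure lborel T + ennreal (e/2))"
      using S T by (intro add_mono)
    also have "\<dots> = (emeasure lborel S + emeasure lborel T) + (ennreal (e/2) + ennreal (e/2))"
      by (simp add: ac_simps)
    also have "ennreal (e/2) + ennreal (e/2) = ennreal e"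
      using e by (simp flip: ennreal_plus)
    also have "emeasure lborel S + emeasure lborel T \<le> 2 * emeasure lborel C"
    proof (rule emeasure_lborel_midpoint_compact[OF S(1) T(1) S(2) T(2) C])
      show "(a + b) / 2 \<in> C" if "a \<in> S" "b \<in> T" for a b
        by (rule mid) (use that S(3) T(3) A'(4) B'(4) in blast)+
    qed
    finally show "emeasure lborel A' + emeasure lborel B' \<le> 2 * emeasure lborel C + ennreal e"
      by (simp add: add_right_mono)
  qed
  obtain a b where ab: "a \<in> A" "b \<in> B" using A B by auto
  \<comment> \<open>All intervals \<open>I i\<close> contain \<open>a\<close> and \<open>b\<close>,
    so that every truncation of \<open>A\<close> and \<open>B\<close> is nonempty.\<close>
  define m where "m = max \<bar>a\<bar> \<bar>b\<bar>"
  define I where "I i = {-(m + real i)..m + real i}" for i :: nat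
  have I: "incseq I" "(\<Union>i. I i) = UNIV" "\<And>i. I i \<in> sets borel" "\<And>i. bounded (I i)"
  proof -
    show "incseq I" by (auto simp: incseq_def I_def)
    show "(\<Union>i. I i) = UNIV"
    proof (intro set_eqI iffI UNIV_I)
      fix x :: real
      obtain i :: nat where "\<bar>x\<bar> \<le> real i" using real_arch_simple by blast
      moreover have "m \<ge> 0" by (auto simp: m_def)
      ultimately show "x \<in> (\<Union>i. I i)" by (auto simp: I_def intro!: exI[of _ i])
    qed
  qed (auto simp: I_def)
  have lim: "(\<lambda>i. emeasure lborel (X \<inter> I i)) \<longlonglongrightarrow> emeasure lborel X" if "X \<in> sets borel" for X
  proof -
    have "(\<lambda>i. emeasure lborel (X \<inter> I i)) \<longlonglongrightarrow> emeasure lborel (\<Union>i. X \<inter> I i)"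
      using I that by (intro Lim_emeasure_incseq) (auto simp: incseq_def)
    also have "(\<Union>i. X \<inter> I i) = X" using I(2) by auto
    finally show ?thesis .
  qed
  have in_I: "a \<in> I i" "b \<in> I i" for i
    by (auto simp: I_def m_def)
  show ?thesis
  proof (rule LIMSEQ_le_const2[OF tendsto_add[OF lim lim]])
    have "emeasure lborel (A \<inter> I i) + emeasure lborel (B \<inter> I i) \<le> 2 * emeasure lborel C" for i
      using A B I ab in_I[of i] by (intro bdd) (auto intro: bounded_subset)
    then show "\<exists>N. \<forall>n\<ge>N. emeasure lborel (A \<inter> I n) + emeasure lborel (B \<inter> I n) \<le> 2 * emeasure lborel C"
      by auto
  qed (use A B in auto)
qed

section \<open>Prekopa-Leindler on the line and its tensorization\<close>

text \<open>Layer-cake formula. Only levels below 1 appear; at these the level sets of a function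
  with supremum 1 are nonempty, as the midpoint bound requires.\<close>

lemma nn_integral_superlevel:
  fixes f :: "real \<Rightarrow> real"
  assumes [measurable]: "f \<in> borel_measurable borel" and f: "\<And>x. 0 \<le> f x" "\<And>x. f x \<le> 1"
  shows "(\<integral>\<^sup>+x. f x \<partial>lborel) = (\<integral>\<^sup>+s. emeasure lborel {x. s < f x} * indicator {0..<1} s \<partial>lborel)"
proof -
  have "ennreal (f x) = (\<integral>\<^sup>+s. indicator {s. s < f x} s * indicator {0..<1} s \<partial>lborel)" for x
  proof -
    have "(\<integral>\<^sup>+s. indicator {s. s < f x} s * indicator {0..<1} s \<partial>lborel)
        = (\<integral>\<^sup>+s. indicator {0..<f x} s \<partial>lborel)"
      using f(2)[of x] by (intro nn_integral_cong) (auto simp: indicator_def)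
    then show ?thesis using f(1)[of x] by simp
  qed
  then have "(\<integral>\<^sup>+x. f x \<partial>lborel) = (\<integral>\<^sup>+x. \<integral>\<^sup>+s. indicator {s. s < f x} s * indicator {0..<1} s \<partial>lborel \<partial>lborel)"
    by simp
  also have "\<dots> = (\<integral>\<^sup>+s. \<integral>\<^sup>+x. indicator {s. s < f x} s * indicator {0..<1} s \<partial>lborel \<partial>lborel)"
  proof -
    have "(\<lambda>z. indicator {z. snd z < f (fst z)} z * indicator {0..<1} (snd z) :: ennreal)
      \<in> borel_measurable (lborel \<Otimes>\<^sub>M lborel)"
      by measurable
    then have "(\<lambda>(x, s). indicator {s. s < f x} s * indicator {0..<1} s :: ennreal)
      \<in> borel_measurable (lborel \<Otimes>\<^sub>M lborel)"
      by (simp add: split_beta' indicator_def)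
    then show ?thesis by (rule lborel_pair.Fubini'[symmetric])
  qed
  also have "\<dots> = (\<integral>\<^sup>+s. emeasure lborel {x. s < f x} * indicator {0..<1} s \<partial>lborel)"
  proof (rule nn_integral_cong)
    fix s
    have "(\<integral>\<^sup>+x. indicator {s. s < f x} s * indicator {0..<1} s \<partial>lborel)
        = (\<integral>\<^sup>+x. indicator {x. s < f x} x * indicator {0..<1} s \<partial>lborel)"
      by (intro nn_integral_cong) (auto simp: indicator_def)
    also have "\<dots> = emeasure lborel {x. s < f x} * indicator {0..<1} s"
      by (subst nn_integral_multc) auto
    finally show "(\<integral>\<^sup>+x. indicator {s. s < f x} s * indicator {0..<1} s \<partial>lborel)
      = emeasure lborel {x. s < f x} * indicator {0..<1} s" .
  qed
  finally show ?thesis .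
qed

lemma ennreal_mult_le_square:
  fixes a b c :: ennreal
  assumes "a + b \<le> 2 * c"
  shows "a * b \<le> c\<^sup>2"
proof (cases "c = top")
  case False
  then obtain z where z: "c = ennreal z" "z \<ge> 0" by (cases c) auto
  have "2 * c < top" using z by (simp add: ennreal_mult_less_top)
  with assms have "a + b < top" by (rule le_less_trans)
  then have "a < top" "b < top" by simp_all
  then obtain x y where xy: "a = ennreal x" "x \<ge> 0" "b = ennreal y" "y \<ge> 0"
    by (cases a; cases b) auto
  have "2 * c = ennreal (2 * z)"
    using z by (simp add: ennreal_mult')
  then have "x + y \<le> 2 * z"
    using assms xy z by (simp flip: ennreal_plus)
  then have "(x + y)\<^sup>2 \<le> (2 * z)\<^sup>2"
    using xy by (intro power_mono) auto
  then have "x * y \<le> z\<^sup>2"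
    using zero_le_power2[of "x - y"] by (simp add: power2_eq_square algebra_simps)
  then show ?thesis
    using xy z by (simp add: ennreal_power flip: ennreal_mult)
qed (simp add: power2_eq_square)

text \<open>Division by the suprema makes the superlevel sets of \<open>f\<close> and
  \<open>g\<close> nonempty at the same levels \<open>s < 1\<close>. The midpoint bound holds level
  by level, the layer-cake formula integrates it, and AM-GM passes from the sum to the product.
  Squaring \<open>h\<close> avoids roots in \<open>ennreal\<close>.\<close>

lemma prekopa_leindler_bounded:
  fixes f g :: "real \<Rightarrow> real" and h :: "real \<Rightarrow> ennreal"
  assumes [measurable]: "f \<in> borel_measurable borel" "g \<in> borel_measurable borel" "h \<in> borel_measurable borel"
    and f: "\<And>x. 0 \<le> f x" "\<And>x. f x \<le> m" and g: "\<And>x. 0 \<le> g x" "\<And>x. g x \<le> m"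
    and h: "\<And>x y. ennreal (f x * g y) \<le> (h ((x + y) / 2))\<^sup>2"
  shows "(\<integral>\<^sup>+x. f x \<partial>lborel) * (\<integral>\<^sup>+x. g x \<partial>lborel) \<le> (\<integral>\<^sup>+x. h x \<partial>lborel)\<^sup>2"
proof -
  define a b where "a = (SUP x. f x)" and "b = (SUP x. g x)"
  have bdd: "bdd_above (range f)" "bdd_above (range g)"
    using f(2) g(2) by (auto intro!: bdd_aboveI)
  have le: "f x \<le> a" "g x \<le> b" for x
    unfolding a_def b_def using bdd by (auto intro: cSUP_upper)
  show ?thesis
  proof (cases "a \<le> 0 \<or> b \<le> 0")
    case True
    then have "(\<forall>x. f x = 0) \<or> (\<forall>x. g x = 0)"
      using le f(1) g(1) by (meson order_antisym order_trans)
    then show ?thesis by auto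
  next
    case False
    then have ab: "a > 0" "b > 0" by auto
    define r where "r = sqrt (a * b)"
    have r: "r > 0" "r * r = a * b" using ab by (auto simp: r_def)
    \<comment> \<open>Truncation at the geometric mean \<open>r\<close> of the suprema brings
      \<open>h'\<close> into \<open>[0, 1]\<close>; no level is lost, because only values
      \<open>s * r < r\<close> have to be exceeded.\<close>
    define h' where "h' x = enn2real (min (h x) (ennreal r)) / r" for x
    have h'[measurable]: "h' \<in> borel_measurable borel" unfolding h'_def by measurable
    have h'1: "0 \<le> h' x" "h' x \<le> 1" "ennreal r * ennreal (h' x) \<le> h x" for x
    proof -
      have "enn2real (min (h x) (ennreal r)) \<le> r"
        using r enn2real_mono[of "min (h x) (ennreal r)" "ennreal r"] by auto
      then show "0 \<le> h' x" "h' x \<le> 1" using r by (auto simp: h'_def)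
      have "min (h x) (ennreal r) < top" by (simp add: min_less_iff_disj)
      then have "ennreal (enn2real (min (h x) (ennreal r))) \<le> h x" by simp
      then show "ennreal r * ennreal (h' x) \<le> h x"
        using r by (simp add: h'_def flip: ennreal_mult')
    qed
    have level: "emeasure lborel {x. s < f x / a} + emeasure lborel {x. s < g x / b}
      \<le> 2 * emeasure lborel {x. s < h' x}" if s: "s \<in> {0..<1}" for s
    proof (rule emeasure_lborel_midpoint)
      have "s * a < a" "s * b < b" using s ab by auto
      then obtain x y where "s * a < f x" "s * b < g y"
        using less_cSUP_iff[OF _ bdd(1)] less_cSUP_iff[OF _ bdd(2)] unfolding a_def[symmetric] b_def[symmetric] by auto
      then show "{x. s < f x / a} \<noteq> {}" "{x. s < g x / b} \<noteq> {}"
        using ab by (auto simp: field_simps)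
    next
      fix x y assume "x \<in> {x. s < f x / a}" "y \<in> {x. s < g x / b}"
      then have *: "s * a < f x" "s * b < g y" using ab by (auto simp: field_simps)
      then have "(s * a) * (s * b) < f x * g y"
        using ab s f(1)[of x] by (intro mult_strict_mono) (auto intro: le_less_trans[rotated])
      moreover have "(s * r)\<^sup>2 = s * s * (r * r)" by (simp add: power2_eq_square)
      ultimately have **: "(s * r)\<^sup>2 < f x * g y" by (simp add: r(2) algebra_simps)
      define z where "z = (x + y) / 2"
      have "ennreal (s * r) < h z"
      proof (rule ccontr)
        assume "\<not> ennreal (s * r) < h z"
        then have "(h z)\<^sup>2 \<le> (ennreal (s * r))\<^sup>2" by (intro power_mono) auto
        also have "\<dots> = ennreal ((s * r)\<^sup>2)" using s r by (simp add: ennreal_power)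
        also have "\<dots> < ennreal (f x * g y)" using ** by (intro ennreal_lessI) (auto intro: le_less_trans[OF zero_le_power2])
        also have "\<dots> \<le> (h z)\<^sup>2" using h by (simp add: z_def)
        finally show False by simp
      qed
      moreover have "ennreal (s * r) < ennreal r" using s r by (intro ennreal_lessI) auto
      ultimately have "ennreal (s * r) < min (h z) (ennreal r)" by simp
      moreover have "min (h z) (ennreal r) < top" by (simp add: min_less_iff_disj)
      ultimately have "s * r < enn2real (min (h z) (ennreal r))"
        using s r by (cases "min (h z) (ennreal r)") (auto simp: ennreal_less_iff)
      then show "(x + y) / 2 \<in> {x. s < h' x}"
        using r by (simp add: h'_def z_def field_simps)
    qed measurable
    have "(\<integral>\<^sup>+x. ennreal (f x / a) \<partial>lborel) + (\<integral>\<^sup>+x. ennreal (g x / b) \<partial>lborel)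
      = (\<integral>\<^sup>+s. emeasure lborel {x. s < f x / a} * indicator {0..<1} s \<partial>lborel)
      + (\<integral>\<^sup>+s. emeasure lborel {x. s < g x / b} * indicator {0..<1} s \<partial>lborel)"
      using f g ab le by (subst (1 2) nn_integral_superlevel) auto
    also have "\<dots> = (\<integral>\<^sup>+s. (emeasure lborel {x. s < f x / a} * indicator {0..<1} s
        + emeasure lborel {x. s < g x / b} * indicator {0..<1} s) \<partial>lborel)"
      by (subst nn_integral_add) auto
    also have "\<dots> \<le> (\<integral>\<^sup>+s. 2 * (emeasure lborel {x. s < h' x} * indicator {0..<1} s) \<partial>lborel)"
      using level by (intro nn_integral_mono) (auto simp: indicator_def)
    also have "\<dots> = 2 * (\<integral>\<^sup>+x. ennreal (h' x) \<partial>lborel)"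
      using h'1 by (subst nn_integral_cmult) (auto simp: nn_integral_superlevel)
    finally have *: "(\<integral>\<^sup>+x. ennreal (f x / a) \<partial>lborel) * (\<integral>\<^sup>+x. ennreal (g x / b) \<partial>lborel)
      \<le> (\<integral>\<^sup>+x. ennreal (h' x) \<partial>lborel)\<^sup>2"
      by (rule ennreal_mult_le_square)
    have "(\<integral>\<^sup>+x. f x \<partial>lborel) = ennreal a * (\<integral>\<^sup>+x. ennreal (f x / a) \<partial>lborel)"
      using ab by (subst nn_integral_cmult[symmetric]) (auto simp flip: ennreal_mult')
    moreover have "(\<integral>\<^sup>+x. g x \<partial>lborel) = ennreal b * (\<integral>\<^sup>+x. ennreal (g x / b) \<partial>lborel)"
      using ab by (subst nn_integral_cmult[symmetric]) (auto simp flip: ennreal_mult')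
    ultimately have "(\<integral>\<^sup>+x. f x \<partial>lborel) * (\<integral>\<^sup>+x. g x \<partial>lborel)
      = (ennreal a * ennreal b) * ((\<integral>\<^sup>+x. ennreal (f x / a) \<partial>lborel) * (\<integral>\<^sup>+x. ennreal (g x / b) \<partial>lborel))"
      by (simp add: ac_simps)
    also have "\<dots> \<le> (ennreal a * ennreal b) * (\<integral>\<^sup>+x. ennreal (h' x) \<partial>lborel)\<^sup>2"
      using * by (intro mult_left_mono) auto
    also have "ennreal a * ennreal b = (ennreal r)\<^sup>2"
      using ab r by (simp add: power2_eq_square flip: ennreal_mult')
    also have "(ennreal r)\<^sup>2 * (\<integral>\<^sup>+x. ennreal (h' x) \<partial>lborel)\<^sup>2 = (\<integral>\<^sup>+x. ennreal r * ennreal (h' x) \<partial>lborel)\<^sup>2"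
      by (subst nn_integral_cmult) (auto simp: power_mult_distrib)
    also have "\<dots> \<le> (\<integral>\<^sup>+x. h x \<partial>lborel)\<^sup>2"
      using h'1 by (intro power_mono nn_integral_mono) auto
    finally show ?thesis .
  qed
qed

lemma prekopa_leindler_real:
  fixes f g h :: "real \<Rightarrow> ennreal"
  assumes [measurable]: "f \<in> borel_measurable borel" "g \<in> borel_measurable borel" "h \<in> borel_measurable borel"
    and h: "\<And>x y. f x * g y \<le> (h ((x + y) / 2))\<^sup>2"
  shows "(\<integral>\<^sup>+x. f x \<partial>lborel) * (\<integral>\<^sup>+x. g x \<partial>lborel) \<le> (\<integral>\<^sup>+x. h x \<partial>lborel)\<^sup>2"
proof -
  define t where "t u i x = min (u x) (ennreal (real i))" for u :: "real \<Rightarrow> ennreal" and i x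
  have t_le: "t u i x \<le> u x" for u i x by (simp add: t_def)
  have t_fin: "t u i x < top" for u i x by (simp add: t_def min_less_iff_disj)
  have bdd: "(\<integral>\<^sup>+x. t f i x \<partial>lborel) * (\<integral>\<^sup>+x. t g i x \<partial>lborel) \<le> (\<integral>\<^sup>+x. h x \<partial>lborel)\<^sup>2" for i
  proof -
    have "(\<integral>\<^sup>+x. ennreal (enn2real (t f i x)) \<partial>lborel) * (\<integral>\<^sup>+x. ennreal (enn2real (t g i x)) \<partial>lborel)
      \<le> (\<integral>\<^sup>+x. h x \<partial>lborel)\<^sup>2"
    proof (rule prekopa_leindler_bounded[where m = "real i"])
      fix x y
      have "ennreal (enn2real (t f i x) * enn2real (t g i y)) = t f i x * t g i y"
        using t_fin by (simp add: ennreal_mult)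
      also have "\<dots> \<le> f x * g y" using t_le by (intro mult_mono) auto
      also have "\<dots> \<le> (h ((x + y) / 2))\<^sup>2" by (rule h)
      finally show "ennreal (enn2real (t f i x) * enn2real (t g i y)) \<le> (h ((x + y) / 2))\<^sup>2" .
    next
      show "enn2real (t f i x) \<le> real i" "enn2real (t g i x) \<le> real i" for x
        by (auto simp: t_def intro!: enn2real_leI)
    qed (auto simp: t_def)
    then show ?thesis using t_fin by simp
  qed
  have lim: "(\<lambda>i. \<integral>\<^sup>+x. t u i x \<partial>lborel) \<longlonglongrightarrow> (\<integral>\<^sup>+x. u x \<partial>lborel)"
    if [measurable]: "u \<in> borel_measurable borel" for u
  proof (rule nn_integral_LIMSEQ)
    show "incseq (t u)"
      unfolding incseq_def le_fun_def t_def
      by (intro allI impI min.mono[OF order_refl] ennreal_leI) simp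
    show "t u i \<in> borel_measurable lborel" for i unfolding t_def by measurable
    show "(\<lambda>i. t u i x) \<longlonglongrightarrow> u x" for x
    proof (cases "u x = top")
      case True
      then show ?thesis
        unfolding t_def by (simp add: of_nat_tendsto_top_ennreal flip: ennreal_of_nat_eq_real_of_nat)
    next
      case False
      then obtain r where r: "u x = ennreal r" "r \<ge> 0" by (cases "u x") auto
      obtain N :: nat where "r \<le> real N" using real_arch_simple by blast
      then have "eventually (\<lambda>i. t u i x = u x) sequentially"
        unfolding eventually_sequentially using r
        by (intro exI[of _ N]) (auto simp: t_def min_absorb1 intro!: ennreal_leI)
      then show ?thesis by (rule tendsto_eventually)
    qed
  qed
  show ?thesis
  \<comment> \<open>Multiplication in \<open>ennreal\<close> is not continuous at
    \<open>0 * \<infinity>\<close>, so vanishing integrals are split off before taking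
    limits.\<close>
  proof (cases "(\<integral>\<^sup>+x. f x \<partial>lborel) = 0 \<or> (\<integral>\<^sup>+x. g x \<partial>lborel) = 0")
    case False
    then show ?thesis
      by (intro LIMSEQ_le_const2[OF tendsto_mult_ennreal[OF lim lim]]) (use bdd in auto)
  qed auto
qed

text \<open>Tensorization, the advantage of the functional form: with one coordinate fixed, the
  integrals over the others satisfy the one-dimensional hypothesis by induction.\<close>

theorem prekopa_leindler_PiM:
  fixes f g h :: "('i \<Rightarrow> real) \<Rightarrow> ennreal"
  assumes "finite I"
    and "f \<in> borel_measurable (Pi\<^sub>M I (\<lambda>_. lborel))" "g \<in> borel_measurable (Pi\<^sub>M I (\<lambda>_. lborel))"
      "h \<in> borel_measurable (Pi\<^sub>M I (\<lambda>_. lborel))"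
    and "\<And>x y. x \<in> extensional I \<Longrightarrow> y \<in> extensional I
      \<Longrightarrow> f x * g y \<le> (h (\<lambda>i\<in>I. (x i + y i) / 2))\<^sup>2"
  shows "(\<integral>\<^sup>+x. f x \<partial>Pi\<^sub>M I (\<lambda>_. lborel)) * (\<integral>\<^sup>+x. g x \<partial>Pi\<^sub>M I (\<lambda>_. lborel))
    \<le> (\<integral>\<^sup>+x. h x \<partial>Pi\<^sub>M I (\<lambda>_. lborel))\<^sup>2"
  using assms
proof (induction I arbitrary: f g h rule: finite_induct)
  case empty
  interpret product_sigma_finite "\<lambda>_::'i. lborel :: real measure" by standard
  have "(\<lambda>i\<in>{}. (x i + y i) / 2) = (\<lambda>_. undefined)" for x y :: "'i \<Rightarrow> real"
    by (simp add: restrict_def)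
  then show ?case
    using empty(4)[of "\<lambda>_. undefined" "\<lambda>_. undefined"] by (simp add: nn_integral_empty)
next
  case (insert j I)
  interpret product_sigma_finite "\<lambda>_::'i. lborel :: real measure" by standard
  interpret I: finite_product_sigma_finite "\<lambda>_::'i. lborel :: real measure" I by standard fact
  note [measurable] = insert.prems(1-3)
  let ?M = "Pi\<^sub>M I (\<lambda>_. lborel)"
  have upd: "(\<lambda>x. u (x(j := s))) \<in> borel_measurable ?M"
    if [measurable]: "u \<in> borel_measurable (Pi\<^sub>M (insert j I) (\<lambda>_. lborel))" for u :: "('i \<Rightarrow> real) \<Rightarrow> ennreal" and s :: real
    by measurable
  have int: "(\<lambda>s. \<integral>\<^sup>+x. u (x(j := s)) \<partial>?M) \<in> borel_measurable borel"
    if [measurable]: "u \<in> borel_measurable (Pi\<^sub>M (insert j I) (\<lambda>_. lborel))" for u :: "('i \<Rightarrow> real) \<Rightarrow> ennreal"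
  proof -
    have "(\<lambda>s. \<integral>\<^sup>+x. u (x(j := s)) \<partial>?M) \<in> borel_measurable lborel"
      by measurable
    then show ?thesis by simp
  qed
  have "(\<integral>\<^sup>+x. f (x(j := s)) \<partial>?M) * (\<integral>\<^sup>+x. g (x(j := t)) \<partial>?M)
      \<le> (\<integral>\<^sup>+x. h (x(j := (s + t) / 2)) \<partial>?M)\<^sup>2" for s t
  proof (rule insert.IH[OF upd upd upd])
    fix x y :: "'i \<Rightarrow> real" assume xy: "x \<in> extensional I" "y \<in> extensional I"
    have "(\<lambda>i\<in>insert j I. ((x(j := s)) i + (y(j := t)) i) / 2)
      = (\<lambda>i\<in>I. (x i + y i) / 2)(j := (s + t) / 2)"
      using insert.hyps by (auto simp: fun_eq_iff)
    moreover have "x(j := s) \<in> extensional (insert j I)" "y(j := t) \<in> extensional (insert j I)"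
      using xy by (auto simp: extensional_def)
    ultimately show "f (x(j := s)) * g (y(j := t)) \<le> (h ((\<lambda>i\<in>I. (x i + y i) / 2)(j := (s + t) / 2)))\<^sup>2"
      using insert.prems(4) by metis
  qed (use insert.prems in auto)
  then have "(\<integral>\<^sup>+s. \<integral>\<^sup>+x. f (x(j := s)) \<partial>?M \<partial>lborel) * (\<integral>\<^sup>+s. \<integral>\<^sup>+x. g (x(j := s)) \<partial>?M \<partial>lborel)
    \<le> (\<integral>\<^sup>+s. \<integral>\<^sup>+x. h (x(j := s)) \<partial>?M \<partial>lborel)\<^sup>2"
    by (intro prekopa_leindler_real int) (use insert.prems in auto)
  then show ?case
    using insert.hyps insert.prems by (subst (1 2 3) product_nn_integral_insert_rev) auto
qed

section \<open>The Blaschke-Santalo inequality up to a constant\<close>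

abbreviation LM :: "'i set \<Rightarrow> ('i \<Rightarrow> real) measure" where
  "LM I \<equiv> Pi\<^sub>M I (\<lambda>_. lborel)"

lemma space_LM [simp]: "space (LM I) = extensional I"
  by (auto simp: space_PiM PiE_def)

text \<open>The rescaled image measure takes the values on boxes that characterise the product
  measure.\<close>

lemma emeasure_LM_coordinatewise:
  fixes f :: "'i \<Rightarrow> real \<Rightarrow> real"
  assumes I: "finite I" and K: "K > 0"
    and f[measurable]: "\<And>i. i \<in> I \<Longrightarrow> f i \<in> borel_measurable borel"
    and fK: "\<And>i A. i \<in> I \<Longrightarrow> A \<in> sets borel \<Longrightarrow> emeasure lborel (f i -` A) = ennreal K * emeasure lborel A"
    and A: "A \<in> sets (LM I)"
  shows "emeasure (LM I) {x \<in> extensional I. (\<lambda>i\<in>I. f i (x i)) \<in> A} = ennreal (K ^ card I) * emeasure (LM I) A"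
proof -
  let ?g = "\<lambda>x. \<lambda>i\<in>I. f i (x i)"
  interpret product_sigma_finite "\<lambda>_::'i. lborel :: real measure" by standard
  have g[measurable]: "?g \<in> measurable (LM I) (LM I)"
    by measurable
  let ?P = "scale_measure (ennreal (1 / K ^ card I)) (distr (LM I) (LM I) ?g)"
  have eq: "?P = LM I"
  proof (rule PiM_eqI[OF I])
    fix A :: "'i \<Rightarrow> real set" assume A: "\<And>i. i \<in> I \<Longrightarrow> A i \<in> sets lborel"
    have "?g -` Pi\<^sub>E I A \<inter> space (LM I) = Pi\<^sub>E I (\<lambda>i. f i -` A i)"
      by (auto simp: PiE_iff extensional_def)
    moreover have "f i -` A i \<in> sets lborel" if "i \<in> I" for i
      using measurable_sets[OF f[OF that], of "A i"] A[OF that] by simp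
    ultimately have "emeasure (distr (LM I) (LM I) ?g) (Pi\<^sub>E I A) = (\<Prod>i\<in>I. ennreal K * emeasure lborel (A i))"
      using A I fK by (simp add: emeasure_distr sets_PiM_I_finite emeasure_PiM)
    also have "\<dots> = ennreal (K ^ card I) * (\<Prod>i\<in>I. emeasure lborel (A i))"
      using K by (simp add: prod.distrib ennreal_power)
    finally show "emeasure ?P (Pi\<^sub>E I A) = (\<Prod>i\<in>I. emeasure lborel (A i))"
      using K by (simp add: mult.assoc[symmetric] flip: ennreal_mult')
  qed simp
  show "emeasure (LM I) {x \<in> extensional I. ?g x \<in> A} = ennreal (K ^ card I) * emeasure (LM I) A"
  proof -
    have "emeasure (LM I) {x \<in> extensional I. ?g x \<in> A} = emeasure (distr (LM I) (LM I) ?g) A"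
      using A by (subst emeasure_distr) (auto intro!: arg_cong2[where f = emeasure])
    also have "\<dots> = ennreal (K ^ card I) * emeasure ?P A"
      using K by (simp add: mult.assoc[symmetric] flip: ennreal_mult')
    finally show ?thesis by (simp add: eq)
  qed
qed

lemma emeasure_lborel_vimage_uminus:
  assumes "A \<in> sets borel"
  shows "emeasure lborel (uminus -` A) = emeasure lborel (A :: real set)"
  using emeasure_distr[of uminus lborel borel A] assms by (simp add: lborel_distr_uminus)

lemma emeasure_LM_uminus:
  assumes "finite I" "A \<in> sets (LM I)"
  shows "emeasure (LM I) {x \<in> extensional I. (\<lambda>i\<in>I. - x i) \<in> A} = emeasure (LM I) A"
  using emeasure_LM_coordinatewise[of I 1 "\<lambda>_. uminus" A] assms
  by (simp add: emeasure_lborel_vimage_uminus)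

lemma sets_LM_insert_section:
  assumes "A \<in> sets (LM (insert j I))"
  shows "x \<in> extensional I \<Longrightarrow> j \<notin> I \<Longrightarrow> {s. x(j := s) \<in> A} \<in> sets borel"
    and "{x \<in> extensional I. x(j := s) \<in> A} \<in> sets (LM I)"
proof -
  show "{s. x(j := s) \<in> A} \<in> sets borel" if "x \<in> extensional I" "j \<notin> I"
  proof -
    have "(\<lambda>s. x(j := s)) \<in> measurable lborel (LM (insert j I))"
      using that by (intro measurable_component_update) auto
    then show ?thesis
      using measurable_sets[of "\<lambda>s. x(j := s)" lborel, OF _ assms] by (simp add: vimage_def)
  qed
  have "(\<lambda>x. x(j := s)) \<in> measurable (LM I) (LM (insert j I))"
    by measurable
  then show "{x \<in> extensional I. x(j := s) \<in> A} \<in> sets (LM I)"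
    using measurable_sets[of "\<lambda>x. x(j := s)" "LM I", OF _ assms] by (simp add: vimage_def Int_def conj_commute)
qed

text \<open>Symmetrization in the coordinate \<open>j\<close> compares \<open>A\<close> along lines
  in direction \<open>j\<close> and \<open>B\<close> along hyperplanes orthogonal to it; these are
  the two orders of slicing.\<close>

lemma emeasure_LM_insert:
  assumes "finite I" "j \<notin> I" "A \<in> sets (LM (insert j I))"
  shows "emeasure (LM (insert j I)) A = (\<integral>\<^sup>+x. emeasure lborel {s. x(j := s) \<in> A} \<partial>LM I)"
    and "emeasure (LM (insert j I)) A
      = (\<integral>\<^sup>+s. emeasure (LM I) {x \<in> extensional I. x(j := s) \<in> A} \<partial>lborel)"
proof -
  interpret product_sigma_finite "\<lambda>_. lborel :: real measure" by standard
  note [measurable] = assms(3)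
  have "emeasure (LM (insert j I)) A = (\<integral>\<^sup>+x. indicator A x \<partial>LM (insert j I))"
    by simp
  also have "\<dots> = (\<integral>\<^sup>+x. (\<integral>\<^sup>+s. indicator A (x(j := s)) \<partial>lborel) \<partial>LM I)"
    using assms by (subst product_nn_integral_insert) auto
  also have "\<dots> = (\<integral>\<^sup>+x. emeasure lborel {s. x(j := s) \<in> A} \<partial>LM I)"
  proof (rule nn_integral_cong)
    fix x :: "'a \<Rightarrow> real" assume x: "x \<in> space (LM I)"
    have "(\<integral>\<^sup>+s. indicator A (x(j := s)) \<partial>lborel) = (\<integral>\<^sup>+s. indicator {s. x(j := s) \<in> A} s \<partial>lborel)"
      by (intro nn_integral_cong) (auto simp: indicator_def)
    also have "\<dots> = emeasure lborel {s. x(j := s) \<in> A}"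
      using sets_LM_insert_section(1)[OF assms(3) _ assms(2), of x] x by (subst nn_integral_indicator) auto
    finally show "(\<integral>\<^sup>+s. indicator A (x(j := s)) \<partial>lborel) = emeasure lborel {s. x(j := s) \<in> A}" .
  qed
  finally show "emeasure (LM (insert j I)) A = (\<integral>\<^sup>+x. emeasure lborel {s. x(j := s) \<in> A} \<partial>LM I)" .
  have "emeasure (LM (insert j I)) A = (\<integral>\<^sup>+x. indicator A x \<partial>LM (insert j I))"
    by simp
  also have "\<dots> = (\<integral>\<^sup>+s. (\<integral>\<^sup>+x. indicator A (x(j := s)) \<partial>LM I) \<partial>lborel)"
    using assms by (subst product_nn_integral_insert_rev) auto
  also have "\<dots> = (\<integral>\<^sup>+s. emeasure (LM I) {x \<in> extensional I. x(j := s) \<in> A} \<partial>lborel)"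
  proof (rule nn_integral_cong)
    fix s :: real
    have "(\<integral>\<^sup>+x. indicator A (x(j := s)) \<partial>LM I)
        = (\<integral>\<^sup>+x. indicator {x \<in> extensional I. x(j := s) \<in> A} x \<partial>LM I)"
      by (intro nn_integral_cong) (auto simp: indicator_def)
    also have "\<dots> = emeasure (LM I) {x \<in> extensional I. x(j := s) \<in> A}"
      using sets_LM_insert_section(2)[OF assms(3)] by (subst nn_integral_indicator) auto
    finally show "(\<integral>\<^sup>+x. indicator A (x(j := s)) \<partial>LM I) = emeasure (LM I) {x \<in> extensional I. x(j := s) \<in> A}" .
  qed
  finally show "emeasure (LM (insert j I)) A
      = (\<integral>\<^sup>+s. emeasure (LM I) {x \<in> extensional I. x(j := s) \<in> A} \<partial>lborel)" .
qed

section \<open>Polars and symmetrization\<close>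

definition polar_of :: "'i set \<Rightarrow> ('i \<Rightarrow> real) set \<Rightarrow> ('i \<Rightarrow> real) set" where
  "polar_of I B = {x \<in> extensional I. \<forall>y\<in>B. (\<Sum>i\<in>I. x i * y i) \<le> 1}"

text \<open>A closed set as an intersection of half-spaces, for arbitrary \<open>B\<close>.
  Countability of the index type allows measurability into the function space to be checked
  coordinate by coordinate.\<close>

lemma sets_polar_of:
  fixes I :: "'i :: countable set"
  shows "polar_of I B \<in> sets (LM I)"
proof -
  have "closed (\<Inter>y\<in>B. {x :: 'i \<Rightarrow> real. (\<Sum>i\<in>I. x i * y i) \<le> 1})"
    by (intro closed_INT ballI closed_Collect_le continuous_intros continuous_on_product_coordinates)
  then have "(\<Inter>y\<in>B. {x :: 'i \<Rightarrow> real. (\<Sum>i\<in>I. x i * y i) \<le> 1}) \<in> sets borel"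
    by (rule borel_closed)
  moreover have "(\<lambda>x. x) \<in> borel_measurable (LM I)"
  proof (rule measurable_coordinatewise_then_product)
    fix i
    show "(\<lambda>x. x i) \<in> borel_measurable (LM I)"
    proof (cases "i \<in> I")
      \<comment> \<open>On \<open>extensional I\<close> the coordinates outside \<open>I\<close> are
        constantly \<open>undefined\<close>.\<close>
      case False
      then have "(\<lambda>x. x i) \<in> borel_measurable (LM I) \<longleftrightarrow> (\<lambda>x. undefined :: real) \<in> borel_measurable (LM I)"
        by (intro measurable_cong) (auto simp: extensional_def)
      then show ?thesis by simp
    next
      case True
      then show ?thesis using measurable_component_singleton[OF True, of "\<lambda>_. lborel"] by simp
    qed
  qed
  ultimately have "(\<lambda>x. x) -` (\<Inter>y\<in>B. {x :: 'i \<Rightarrow> real. (\<Sum>i\<in>I. x i * y i) \<le> 1}) \<inter> space (LM I) \<in> sets (LM I)"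
    by (rule measurable_sets[rotated])
  also have "(\<lambda>x. x) -` (\<Inter>y\<in>B. {x :: 'i \<Rightarrow> real. (\<Sum>i\<in>I. x i * y i) \<le> 1}) \<inter> space (LM I) = polar_of I B"
    by (auto simp: polar_of_def)
  finally show ?thesis .
qed

lemma polar_of_uminus:
  assumes "\<And>y. y \<in> B \<Longrightarrow> (\<lambda>i\<in>I. - y i) \<in> B" "x \<in> polar_of I B"
  shows "(\<lambda>i\<in>I. - x i) \<in> polar_of I B"
proof -
  have "(\<Sum>i\<in>I. (\<lambda>i\<in>I. - x i) i * y i) \<le> 1" if "y \<in> B" for y
  proof -
    have "(\<Sum>i\<in>I. x i * (\<lambda>i\<in>I. - y i) i) \<le> 1"
      using assms(1)[OF that] assms(2) unfolding polar_of_def by blast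
    then show ?thesis by simp
  qed
  then show ?thesis by (auto simp: polar_of_def)
qed

lemma polar_of_flip:
  assumes "finite I" "j \<in> I" "\<And>y. y \<in> B \<Longrightarrow> y(j := - y j) \<in> B" "x \<in> polar_of I B"
  shows "x(j := - x j) \<in> polar_of I B"
proof -
  have "(\<Sum>i\<in>I. (x(j := - x j)) i * y i) \<le> 1" if "y \<in> B" for y
  proof -
    have "(\<Sum>i\<in>I. x i * (y(j := - y j)) i) \<le> 1"
      using assms(3)[OF that] assms(4) unfolding polar_of_def by blast
    also have "(\<Sum>i\<in>I. x i * (y(j := - y j)) i) = (\<Sum>i\<in>I. (x(j := - x j)) i * y i)"
      by (intro sum.cong) auto
    finally show ?thesis .
  qed
  then show ?thesis using assms by (auto simp: polar_of_def extensional_def)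
qed

lemma ennreal_le_of_square_le:
  fixes a b :: ennreal
  assumes "a * a \<le> b\<^sup>2"
  shows "a \<le> b"
proof (rule ccontr)
  assume "\<not> a \<le> b"
  then have "b < a" by simp
  then obtain y where y: "b = ennreal y" "y \<ge> 0" by (cases b) auto
  show False
  proof (cases a)
    case (real x)
    then have "y < x" using \<open>b < a\<close> y by (simp add: ennreal_less_iff)
    then have "y * y < x * x" using y by (intro mult_strict_mono) auto
    then show False using assms y real by (simp add: power2_eq_square flip: ennreal_mult)
  qed (use assms y in \<open>simp add: power2_eq_square ennreal_top_mult top_unique flip: ennreal_mult\<close>)
qed

text \<open>Steiner symmetrization of \<open>A\<close> in the coordinate \<open>j\<close> (Meyer-Pajor): the slices at height \<open>t\<close> of the
  new polar contain the midpoints of the slices of \<open>B\<close> at heights \<open>t\<close> and \<open>- t\<close>, and these two have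
  the same volume because \<open>B\<close> is symmetric. Passing to polars keeps all sets measurable.\<close>

lemma symmetrize_step:
  fixes I :: "'i :: countable set" and A B :: "('i \<Rightarrow> real) set"
  assumes I: "finite I" "j \<notin> I"
    and A: "A \<in> sets (LM (insert j I))" and B: "B \<in> sets (LM (insert j I))"
    and sym: "\<And>y. y \<in> B \<Longrightarrow> (\<lambda>i\<in>insert j I. - y i) \<in> B"
    and le1: "\<And>x y. x \<in> A \<Longrightarrow> y \<in> B \<Longrightarrow> (\<Sum>i\<in>insert j I. x i * y i) \<le> 1"
    and flip: "\<And>i y. i \<in> J \<Longrightarrow> y \<in> B \<Longrightarrow> y(i := - y i) \<in> B" and J: "J \<subseteq> I"
  obtains A1 B1 where
    "A1 \<in> sets (LM (insert j I))" "B1 \<in> sets (LM (insert j I))"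
    "\<And>y. y \<in> B1 \<Longrightarrow> (\<lambda>i\<in>insert j I. - y i) \<in> B1"
    "\<And>x y. x \<in> A1 \<Longrightarrow> y \<in> B1 \<Longrightarrow> (\<Sum>i\<in>insert j I. x i * y i) \<le> 1"
    "\<And>i y. i \<in> insert j J \<Longrightarrow> y \<in> B1 \<Longrightarrow> y(i := - y i) \<in> B1"
    "emeasure (LM (insert j I)) A \<le> emeasure (LM (insert j I)) A1"
    "emeasure (LM (insert j I)) B \<le> emeasure (LM (insert j I)) B1"
proof -
  let ?I = "insert j I"
  \<comment> \<open>For \<open>z j = - y j\<close> this is the midpoint of \<open>y\<close> and of
    the reflection of \<open>z\<close> in the hyperplane where coordinate \<open>j\<close> vanishes.
    \<open>B1\<close> is the bipolar of the set \<open>C\<close> of these midpoints.\<close>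
  define mix where "mix y z = (\<lambda>i\<in>?I. if i = j then y j else (y i + z i) / 2)" for y z :: "'i \<Rightarrow> real"
  define C where "C = {mix y z | y z. y \<in> B \<and> z \<in> B \<and> z j = - y j}"
  define A1 where "A1 = polar_of ?I C"
  define B1 where "B1 = polar_of ?I A1"
  have ext: "y \<in> extensional ?I" if "y \<in> B \<or> y \<in> A" for y
    using that sets.sets_into_space[OF B] sets.sets_into_space[OF A] by auto
  have CB1: "C \<subseteq> B1"
  proof
    fix z assume z: "z \<in> C"
    then have "z \<in> extensional ?I" by (auto simp: C_def mix_def)
    moreover have "(\<Sum>i\<in>?I. z i * x i) \<le> 1" if "x \<in> A1" for x
      using that z unfolding A1_def polar_of_def by (subst mult.commute) blast
    ultimately show "z \<in> B1" unfolding B1_def polar_of_def by blast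
  qed
  have C_sym: "(\<lambda>i\<in>?I. - y i) \<in> C" if "y \<in> C" for y
  proof -
    obtain u v where uv: "y = mix u v" "u \<in> B" "v \<in> B" "v j = - u j"
      using \<open>y \<in> C\<close> by (auto simp: C_def)
    have "(\<lambda>i\<in>?I. - y i) = mix (\<lambda>i\<in>?I. - u i) (\<lambda>i\<in>?I. - v i)"
      by (auto simp: uv mix_def fun_eq_iff field_simps)
    moreover have "(\<lambda>i\<in>?I. - u i) \<in> B" "(\<lambda>i\<in>?I. - v i) \<in> B" "(\<lambda>i\<in>?I. - v i) j = - (\<lambda>i\<in>?I. - u i) j"
      using uv sym by auto
    ultimately show ?thesis unfolding C_def by blast
  qed
  have C_flip: "y(i := - y i) \<in> C" if "y \<in> C" "i \<in> insert j J" for i y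
  proof -
    obtain u v where uv: "y = mix u v" "u \<in> B" "v \<in> B" "v j = - u j"
      using \<open>y \<in> C\<close> by (auto simp: C_def)
    show ?thesis
    proof (cases "i = j")
      case True
      have "y(i := - y i) = mix v u"
        using uv True by (auto simp: mix_def fun_eq_iff)
      moreover have "u j = - v j" using uv by simp
      ultimately show ?thesis
        using uv unfolding C_def by blast
    next
      case False
      then have i: "i \<in> J" "i \<in> I" using that J by auto
      have "y(i := - y i) = mix (u(i := - u i)) (v(i := - v i))"
        using uv False i by (auto simp: mix_def fun_eq_iff field_simps)
      then show ?thesis
        using uv False flip[OF i(1)] unfolding C_def by fastforce
    qed
  qed
  have meas: "A1 \<in> sets (LM ?I)" "B1 \<in> sets (LM ?I)"
    by (auto simp: A1_def B1_def sets_polar_of)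
  \<comment> \<open>Average the pairings of \<open>x(j := s)\<close> with \<open>y\<close> and of
    \<open>x(j := t)\<close> with \<open>z\<close>: as \<open>z j = - y j\<close>, the terms at
    \<open>j\<close> combine to \<open>(s - t) / 2 * y j\<close>. Each line slice of
    \<open>A1\<close> thus contains the midpoints of the slice of \<open>A\<close> and its negative,
    and is at least as long.\<close>
  have A1_mid: "x(j := (s - t) / 2) \<in> A1"
    if "x(j := s) \<in> A" "x(j := t) \<in> A" "x \<in> extensional I" for x s t
  proof -
    have "(\<Sum>i\<in>?I. (x(j := (s - t) / 2)) i * mix y z i) \<le> 1"
      if yz: "y \<in> B" "z \<in> B" "z j = - y j" for y z
    proof -
      have eq: "(\<Sum>i\<in>?I. (x(j := r)) i * w i) = r * w j + (\<Sum>i\<in>I. x i * w i)" for r w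
        using I by (simp, intro sum.cong) auto
      have "(\<Sum>i\<in>I. x i * mix y z i) = (\<Sum>i\<in>I. x i * y i / 2 + x i * z i / 2)"
        using I by (intro sum.cong) (auto simp: mix_def field_simps)
      also have "\<dots> = (\<Sum>i\<in>I. x i * y i) / 2 + (\<Sum>i\<in>I. x i * z i) / 2"
        by (simp add: sum.distrib sum_divide_distrib)
      finally show ?thesis
        using le1[OF \<open>x(j := s) \<in> A\<close> yz(1)] le1[OF \<open>x(j := t) \<in> A\<close> yz(2)] yz(3)
        unfolding eq by (simp add: mix_def field_simps)
    qed
    moreover have "x(j := (s - t) / 2) \<in> extensional ?I"
      using that(3) by (auto simp: extensional_def)
    ultimately show ?thesis
      unfolding A1_def polar_of_def C_def by auto
  qed
  have "emeasure (LM ?I) A \<le> emeasure (LM ?I) A1"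
  proof (subst (1 2) emeasure_LM_insert(1)[OF I], (fact A meas)+, rule nn_integral_mono)
    fix x :: "'i \<Rightarrow> real" assume "x \<in> space (LM I)"
    then have x: "x \<in> extensional I" by simp
    let ?S = "{s. x(j := s) \<in> A}" and ?S1 = "{s. x(j := s) \<in> A1}"
    have S: "?S \<in> sets borel" "?S1 \<in> sets borel"
      using sets_LM_insert_section(1)[OF A x I(2)] sets_LM_insert_section(1)[OF meas(1) x I(2)] by auto
    show "emeasure lborel ?S \<le> emeasure lborel ?S1"
    proof (cases "?S = {}")
      case False
      have "uminus -` ?S \<in> sets borel" using measurable_sets[OF _ S(1), of uminus borel] by simp
      moreover have "uminus -` ?S \<noteq> {}" using False by (auto intro: exI[of _ "- _"])
      ultimately have "emeasure lborel ?S + emeasure lborel (uminus -` ?S) \<le> 2 * emeasure lborel ?S1"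
        using S False A1_mid[OF _ _ x] by (intro emeasure_lborel_midpoint) (auto, fastforce)
      then have "2 * emeasure lborel ?S \<le> 2 * emeasure lborel ?S1"
        unfolding emeasure_lborel_vimage_uminus[OF S(1)] by (simp add: mult_2)
      then show ?thesis by (simp add: ennreal_mult_le_mult_iff)
    qed (metis emeasure_empty zero_le)
  qed
  moreover have "emeasure (LM ?I) B \<le> emeasure (LM ?I) B1"
  proof (subst (1 2) emeasure_LM_insert(2)[OF I], (fact B meas)+, rule nn_integral_mono)
    fix t :: real
    let ?T = "\<lambda>t. {x \<in> extensional I. x(j := t) \<in> B}" and ?T1 = "{x \<in> extensional I. x(j := t) \<in> B1}"
    have T: "?T t \<in> sets (LM I)" "?T (- t) \<in> sets (LM I)" "?T1 \<in> sets (LM I)"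
      using sets_LM_insert_section(2)[OF B] sets_LM_insert_section(2)[OF meas(2)] by auto
    have "emeasure (LM I) (?T t) * emeasure (LM I) (?T (- t)) \<le> (emeasure (LM I) ?T1)\<^sup>2"
    proof -
      have "(\<integral>\<^sup>+x. indicator (?T t) x \<partial>LM I) * (\<integral>\<^sup>+x. indicator (?T (- t)) x \<partial>LM I)
        \<le> (\<integral>\<^sup>+x. indicator ?T1 x \<partial>LM I)\<^sup>2"
      proof (rule prekopa_leindler_PiM[OF I(1)])
        fix x y :: "'i \<Rightarrow> real" assume xy: "x \<in> extensional I" "y \<in> extensional I"
        have "(\<lambda>i\<in>I. (x i + y i) / 2) \<in> ?T1" if "x \<in> ?T t" "y \<in> ?T (- t)"
        proof -
          have "mix (x(j := t)) (y(j := - t)) \<in> C"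
          proof -
            have "(y(j := - t)) j = - (x(j := t)) j" by simp
            then show ?thesis using that unfolding C_def by blast
          qed
          also have "mix (x(j := t)) (y(j := - t)) = (\<lambda>i\<in>I. (x i + y i) / 2)(j := t)"
            using I by (auto simp: mix_def fun_eq_iff)
          finally have "(\<lambda>i\<in>I. (x i + y i) / 2)(j := t) \<in> B1" using CB1 by blast
          then show ?thesis by simp
        qed
        then show "indicator (?T t) x * indicator (?T (- t)) y
          \<le> (indicator ?T1 (\<lambda>i\<in>I. (x i + y i) / 2) :: ennreal)\<^sup>2"
          by (auto simp: indicator_def)
      qed (use T in auto)
      then show ?thesis using T by simp
    qed
    also have "?T t = {x \<in> extensional I. (\<lambda>i\<in>I. - x i) \<in> ?T (- t)}"
    proof -
      have "x(j := t) \<in> B \<longleftrightarrow> (\<lambda>i\<in>I. - x i)(j := - t) \<in> B" if x: "x \<in> extensional I" for x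
      proof -
        have "(\<lambda>i\<in>?I. - (x(j := t)) i) = (\<lambda>i\<in>I. - x i)(j := - t)"
          using I by (auto simp: fun_eq_iff)
        moreover have "(\<lambda>i\<in>?I. - ((\<lambda>i\<in>I. - x i)(j := - t)) i) = x(j := t)"
          using I x by (auto simp: fun_eq_iff extensional_def)
        ultimately show ?thesis using sym by metis
      qed
      then show ?thesis by auto
    qed
    also have "emeasure (LM I) \<dots> = emeasure (LM I) (?T (- t))"
      using emeasure_LM_uminus[OF I(1) T(2)] by simp
    finally have "emeasure (LM I) (?T (- t)) \<le> emeasure (LM I) ?T1"
      by (rule ennreal_le_of_square_le)
    then show "emeasure (LM I) (?T t) \<le> emeasure (LM I) ?T1"
      using emeasure_LM_uminus[OF I(1) T(2)]
        \<open>?T t = {x \<in> extensional I. (\<lambda>i\<in>I. - x i) \<in> ?T (- t)}\<close> by simp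
  qed
  moreover have "(\<lambda>i\<in>?I. - y i) \<in> B1" if "y \<in> B1" for y
    using that unfolding B1_def A1_def by (intro polar_of_uminus C_sym)
  moreover have "y(i := - y i) \<in> B1" if "i \<in> insert j J" "y \<in> B1" for i y
    using that J I C_flip unfolding B1_def A1_def by (intro polar_of_flip) auto
  moreover have "(\<Sum>i\<in>?I. x i * y i) \<le> 1" if "x \<in> A1" "y \<in> B1" for x y
    using that by (auto simp: B1_def polar_of_def mult.commute)
  ultimately show ?thesis
    using that[OF meas] by blast
qed

text \<open>One coordinate at a time: \<open>symmetrize_step\<close> keeps the reflections already
  gained. With \<open>J = I\<close> the second set becomes unconditional.\<close>

lemma symmetrize:
  fixes I :: "'i :: countable set" and A B :: "('i \<Rightarrow> real) set"
  assumes "finite I" and "A \<in> sets (LM I)" "B \<in> sets (LM I)"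
    and "\<And>y. y \<in> B \<Longrightarrow> (\<lambda>i\<in>I. - y i) \<in> B"
    and "\<And>x y. x \<in> A \<Longrightarrow> y \<in> B \<Longrightarrow> (\<Sum>i\<in>I. x i * y i) \<le> 1"
    and "finite J" "J \<subseteq> I"
  shows "\<exists>A1 B1. A1 \<in> sets (LM I) \<and> B1 \<in> sets (LM I) \<and>
    (\<forall>y\<in>B1. (\<lambda>i\<in>I. - y i) \<in> B1) \<and> (\<forall>x\<in>A1. \<forall>y\<in>B1. (\<Sum>i\<in>I. x i * y i) \<le> 1) \<and>
    (\<forall>i\<in>J. \<forall>y\<in>B1. y(i := - y i) \<in> B1) \<and>
    emeasure (LM I) A \<le> emeasure (LM I) A1 \<and> emeasure (LM I) B \<le> emeasure (LM I) B1"
  using assms(6,7)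
proof (induction J rule: finite_induct)
  case empty
  have "\<forall>y\<in>B. (\<lambda>i\<in>I. - y i) \<in> B" "\<forall>x\<in>A. \<forall>y\<in>B. (\<Sum>i\<in>I. x i * y i) \<le> 1"
    using assms(4,5) by blast+
  then show ?case using assms(2,3) by blast
next
  case (insert j J)
  obtain A1 B1 where 1: "A1 \<in> sets (LM I)" "B1 \<in> sets (LM I)"
    "\<And>y. y \<in> B1 \<Longrightarrow> (\<lambda>i\<in>I. - y i) \<in> B1" "\<And>x y. x \<in> A1 \<Longrightarrow> y \<in> B1 \<Longrightarrow> (\<Sum>i\<in>I. x i * y i) \<le> 1"
    "\<And>i y. i \<in> J \<Longrightarrow> y \<in> B1 \<Longrightarrow> y(i := - y i) \<in> B1"
    "emeasure (LM I) A \<le> emeasure (LM I) A1" "emeasure (LM I) B \<le> emeasure (LM I) B1"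
  proof -
    have "J \<subseteq> I" using insert.prems by simp
    from insert.IH[OF this] show ?thesis by (elim exE conjE) (rule that; blast)
  qed
  have I: "insert j (I - {j}) = I" "finite (I - {j})" "j \<notin> I - {j}" "J \<subseteq> I - {j}"
    using insert.hyps insert.prems assms(1) by auto
  obtain A2 B2 where 2: "A2 \<in> sets (LM I)" "B2 \<in> sets (LM I)"
    "\<And>y. y \<in> B2 \<Longrightarrow> (\<lambda>i\<in>I. - y i) \<in> B2" "\<And>x y. x \<in> A2 \<Longrightarrow> y \<in> B2 \<Longrightarrow> (\<Sum>i\<in>I. x i * y i) \<le> 1"
    "\<And>i y. i \<in> insert j J \<Longrightarrow> y \<in> B2 \<Longrightarrow> y(i := - y i) \<in> B2"
    "emeasure (LM I) A1 \<le> emeasure (LM I) A2" "emeasure (LM I) B1 \<le> emeasure (LM I) B2"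
    using symmetrize_step[OF I(2,3), unfolded I(1), OF 1(1-5) I(4)] by blast
  show ?case
    by (rule exI[of _ A2], rule exI[of _ B2])
      (intro conjI ballI 2 order_trans[OF 1(6)] order_trans[OF 1(7)])
qed

section \<open>Volume product of unconditional sets\<close>

lemma nn_integral_exp_abs_le:
  assumes "b > 0"
  shows "(\<integral>\<^sup>+s. ennreal (exp (- b * \<bar>s\<bar>)) \<partial>lborel) \<le> ennreal (2 / b)"
proof -
  let ?e = "\<lambda>s. ennreal (exponential_density b s)"
  have one: "(\<integral>\<^sup>+s. ?e s \<partial>lborel) = 1"
    using prob_space.emeasure_space_1[OF prob_space_exponential_density[OF assms]]
    by (simp add: emeasure_density)
  have "(\<integral>\<^sup>+s. ?e s \<partial>distr lborel borel uminus) = (\<integral>\<^sup>+s. ?e (- s) \<partial>lborel)"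
    by (subst nn_integral_distr) auto
  then have one': "(\<integral>\<^sup>+s. ?e (- s) \<partial>lborel) = 1"
    using one by (simp add: lborel_distr_uminus)
  have "(\<integral>\<^sup>+s. ennreal (exp (- b * \<bar>s\<bar>)) \<partial>lborel)
    \<le> (\<integral>\<^sup>+s. ennreal (1 / b) * (?e s + ?e (- s)) \<partial>lborel)"
  proof (rule nn_integral_mono)
    fix s
    have "exp (- b * \<bar>s\<bar>) \<le> 1 / b * (exponential_density b s + exponential_density b (- s))"
      using assms by (auto simp: exponential_density_def abs_if field_simps)
    then have "ennreal (exp (- b * \<bar>s\<bar>)) \<le> ennreal (1 / b * (exponential_density b s + exponential_density b (- s)))"
      by (rule ennreal_leI)
    also have "\<dots> = ennreal (1 / b) * (?e s + ?e (- s))"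
      using assms by (subst ennreal_mult) (auto simp: exponential_density_def)
    finally show "ennreal (exp (- b * \<bar>s\<bar>)) \<le> ennreal (1 / b) * (?e s + ?e (- s))" .
  qed
  also have "\<dots> = ennreal (1 / b) * ((\<integral>\<^sup>+s. ?e s \<partial>lborel) + (\<integral>\<^sup>+s. ?e (- s) \<partial>lborel))"
    by (simp add: nn_integral_cmult nn_integral_add)
  also have "\<dots> = ennreal (2 / b)"
    using assms by (simp add: one one' flip: ennreal_mult' ennreal_numeral)
  finally show ?thesis .
qed

text \<open>Exponential Markov bound: the indicator is at most
  \<open>exp (r - (\<Sum>i\<in>I. b i * \<bar>x i\<bar>))\<close>, whose integral factors over the
  coordinates.\<close>

lemma emeasure_cross_polytope_le:
  fixes b :: "'i \<Rightarrow> real"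
  assumes I: "finite I" and b: "\<And>i. i \<in> I \<Longrightarrow> b i > 0"
    and sub: "A \<subseteq> {x \<in> extensional I. (\<Sum>i\<in>I. b i * \<bar>x i\<bar>) \<le> r}"
  shows "emeasure (LM I) A \<le> ennreal (exp r * (\<Prod>i\<in>I. 2 / b i))"
proof -
  interpret product_sigma_finite "\<lambda>_::'i. lborel :: real measure" by standard
  let ?S = "{x \<in> space (LM I). (\<Sum>i\<in>I. b i * \<bar>x i\<bar>) \<le> r}"
  have S: "?S \<in> sets (LM I)" by measurable
  have "emeasure (LM I) A \<le> emeasure (LM I) ?S"
    using sub S by (intro emeasure_mono) auto
  also have "\<dots> = (\<integral>\<^sup>+x. indicator ?S x \<partial>LM I)"
    using S by simp
  also have "\<dots> \<le> (\<integral>\<^sup>+x. ennreal (exp r) * (\<Prod>i\<in>I. ennreal (exp (- b i * \<bar>x i\<bar>))) \<partial>LM I)"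
  proof (rule nn_integral_mono)
    fix x :: "'i \<Rightarrow> real"
    have "(\<Prod>i\<in>I. ennreal (exp (- b i * \<bar>x i\<bar>))) = ennreal (exp (\<Sum>i\<in>I. - b i * \<bar>x i\<bar>))"
      using I by (simp add: prod_ennreal exp_sum)
    then have "ennreal (exp r) * (\<Prod>i\<in>I. ennreal (exp (- b i * \<bar>x i\<bar>))) = ennreal (exp (r - (\<Sum>i\<in>I. b i * \<bar>x i\<bar>)))"
      by (simp add: sum_negf exp_diff exp_minus divide_inverse flip: ennreal_mult)
    then show "indicator ?S x \<le> ennreal (exp r) * (\<Prod>i\<in>I. ennreal (exp (- b i * \<bar>x i\<bar>)))"
      by (auto simp: indicator_def one_ennreal_def[symmetric] intro!: ennreal_leI simp flip: ennreal_1)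
  qed
  also have "\<dots> = ennreal (exp r) * (\<integral>\<^sup>+x. (\<Prod>i\<in>I. ennreal (exp (- b i * \<bar>x i\<bar>))) \<partial>LM I)"
    by (rule nn_integral_cmult) measurable
  also have "(\<integral>\<^sup>+x. (\<Prod>i\<in>I. ennreal (exp (- b i * \<bar>x i\<bar>))) \<partial>LM I)
    = (\<Prod>i\<in>I. \<integral>\<^sup>+s. ennreal (exp (- b i * \<bar>s\<bar>)) \<partial>lborel)"
    using I by (intro product_nn_integral_prod) auto
  also have "\<dots> \<le> (\<Prod>i\<in>I. ennreal (2 / b i))"
    using b by (intro prod_mono_ennreal nn_integral_exp_abs_le)
  also have "\<dots> = ennreal (\<Prod>i\<in>I. 2 / b i)"
    using b by (intro prod_ennreal) (auto intro: less_imp_le)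
  finally show ?thesis
    by (simp add: mult_left_mono ennreal_mult')
qed

lemma emeasure_LM_coordinate_hyperplanes:
  fixes A :: "('i \<Rightarrow> real) set"
  assumes I: "finite I" and A: "\<And>x. x \<in> A \<Longrightarrow> x \<in> extensional I \<and> (\<exists>i\<in>I. x i = 0)"
  shows "emeasure (LM I) A = 0"
proof -
  interpret product_sigma_finite "\<lambda>_::'i. lborel :: real measure" by standard
  have null: "Pi\<^sub>E I (\<lambda>j. if j = i then {0} else UNIV) \<in> null_sets (LM I)" if "i \<in> I" for i
  proof -
    have "emeasure (LM I) (Pi\<^sub>E I (\<lambda>j. if j = i then {0} else UNIV)) = 0"
      using that I by (subst emeasure_PiM) (auto intro!: bexI[of _ i])
    then show ?thesis using I by (auto intro!: null_setsI sets_PiM_I_finite)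
  qed
  have "(\<Union>i\<in>I. Pi\<^sub>E I (\<lambda>j. if j = i then {0} else UNIV)) \<in> null_sets (LM I)"
    using I null by (intro null_sets_UN' countable_finite) auto
  moreover have "A \<subseteq> (\<Union>i\<in>I. Pi\<^sub>E I (\<lambda>j. if j = i then {0} else UNIV))"
    using A by (fastforce simp: PiE_iff)
  ultimately show ?thesis
    by (metis emeasure_eq_0 null_setsD1 null_setsD2)
qed

lemma flips_abs:
  fixes A :: "('i \<Rightarrow> real) set"
  assumes I: "finite I" and A: "A \<subseteq> extensional I" "\<And>i x. i \<in> I \<Longrightarrow> x \<in> A \<Longrightarrow> x(i := - x i) \<in> A"
    and x: "x \<in> A"
  shows "(\<lambda>i\<in>I. \<bar>x i\<bar>) \<in> A"
proof -
  have "(\<lambda>i. if i \<in> J then \<bar>x i\<bar> else x i) \<in> A" if "finite J" "J \<subseteq> I" for J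
    using that
  proof (induction J rule: finite_induct)
    case (insert j J)
    let ?y = "\<lambda>i. if i \<in> J then \<bar>x i\<bar> else x i"
    have y: "?y \<in> A" "?y(j := - ?y j) \<in> A" using insert A(2)[of j ?y] by auto
    have "(\<lambda>i. if i \<in> insert j J then \<bar>x i\<bar> else x i) = (if x j \<ge> 0 then ?y else ?y(j := - ?y j))"
      using insert.hyps by (auto simp: fun_eq_iff)
    then show ?case using y by presburger
  qed (use x in simp)
  from this[OF I] have "(\<lambda>i. if i \<in> I then \<bar>x i\<bar> else x i) \<in> A" by simp
  also have "(\<lambda>i. if i \<in> I then \<bar>x i\<bar> else x i) = (\<lambda>i\<in>I. \<bar>x i\<bar>)"
    using A(1) x by (auto simp: fun_eq_iff extensional_def)
  finally show ?thesis .
qed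

lemma one_plus_sum_le_prod:
  fixes u :: "'i \<Rightarrow> real"
  assumes "\<And>i. i \<in> I \<Longrightarrow> u i \<ge> 0"
  shows "1 + (\<Sum>i\<in>I. u i) \<le> (\<Prod>i\<in>I. 1 + u i)"
  using assms
proof (induction I rule: infinite_finite_induct)
  case (insert i I)
  have "1 + (u i + sum u I) \<le> (1 + u i) * (1 + sum u I)"
    using insert sum_nonneg[of I u] by (simp add: algebra_simps)
  also have "\<dots> \<le> (1 + u i) * (\<Prod>i\<in>I. 1 + u i)"
    using insert by (intro mult_left_mono) auto
  finally show ?case using insert by simp
qed auto

text \<open>If \<open>a\<close> almost maximizes the product of the coordinates over an unconditional convex set, then
  moving from \<open>a\<close> towards another point shows that the set lies in a cross polytope with semi-axes
  comparable to \<open>n a i\<close>.\<close>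

lemma santalo_unconditional:
  fixes I :: "'i set" and A B :: "('i \<Rightarrow> real) set"
  defines "n \<equiv> real (card I)"
  assumes I: "finite I" "I \<noteq> {}" and A: "A = polar_of I B"
    and B: "B \<subseteq> extensional I" "\<And>i y. i \<in> I \<Longrightarrow> y \<in> B \<Longrightarrow> y(i := - y i) \<in> B"
  shows "emeasure (LM I) A * emeasure (LM I) B \<le> ennreal ((4 * exp 7 / n) ^ card I)"
\<comment> \<open>A set without such a point lies in the coordinate hyperplanes and is null.
  Otherwise \<open>y0\<close> bounds the product of coordinates on \<open>A\<close> and
  \<open>x0\<close> makes its supremum positive.\<close>
proof (cases "(\<exists>x\<in>A. \<forall>i\<in>I. x i \<noteq> 0) \<and> (\<exists>y\<in>B. \<forall>i\<in>I. y i \<noteq> 0)")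
  case False
  then have "emeasure (LM I) A = 0 \<or> emeasure (LM I) B = 0"
  proof (elim de_Morgan_conj[THEN iffD1, THEN disjE])
    assume "\<not> (\<exists>x\<in>A. \<forall>i\<in>I. x i \<noteq> 0)"
    then have "emeasure (LM I) A = 0"
      by (intro emeasure_LM_coordinate_hyperplanes[OF I(1)]) (auto simp: A polar_of_def)
    then show ?thesis ..
  next
    assume "\<not> (\<exists>y\<in>B. \<forall>i\<in>I. y i \<noteq> 0)"
    then have "emeasure (LM I) B = 0"
      using B(1) by (intro emeasure_LM_coordinate_hyperplanes[OF I(1)]) auto
    then show ?thesis ..
  qed
  then show ?thesis by auto
next
  case True
  then obtain x0 y0 where x0: "x0 \<in> A" "\<And>i. i \<in> I \<Longrightarrow> x0 i \<noteq> 0" and y0: "y0 \<in> B" "\<And>i. i \<in> I \<Longrightarrow> y0 i \<noteq> 0"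
    by blast
  have n: "n \<ge> 1" using I by (simp add: n_def Suc_le_eq card_gt_0_iff)
  have A_ext: "A \<subseteq> extensional I" by (auto simp: A polar_of_def)
  have A_flip: "x(i := - x i) \<in> A" if "i \<in> I" "x \<in> A" for i x
    using that B(2) unfolding A by (intro polar_of_flip[OF I(1)]) auto
  have absA: "(\<lambda>i\<in>I. \<bar>x i\<bar>) \<in> A" if "x \<in> A" for x
    using flips_abs[OF I(1) A_ext A_flip that] by simp
  have pair: "(\<Sum>i\<in>I. \<bar>x i\<bar> * \<bar>y i\<bar>) \<le> 1" if "x \<in> A" "y \<in> B" for x y
  proof -
    have "(\<Sum>i\<in>I. (\<lambda>i\<in>I. \<bar>x i\<bar>) i * (\<lambda>i\<in>I. \<bar>y i\<bar>) i) \<le> 1"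
      using absA[OF that(1)] flips_abs[OF I(1) B that(2)] unfolding A polar_of_def by blast
    then show ?thesis by simp
  qed
  define P where "P x = (\<Prod>i\<in>I. \<bar>x i\<bar>)" for x :: "'i \<Rightarrow> real"
  have P_le: "P x \<le> (\<Prod>i\<in>I. 1 / \<bar>y0 i\<bar>)" if "x \<in> A" for x
    unfolding P_def
  proof (rule prod_mono)
    fix i assume i: "i \<in> I"
    have "\<bar>x i\<bar> * \<bar>y0 i\<bar> \<le> (\<Sum>i\<in>I. \<bar>x i\<bar> * \<bar>y0 i\<bar>)"
      using i I by (intro member_le_sum) auto
    also have "\<dots> \<le> 1" using pair[OF that y0(1)] .
    finally show "0 \<le> \<bar>x i\<bar> \<and> \<bar>x i\<bar> \<le> 1 / \<bar>y0 i\<bar>" using y0(2)[OF i] by (simp add: field_simps)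
  qed
  then have bdd: "bdd_above (P ` A)" by (rule bdd_aboveI2)
  define V where "V = (SUP x\<in>A. P x)"
  have PV: "P x \<le> V" if "x \<in> A" for x unfolding V_def using that bdd by (rule cSUP_upper)
  have "P x0 > 0" unfolding P_def using x0 by (intro prod_pos) auto
  then have "V > 0" using PV[OF x0(1)] by simp
  then have "V / 2 < V" by simp
  \<comment> \<open>Attainment up to a factor 2 spares a compactness argument for
    \<open>A\<close>.\<close>
  then obtain a where a: "a \<in> A" "V / 2 < P a"
    using less_cSUP_iff[OF _ bdd] x0(1) unfolding V_def by blast
  then have Pa: "P a > 0" using \<open>V > 0\<close> by simp
  have a_pos: "\<bar>a i\<bar> > 0" if "i \<in> I" for i
  proof (rule ccontr)
    assume "\<not> \<bar>a i\<bar> > 0"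
    then have "P a = 0" unfolding P_def using that I(1) by (intro prod_zero) auto
    then show False using Pa by simp
  qed
  have sum_le: "(\<Sum>i\<in>I. 1 / \<bar>a i\<bar> * \<bar>x i\<bar>) \<le> 6 * n" if x: "x \<in> A" for x
  proof -
    \<comment> \<open>By Bernoulli \<open>(1 - l) ^ n\<close> is at least 1/2, so the
      near-maximality of \<open>a\<close> bounds \<open>1 + sum u I\<close> by 4, and
      \<open>3 / l = 6 * n\<close> is the bound claimed.\<close>
    define l where "l = 1 / (2 * n)"
    have l: "0 < l" "l \<le> 1 / 2" using n by (auto simp: l_def field_simps)
    define z where "z = (\<lambda>i\<in>I. (1 - l) * \<bar>a i\<bar> + l * \<bar>x i\<bar>)"
    have "z \<in> A"
    proof -
      have "(\<Sum>i\<in>I. z i * y i) \<le> 1" if y: "y \<in> B" for y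
      proof -
        have "(\<Sum>i\<in>I. z i * y i) = (1 - l) * (\<Sum>i\<in>I. \<bar>a i\<bar> * y i) + l * (\<Sum>i\<in>I. \<bar>x i\<bar> * y i)"
          by (simp add: z_def sum_distrib_left sum.distrib[symmetric] algebra_simps)
        also have "\<dots> \<le> (1 - l) * (\<Sum>i\<in>I. \<bar>a i\<bar> * \<bar>y i\<bar>) + l * (\<Sum>i\<in>I. \<bar>x i\<bar> * \<bar>y i\<bar>)"
          using l by (intro add_mono mult_left_mono sum_mono) auto
        also have "\<dots> \<le> (1 - l) * 1 + l * 1"
          using l pair[OF a(1) y] pair[OF x y] by (intro add_mono mult_left_mono) auto
        finally show ?thesis by simp
      qed
      then show ?thesis by (auto simp: A polar_of_def z_def)
    qed
    define u where "u i = l / (1 - l) * (\<bar>x i\<bar> / \<bar>a i\<bar>)" for i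
    have u: "u i \<ge> 0" for i using l by (auto simp: u_def)
    have "(1 - l) ^ card I * (1 + (\<Sum>i\<in>I. u i)) \<le> (1 - l) ^ card I * (\<Prod>i\<in>I. 1 + u i)"
      using l u by (intro mult_left_mono one_plus_sum_le_prod) auto
    also have "\<dots> * P a = (\<Prod>i\<in>I. (1 - l) * (1 + u i) * \<bar>a i\<bar>)"
      by (simp add: prod.distrib P_def)
    also have "\<dots> = P z"
      unfolding P_def
    proof (rule prod.cong[OF refl])
      fix i assume i: "i \<in> I"
      have "(1 - l) * (1 + u i) * \<bar>a i\<bar> = z i"
        using a_pos[OF i] l i by (simp add: u_def z_def field_simps)
      moreover have "z i \<ge> 0" using i l by (simp add: z_def)
      ultimately show "(1 - l) * (1 + u i) * \<bar>a i\<bar> = \<bar>z i\<bar>" by simp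
    qed
    finally have "(1 - l) ^ card I * (1 + (\<Sum>i\<in>I. u i)) * P a \<le> P z"
      using Pa by (simp add: mult_right_mono)
    also have "\<dots> \<le> 2 * P a" using PV[OF \<open>z \<in> A\<close>] a(2) by simp
    finally have 1: "(1 - l) ^ card I * (1 + (\<Sum>i\<in>I. u i)) \<le> 2" using Pa by simp
    have "1 / 2 = 1 + n * (- l)" using n by (simp add: l_def)
    also have "\<dots> \<le> (1 + (- l)) ^ card I"
      unfolding n_def using l by (intro Bernoulli_inequality) auto
    finally have "1 / 2 \<le> (1 - l) ^ card I" by simp
    then have "1 / 2 * (1 + (\<Sum>i\<in>I. u i)) \<le> (1 - l) ^ card I * (1 + (\<Sum>i\<in>I. u i))"
      using u by (intro mult_right_mono) (auto intro!: add_nonneg_nonneg sum_nonneg)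
    with 1 have 2: "(\<Sum>i\<in>I. u i) \<le> 3" by simp
    have "l * (\<Sum>i\<in>I. 1 / \<bar>a i\<bar> * \<bar>x i\<bar>) \<le> (\<Sum>i\<in>I. u i)"
      unfolding sum_distrib_left u_def
    proof (rule sum_mono)
      fix i
      have "l * (\<bar>x i\<bar> / \<bar>a i\<bar>) \<le> l / (1 - l) * (\<bar>x i\<bar> / \<bar>a i\<bar>)"
        using l by (intro mult_right_mono) (auto simp: field_simps)
      then show "l * (1 / \<bar>a i\<bar> * \<bar>x i\<bar>) \<le> l / (1 - l) * (\<bar>x i\<bar> / \<bar>a i\<bar>)" by simp
    qed
    with 2 have "l * (\<Sum>i\<in>I. 1 / \<bar>a i\<bar> * \<bar>x i\<bar>) \<le> 3" by simp
    then show ?thesis using n by (simp add: l_def field_simps)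
  qed
  have "emeasure (LM I) A \<le> ennreal (exp (6 * n) * (\<Prod>i\<in>I. 2 / (1 / \<bar>a i\<bar>)))"
    using a_pos sum_le A_ext by (intro emeasure_cross_polytope_le[OF I(1)]) auto
  \<comment> \<open>Pairing with \<open>a\<close> puts \<open>B\<close> into a cross polytope of
    level 1. Multiplying weights and level by \<open>n\<close> costs a factor \<open>exp n\<close>
    in the exponential bound but gains the decisive \<open>n ^ n\<close> in the denominator.\<close>
  moreover have "emeasure (LM I) B \<le> ennreal (exp n * (\<Prod>i\<in>I. 2 / (n * \<bar>a i\<bar>)))"
  proof (rule emeasure_cross_polytope_le[OF I(1)])
    show "n * \<bar>a i\<bar> > 0" if "i \<in> I" for i using a_pos[OF that] n by simp
    have "(\<Sum>i\<in>I. n * \<bar>a i\<bar> * \<bar>y i\<bar>) \<le> n" if "y \<in> B" for y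
    proof -
      have "(\<Sum>i\<in>I. n * \<bar>a i\<bar> * \<bar>y i\<bar>) = n * (\<Sum>i\<in>I. \<bar>a i\<bar> * \<bar>y i\<bar>)"
        by (simp add: sum_distrib_left mult.assoc)
      then show ?thesis using pair[OF a(1) that] n by simp
    qed
    then show "B \<subseteq> {x \<in> extensional I. (\<Sum>i\<in>I. n * \<bar>a i\<bar> * \<bar>x i\<bar>) \<le> n}"
      using B(1) by auto
  qed
  ultimately have "emeasure (LM I) A * emeasure (LM I) B
    \<le> ennreal (exp (6 * n) * (\<Prod>i\<in>I. 2 / (1 / \<bar>a i\<bar>))) * ennreal (exp n * (\<Prod>i\<in>I. 2 / (n * \<bar>a i\<bar>)))"
    by (rule mult_mono) auto
  also have "\<dots> = ennreal ((exp (6 * n) * (\<Prod>i\<in>I. 2 / (1 / \<bar>a i\<bar>))) * (exp n * (\<Prod>i\<in>I. 2 / (n * \<bar>a i\<bar>))))"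
    using n by (intro ennreal_mult[symmetric] mult_nonneg_nonneg prod_nonneg) auto
  also have "(exp (6 * n) * (\<Prod>i\<in>I. 2 / (1 / \<bar>a i\<bar>))) * (exp n * (\<Prod>i\<in>I. 2 / (n * \<bar>a i\<bar>)))
    = (exp (6 * n) * exp n) * (\<Prod>i\<in>I. (2 / (1 / \<bar>a i\<bar>)) * (2 / (n * \<bar>a i\<bar>)))"
    unfolding prod.distrib by (simp only: mult_ac)
  also have "(\<Prod>i\<in>I. (2 / (1 / \<bar>a i\<bar>)) * (2 / (n * \<bar>a i\<bar>))) = (\<Prod>i\<in>I. 4 / n)"
    using a_pos n by (intro prod.cong) (auto simp: field_simps)
  also have "exp (6 * n) * exp n = exp 7 ^ card I"
  proof -
    have "exp (6 * n) * exp n = exp (real (card I) * 7)" by (simp add: n_def flip: exp_add)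
    then show ?thesis by (simp only: exp_of_nat_mult)
  qed
  also have "exp 7 ^ card I * (\<Prod>i\<in>I. 4 / n) = (4 * exp 7 / n) ^ card I"
    by (simp add: power_divide power_mult_distrib)
  finally show ?thesis .
qed

text \<open>After symmetrization \<open>A1\<close> lies in the polar of the unconditional
  \<open>B1\<close>, so the unconditional case applies. The sharp bound, the squared volume of the
  unit ball, also has order \<open>(C / n) ^ n\<close>: only an absolute factor per dimension is
  lost.\<close>

theorem santalo_weak:
  fixes I :: "'i :: countable set" and A B :: "('i \<Rightarrow> real) set"
  assumes I: "finite I" "I \<noteq> {}" and A: "A \<in> sets (LM I)" and B: "B \<in> sets (LM I)"
    and sym: "\<And>y. y \<in> B \<Longrightarrow> (\<lambda>i\<in>I. - y i) \<in> B"
    and le1: "\<And>x y. x \<in> A \<Longrightarrow> y \<in> B \<Longrightarrow> (\<Sum>i\<in>I. x i * y i) \<le> 1"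
  shows "emeasure (LM I) A * emeasure (LM I) B \<le> ennreal ((4 * exp 7 / real (card I)) ^ card I)"
proof -
  obtain A1 B1 where 1: "A1 \<in> sets (LM I)" "B1 \<in> sets (LM I)"
    "\<forall>x\<in>A1. \<forall>y\<in>B1. (\<Sum>i\<in>I. x i * y i) \<le> 1" "\<forall>i\<in>I. \<forall>y\<in>B1. y(i := - y i) \<in> B1"
    "emeasure (LM I) A \<le> emeasure (LM I) A1" "emeasure (LM I) B \<le> emeasure (LM I) B1"
    using symmetrize[OF I(1) A B sym le1 I(1) order_refl] by blast
  have "A1 \<subseteq> polar_of I B1"
    using 1(3) sets.sets_into_space[OF 1(1)] by (auto simp: polar_of_def)
  then have "emeasure (LM I) A \<le> emeasure (LM I) (polar_of I B1)"
    using 1(5) emeasure_mono[of A1 "polar_of I B1" "LM I"] sets_polar_of[of I B1] by auto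
  then have "emeasure (LM I) A * emeasure (LM I) B \<le> emeasure (LM I) (polar_of I B1) * emeasure (LM I) B1"
    using 1(6) by (intro mult_mono) auto
  also have "\<dots> \<le> ennreal ((4 * exp 7 / real (card I)) ^ card I)"
    using 1(4) sets.sets_into_space[OF 1(2)] by (intro santalo_unconditional[OF I refl]) auto
  finally show ?thesis .
qed

section \<open>Lebesgue measure on the coordinate subspaces\<close>

lemma coord_sum: "coord (sum f A) i = (\<Sum>a\<in>A. coord (f a) i)"
  by (induction A rule: infinite_finite_induct) auto

definition unit_vec :: "nat \<Rightarrow> fsvec" where
  "unit_vec i = Abs_fsvec (\<lambda>j. if j = i then 1 else 0)"

lemma coord_unit_vec [simp]: "coord (unit_vec i) j = (if j = i then 1 else 0)"
proof -
  have "finite {j. (if j = i then 1 else (0 :: real)) \<noteq> 0}" by auto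
  then show ?thesis by (simp add: unit_vec_def Abs_fsvec_inverse)
qed

lemma unit_vec_Rn: "i < n \<Longrightarrow> unit_vec i \<in> Rn n"
  by (auto simp: Rn_def)

lemma inner_unit_vec: "x \<bullet> unit_vec i = coord x i"
proof -
  have "unit_vec i \<bullet> x = (\<Sum>j<Suc i. coord (unit_vec i) j * coord x j)"
    by (rule inner_Rn) (auto simp: Rn_def)
  then show ?thesis by (simp add: inner_commute)
qed

lemma norm_unit_vec [simp]: "norm (unit_vec i) = 1"
  using inner_unit_vec[of "unit_vec i" i] by (simp add: norm_eq_sqrt_inner)

lemma abs_coord_le_norm: "\<bar>coord x i\<bar> \<le> norm x"
  using Cauchy_Schwarz_ineq2[of x "unit_vec i"] by (simp add: inner_unit_vec)

lemma Rn_expand: "x \<in> Rn n \<Longrightarrow> x = (\<Sum>i<n. coord x i *\<^sub>R unit_vec i)"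
  by (rule fsvec_eqI) (auto simp: coord_sum Rn_def if_distrib cong: if_cong)

lemma in_Rn: "\<exists>n. x \<in> Rn n"
proof -
  obtain n where "\<And>i. coord x i \<noteq> 0 \<Longrightarrow> i < n"
    using finite_nat_bounded[OF finite_coord[of x]] by auto
  then show ?thesis by (intro exI[of _ n]) (force simp: Rn_def)
qed

text \<open>Finite rational combinations of the \<open>unit_vec i\<close> are dense. Second
  countability identifies the Borel sets of pairs with the product sigma-algebra, as Fubini with
  \<open>dist\<close> requires, and it provides Lindelof covers.\<close>

instance fsvec :: second_countable_topology
proof
  define D where "D = range (\<lambda>l :: rat list. \<Sum>i<length l. real_of_rat (l ! i) *\<^sub>R unit_vec i)"
  have dense: "\<exists>d\<in>D. dist d x < e" if e: "e > 0" for x :: fsvec and e :: real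
  proof -
    obtain n where x: "x \<in> Rn n" using in_Rn by blast
    have "\<exists>q. \<bar>real_of_rat q - coord x i\<bar> < e / (real n + 1)" for i
    proof -
      have "coord x i < coord x i + e / (real n + 1)" using e by simp
      then obtain q where "coord x i < real_of_rat q" "real_of_rat q < coord x i + e / (real n + 1)"
        using of_rat_dense by blast
      then show ?thesis by (intro exI[of _ q]) auto
    qed
    then obtain q where q: "\<And>i. \<bar>real_of_rat (q i) - coord x i\<bar> < e / (real n + 1)" by metis
    let ?d = "\<Sum>i<n. real_of_rat (q i) *\<^sub>R unit_vec i"
    have "?d \<in> D"
      unfolding D_def by (rule image_eqI[of _ _ "map q [0..<n]"]) auto
    moreover have "dist ?d x < e"
    proof -
      have "?d - x = (\<Sum>i<n. (real_of_rat (q i) - coord x i) *\<^sub>R unit_vec i)"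
        by (subst Rn_expand[OF x]) (simp add: sum_subtractf scaleR_diff_left)
      then have "dist ?d x \<le> (\<Sum>i<n. norm ((real_of_rat (q i) - coord x i) *\<^sub>R unit_vec i))"
        unfolding dist_norm by (simp only: norm_sum)
      also have "\<dots> \<le> (\<Sum>i<n. e / (real n + 1))"
        using q by (intro sum_mono) (auto intro: less_imp_le)
      also have "\<dots> < e" using e by (simp add: field_simps)
      finally show ?thesis .
    qed
    ultimately show ?thesis by blast
  qed
  define B where "B = (\<lambda>(d, m :: nat). ball d (1 / (real m + 1))) ` (D \<times> UNIV)"
  have "countable D" unfolding D_def by (rule countable_image) auto
  then have "countable B" unfolding B_def by (intro countable_image countable_SIGMA) auto
  moreover have "topological_basis B"
  proof (rule topological_basisI)
    fix U and x :: fsvec assume U: "open U" "x \<in> U"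
    then obtain e where e: "e > 0" "ball x e \<subseteq> U" using open_contains_ball by blast
    obtain m :: nat where "2 / e < real m" using reals_Archimedean2 by blast
    then have m: "2 / (real m + 1) < e" using e by (simp add: field_simps)
    obtain d where d: "d \<in> D" "dist d x < 1 / (real m + 1)" using dense[of "1 / (real m + 1)" x] by auto
    have "ball d (1 / (real m + 1)) \<subseteq> ball x e"
    proof
      fix y assume "y \<in> ball d (1 / (real m + 1))"
      then have "dist x y < 1 / (real m + 1) + 1 / (real m + 1)"
        using d(2) dist_triangle[of x y d] by (simp add: dist_commute)
      then show "y \<in> ball x e" using m by simp
    qed
    then show "\<exists>B'\<in>B. x \<in> B' \<and> B' \<subseteq> U"
      using d e unfolding B_def by (intro bexI[of _ "ball d (1 / (real m + 1))"]) auto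
  qed (auto simp: B_def)
  ultimately show "\<exists>B::fsvec set set. countable B \<and> open = generate_topology B"
    by (auto dest: topological_basis_imp_subbasis)
qed

lemma continuous_on_coord [continuous_intros]: "continuous_on A (\<lambda>x. coord x i)"
  unfolding inner_unit_vec[symmetric] by (intro continuous_intros)

lemma borel_measurable_coord [measurable]: "(\<lambda>x. coord x i) \<in> borel_measurable borel"
  by (intro borel_measurable_continuous_onI continuous_on_coord)

lemma closed_Rn: "closed (Rn n)"
proof -
  have "Rn n = (\<Inter>i\<in>{n..}. {x. coord x i = 0})" by (auto simp: Rn_def)
  then show ?thesis
    by (auto intro!: closed_INT closed_Collect_eq continuous_intros)
qed

lemma sets_Rn [measurable]: "Rn n \<in> sets borel"
  by (intro borel_closed closed_Rn)

definition emb :: "nat \<Rightarrow> (nat \<Rightarrow> real) \<Rightarrow> fsvec" where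
  "emb n x = (\<Sum>i<n. x i *\<^sub>R unit_vec i)"

lemma coord_emb [simp]: "coord (emb n x) i = (if i < n then x i else 0)"
  by (auto simp: emb_def coord_sum if_distrib cong: if_cong)

lemma emb_Rn: "emb n x \<in> Rn n"
  by (auto simp: Rn_def)

lemma emb_coord: "x \<in> Rn n \<Longrightarrow> emb n (coord x) = x"
  by (rule fsvec_eqI) (auto simp: Rn_def)

lemma emb_restrict [simp]: "emb n (restrict x {..<n}) = emb n x"
  by (rule fsvec_eqI) auto

lemma inner_emb: "emb n x \<bullet> emb n y = (\<Sum>i<n. x i * y i)"
  by (subst inner_Rn[OF emb_Rn]) simp

lemma measurable_emb [measurable]: "emb n \<in> borel_measurable (LM {..<n})"
  unfolding emb_def by measurable

text \<open>Lebesgue measure of \<open>Rn n\<close>, spread over the whole type so that all sets and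
  maps stay in the one space \<open>borel\<close>; \<open>AE_lam_Rn\<close> recovers its
  support.\<close>

definition lam :: "nat \<Rightarrow> fsvec measure" where
  "lam n = distr (LM {..<n}) borel (emb n)"

lemma sets_lam [simp, measurable_cong]: "sets (lam n) = sets borel"
  and space_lam [simp]: "space (lam n) = UNIV"
  by (simp_all add: lam_def)

lemma sets_emb_vimage: "A \<in> sets borel \<Longrightarrow> {x \<in> extensional {..<n}. emb n x \<in> A} \<in> sets (LM {..<n})"
  using measurable_sets[OF measurable_emb, of A n] by (simp add: vimage_def Int_def conj_commute)

lemma emeasure_lam:
  "A \<in> sets borel \<Longrightarrow> emeasure (lam n) A = emeasure (LM {..<n}) {x \<in> extensional {..<n}. emb n x \<in> A}"
  unfolding lam_def by (subst emeasure_distr) (auto intro!: arg_cong2[where f = emeasure])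

lemma AE_lam_Rn: "AE x in lam n. x \<in> Rn n"
  unfolding lam_def by (subst AE_distr_iff) (auto simp: emb_Rn)

lemma emeasure_lam_mono:
  assumes "A \<in> sets borel" "B \<in> sets borel" "\<And>x. x \<in> Rn n \<Longrightarrow> x \<in> A \<Longrightarrow> x \<in> B"
  shows "emeasure (lam n) A \<le> emeasure (lam n) B"
proof (rule emeasure_mono_AE)
  show "AE x in lam n. x \<in> A \<longrightarrow> x \<in> B"
    using AE_lam_Rn[of n] by eventually_elim (use assms(3) in blast)
qed (use assms in simp)

lemma emeasure_lam_affine:
  assumes A: "A \<in> sets borel" and y: "y \<in> Rn n" and c: "c \<noteq> 0"
  shows "emeasure (lam n) {x. c *\<^sub>R x + y \<in> A} = ennreal ((1 / \<bar>c\<bar>) ^ n) * emeasure (lam n) A"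
proof -
  let ?f = "\<lambda>i s. c * s + coord y i"
  have 1: "emeasure lborel (?f i -` S) = ennreal (1 / \<bar>c\<bar>) * emeasure lborel S" if S: "S \<in> sets borel" for i S
  proof -
    have "emeasure lborel S
      = emeasure (density (distr lborel borel (\<lambda>s. coord y i + c * s)) (\<lambda>_. ennreal \<bar>c\<bar>)) S"
      using lborel_real_affine[OF c, of "coord y i"] by simp
    also have "\<dots> = ennreal \<bar>c\<bar> * emeasure (distr lborel borel (\<lambda>s. coord y i + c * s)) S"
      using S by (subst emeasure_density_const) auto
    also have "emeasure (distr lborel borel (\<lambda>s. coord y i + c * s)) S = emeasure lborel (?f i -` S)"
      using S by (subst emeasure_distr) (auto simp: vimage_def add.commute)
    finally show ?thesis
      using c by (simp add: mult.assoc[symmetric] flip: ennreal_mult')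
  qed
  have emb: "emb n (\<lambda>i\<in>{..<n}. ?f i (x i)) = c *\<^sub>R emb n x + y" for x
    using y by (intro fsvec_eqI) (auto simp: Rn_def)
  have A': "{x. c *\<^sub>R x + y \<in> A} \<in> sets borel"
  proof -
    have "(\<lambda>x. c *\<^sub>R x + y) \<in> borel_measurable borel" by measurable
    then show ?thesis using measurable_sets[OF _ A, of "\<lambda>x. c *\<^sub>R x + y" borel] by (simp add: vimage_def)
  qed
  let ?S = "{x \<in> extensional {..<n}. emb n x \<in> A}"
  have "emeasure (LM {..<n}) {x \<in> extensional {..<n}. (\<lambda>i\<in>{..<n}. ?f i (x i)) \<in> ?S}
      = ennreal ((1 / \<bar>c\<bar>) ^ card {..<n}) * emeasure (LM {..<n}) ?S"
    using 1 c sets_emb_vimage[OF A] by (intro emeasure_LM_coordinatewise) auto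
  also have "{x \<in> extensional {..<n}. (\<lambda>i\<in>{..<n}. ?f i (x i)) \<in> ?S}
    = {x \<in> extensional {..<n}. emb n x \<in> {x. c *\<^sub>R x + y \<in> A}}"
    using emb by auto
  finally show ?thesis
    using A A' by (simp add: emeasure_lam)
qed

lemma zero_Rn [simp]: "0 \<in> Rn n"
  by (simp add: Rn_def)

lemma emeasure_lam_scale:
  assumes "A \<in> sets borel" "c > 0"
  shows "emeasure (lam n) {x. x /\<^sub>R c \<in> A} = ennreal (c ^ n) * emeasure (lam n) A"
  using emeasure_lam_affine[OF assms(1) zero_Rn, of "inverse c" n] assms(2) by (simp add: field_simps)

lemma emeasure_lam_translate:
  assumes "A \<in> sets borel" "y \<in> Rn n"
  shows "emeasure (lam n) {x. x + y \<in> A} = emeasure (lam n) A"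
  using emeasure_lam_affine[OF assms, of 1] by simp

lemma emeasure_lam_uminus:
  assumes "A \<in> sets borel"
  shows "emeasure (lam n) {x. - x \<in> A} = emeasure (lam n) A"
  using emeasure_lam_affine[OF assms zero_Rn, of "-1"] by simp

section \<open>Volumes of cubes and balls, and the volume inequalities in
  \<open>Rn n\<close>\<close>

lemma norm_emb: "norm (emb n x) = sqrt (\<Sum>i<n. (x i)\<^sup>2)"
  by (simp add: norm_eq_sqrt_inner inner_emb power2_eq_square)

lemma emeasure_lam_cube:
  "r \<ge> 0 \<Longrightarrow> emeasure (lam n) {x. \<forall>i<n. \<bar>coord x i\<bar> \<le> r} = ennreal ((2 * r) ^ n)"
proof -
  assume r: "r \<ge> 0"
  interpret product_sigma_finite "\<lambda>_ :: nat. lborel :: real measure" by standard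
  have "{x. \<forall>i<n. \<bar>coord x i\<bar> \<le> r} \<in> sets borel" by measurable
  then have "emeasure (lam n) {x. \<forall>i<n. \<bar>coord x i\<bar> \<le> r}
    = emeasure (LM {..<n}) {x \<in> extensional {..<n}. \<forall>i<n. \<bar>x i\<bar> \<le> r}"
    by (simp add: emeasure_lam)
  also have "{x \<in> extensional {..<n}. \<forall>i<n. \<bar>x i\<bar> \<le> r} = Pi\<^sub>E {..<n} (\<lambda>_. {-r..r})"
  proof -
    have "\<bar>s\<bar> \<le> r \<longleftrightarrow> s \<in> {-r..r}" for s by auto
    then show ?thesis by (auto simp: PiE_def Pi_iff extensional_def)
  qed
  also have "emeasure (LM {..<n}) \<dots> = (\<Prod>i<n. ennreal (2 * r))"
    using r by (subst emeasure_PiM) auto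
  finally show ?thesis using r by (simp add: ennreal_power)
qed

definition ball_vol :: "nat \<Rightarrow> real" where
  "ball_vol n = measure (lam n) (cball 0 1)"

lemma emeasure_lam_cball_finite: "emeasure (lam n) (cball 0 r) < \<infinity>"
proof -
  have "emeasure (lam n) (cball 0 r) \<le> emeasure (lam n) {x. \<forall>i<n. \<bar>coord x i\<bar> \<le> \<bar>r\<bar>}"
    by (intro emeasure_mono) (auto intro: order_trans[OF abs_coord_le_norm])
  also have "\<dots> < \<infinity>" by (subst emeasure_lam_cube) auto
  finally show ?thesis .
qed

lemma emeasure_lam_cball_eq: "emeasure (lam n) (cball 0 1) = ennreal (ball_vol n)"
  unfolding ball_vol_def using emeasure_lam_cball_finite[of n 1] by (intro emeasure_eq_ennreal_measure) auto

text \<open>The cube of half-side \<open>1 / sqrt n\<close> is inscribed in the unit ball; up to a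
  factor \<open>C ^ n\<close> the bound has the right order.\<close>

lemma ball_vol_ge: "(2 / sqrt (real n)) ^ n \<le> ball_vol n"
proof (cases "n = 0")
  case False
  have "{x. \<forall>i<n. \<bar>coord x i\<bar> \<le> 1 / sqrt (real n)} \<in> sets borel" by measurable
  moreover have "x \<in> cball 0 1" if x: "x \<in> Rn n" "\<forall>i<n. \<bar>coord x i\<bar> \<le> 1 / sqrt (real n)" for x
  proof -
    have "(norm x)\<^sup>2 = (\<Sum>i<n. (coord x i)\<^sup>2)"
      unfolding power2_norm_eq_inner inner_Rn[OF x(1)] by (simp add: power2_eq_square)
    also have "\<dots> \<le> (\<Sum>i<n. 1 / real n)"
    proof (rule sum_mono)
      fix i assume "i \<in> {..<n}"
      then have "\<bar>coord x i\<bar>\<^sup>2 \<le> (1 / sqrt (real n))\<^sup>2" using x(2) by (intro power_mono) auto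
      then show "(coord x i)\<^sup>2 \<le> 1 / real n" by (simp add: power_divide)
    qed
    also have "\<dots> = 1" using False by simp
    finally have "(norm x)\<^sup>2 \<le> 1" .
    then show ?thesis using power2_le_imp_le[of "norm x" 1] by simp
  qed
  ultimately have "emeasure (lam n) {x. \<forall>i<n. \<bar>coord x i\<bar> \<le> 1 / sqrt (real n)} \<le> emeasure (lam n) (cball 0 1)"
    by (intro emeasure_lam_mono) auto
  then have "ennreal ((2 * (1 / sqrt (real n))) ^ n) \<le> ennreal (ball_vol n)"
    by (subst (asm) emeasure_lam_cube) (auto simp: emeasure_lam_cball_eq)
  then show ?thesis
    by (subst (asm) ennreal_le_iff) (auto simp: ball_vol_def)
next
  \<comment> \<open>In dimension 0 the left side is an empty power, hence 1, and the space is the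
    single point 0, of mass 1.\<close>
  case True
  have "emeasure (lam 0) {x. \<forall>i<(0::nat). \<bar>coord x i\<bar> \<le> 0} \<le> emeasure (lam 0) (cball 0 1)"
  proof (rule emeasure_lam_mono)
    fix x assume "x \<in> Rn 0"
    then have "x = 0" by (intro fsvec_eqI) (simp add: Rn_def)
    then show "x \<in> cball 0 1" by simp
  qed auto
  then have "ennreal ((2 * 0) ^ 0) \<le> ennreal (ball_vol 0)"
    by (subst (asm) emeasure_lam_cube) (auto simp: emeasure_lam_cball_eq)
  then show ?thesis using True by simp
qed

lemma ball_vol_pos: "ball_vol n > 0"
proof -
  have "(2 / sqrt (real n)) ^ n > 0" by (cases "n = 0") auto
  then show ?thesis using ball_vol_ge[of n] by linarith
qed

lemma emeasure_lam_cball: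
  assumes "r > 0" "y \<in> Rn n"
  shows "emeasure (lam n) (cball y r) = ennreal (r ^ n * ball_vol n)"
proof -
  have "emeasure (lam n) (cball y r) = emeasure (lam n) {x. x + y \<in> cball y r}"
    using assms by (subst emeasure_lam_translate) auto
  also have "{x. x + y \<in> cball y r} = {x. x /\<^sub>R r \<in> cball 0 1}"
    using assms by (auto simp: dist_norm field_simps)
  also have "emeasure (lam n) \<dots> = ennreal (r ^ n) * ennreal (ball_vol n)"
    using assms by (subst emeasure_lam_scale) (auto simp: emeasure_lam_cball_eq)
  finally show ?thesis using assms by (simp add: ennreal_mult')
qed

lemma sigma_finite_lam: "sigma_finite_measure (lam n)"
proof
  show "\<exists>A. countable A \<and> A \<subseteq> sets (lam n) \<and> \<Union>A = space (lam n) \<and> (\<forall>a\<in>A. emeasure (lam n) a \<noteq> \<infinity>)"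
  proof (intro exI[of _ "range (\<lambda>m::nat. cball 0 (real m))"] conjI)
    show "\<Union>(range (\<lambda>m::nat. cball 0 (real m))) = space (lam n)"
      by (auto simp: real_arch_simple)
    show "\<forall>a\<in>range (\<lambda>m::nat. cball 0 (real m)). emeasure (lam n) a \<noteq> \<infinity>"
      using emeasure_lam_cball_finite by (auto simp: less_top[symmetric])
  qed auto
qed

text \<open>Prekopa-Leindler for indicators: Brunn-Minkowski in its multiplicative, dimension-free
  form.\<close>

lemma emeasure_lam_midpoint:
  assumes "A \<in> sets borel" "B \<in> sets borel" "C \<in> sets borel"
    and mid: "\<And>a b. a \<in> A \<Longrightarrow> b \<in> B \<Longrightarrow> (a + b) /\<^sub>R 2 \<in> C"
  shows "emeasure (lam n) A * emeasure (lam n) B \<le> (emeasure (lam n) C)\<^sup>2"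
proof -
  let ?S = "\<lambda>A. {x \<in> extensional {..<n}. emb n x \<in> A}"
  have "(\<integral>\<^sup>+x. indicator (?S A) x \<partial>LM {..<n}) * (\<integral>\<^sup>+x. indicator (?S B) x \<partial>LM {..<n})
    \<le> (\<integral>\<^sup>+x. indicator (?S C) x \<partial>LM {..<n})\<^sup>2"
  proof (rule prekopa_leindler_PiM)
    fix x y :: "nat \<Rightarrow> real"
    have "emb n (\<lambda>i\<in>{..<n}. (x i + y i) / 2) = (emb n x + emb n y) /\<^sub>R 2"
      by (rule fsvec_eqI) auto
    then have "(\<lambda>i\<in>{..<n}. (x i + y i) / 2) \<in> ?S C" if "x \<in> ?S A" "y \<in> ?S B"
      using that mid by auto
    then show "indicator (?S A) x * indicator (?S B) y
      \<le> (indicator (?S C) (\<lambda>i\<in>{..<n}. (x i + y i) / 2) :: ennreal)\<^sup>2"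
      by (auto simp: indicator_def)
  qed (use assms sets_emb_vimage in auto)
  then show ?thesis
    using assms sets_emb_vimage by (simp add: emeasure_lam)
qed

lemma santalo_lam:
  assumes A: "A \<in> sets borel" and B: "B \<in> sets borel" and n: "n \<ge> 1"
    and sym: "\<And>y. y \<in> B \<Longrightarrow> - y \<in> B" and le1: "\<And>x y. x \<in> A \<Longrightarrow> y \<in> B \<Longrightarrow> x \<bullet> y \<le> 1"
  shows "emeasure (lam n) A * emeasure (lam n) B \<le> ennreal ((4 * exp 7 / real n) ^ n)"
proof -
  have "emb n (\<lambda>i\<in>{..<n}. - x i) = - emb n x" for x
    by (rule fsvec_eqI) auto
  moreover have "{..<n} \<noteq> {}" using n by (simp add: lessThan_empty_iff)
  ultimately have "emeasure (LM {..<n}) {x \<in> extensional {..<n}. emb n x \<in> A} *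
    emeasure (LM {..<n}) {x \<in> extensional {..<n}. emb n x \<in> B} \<le> ennreal ((4 * exp 7 / real (card {..<n})) ^ card {..<n})"
    using n A B sym le1 by (intro santalo_weak sets_emb_vimage) (auto simp: inner_emb[symmetric])
  then show ?thesis using A B by (simp add: emeasure_lam)
qed

section \<open>Uniqueness of Lebesgue measure and its orthogonal invariance\<close>

text \<open>Translation invariant measures agree up to a factor: evaluate the measure of the pairs with
  \<open>x \<in> A\<close> and \<open>x - y\<close> in the unit ball in both orders.\<close>

lemma lam_unique:
  fixes \<nu> :: "fsvec measure"
  assumes sets: "sets \<nu> = sets borel" and sf: "sigma_finite_measure \<nu>"
    and supp: "AE x in \<nu>. x \<in> Rn n"
    and trans: "\<And>A y. A \<in> sets borel \<Longrightarrow> y \<in> Rn n \<Longrightarrow> emeasure \<nu> {x. x + y \<in> A} = emeasure \<nu> A"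
    and A: "A \<in> sets borel"
  shows "emeasure \<nu> A * ennreal (ball_vol n) = emeasure \<nu> (cball 0 1) * emeasure (lam n) A"
proof -
  note [measurable_cong] = sets
  note [measurable] = A
  have [measurable]: "cball (0 :: fsvec) 1 \<in> sets borel" by simp
  interpret N: sigma_finite_measure \<nu> by fact
  interpret L: sigma_finite_measure "lam n" by (rule sigma_finite_lam)
  interpret P: pair_sigma_finite \<nu> "lam n" ..
  have sp: "space \<nu> = UNIV" using sets_eq_imp_space_eq[OF sets] by simp
  let ?f = "\<lambda>x y. indicator A x * indicator {z. norm (fst z - snd z) \<le> 1} (x, y) :: ennreal"
  have "(\<integral>\<^sup>+x. (\<integral>\<^sup>+y. ?f x y \<partial>lam n) \<partial>\<nu>) = (\<integral>\<^sup>+x. ennreal (ball_vol n) * indicator A x \<partial>\<nu>)"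
  proof (rule nn_integral_cong_AE)
    show "AE x in \<nu>. (\<integral>\<^sup>+y. ?f x y \<partial>lam n) = ennreal (ball_vol n) * indicator A x"
      using supp
    proof eventually_elim
      case (elim x)
      have "(\<integral>\<^sup>+y. ?f x y \<partial>lam n) = (\<integral>\<^sup>+y. indicator A x * indicator (cball x 1) y \<partial>lam n)"
        by (intro nn_integral_cong) (auto simp: indicator_def dist_norm)
      also have "\<dots> = ennreal (ball_vol n) * indicator A x"
        using emeasure_lam_cball[OF _ elim, of 1] by (subst nn_integral_cmult_indicator) (auto simp: mult.commute)
      finally show ?case .
    qed
  qed
  also have "\<dots> = ennreal (ball_vol n) * emeasure \<nu> A"
    by (subst nn_integral_cmult_indicator) auto
  finally have 1: "(\<integral>\<^sup>+x. (\<integral>\<^sup>+y. ?f x y \<partial>lam n) \<partial>\<nu>) = ennreal (ball_vol n) * emeasure \<nu> A" .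
  have "(\<integral>\<^sup>+x. (\<integral>\<^sup>+y. ?f x y \<partial>lam n) \<partial>\<nu>) = (\<integral>\<^sup>+y. (\<integral>\<^sup>+x. ?f x y \<partial>\<nu>) \<partial>lam n)"
    by (rule P.Fubini'[symmetric]) measurable
  also have "\<dots> = (\<integral>\<^sup>+y. (\<integral>\<^sup>+x. indicator A (x + y) * indicator (cball 0 1) x \<partial>\<nu>) \<partial>lam n)"
  proof (rule nn_integral_cong_AE)
    show "AE y in lam n. (\<integral>\<^sup>+x. ?f x y \<partial>\<nu>) = (\<integral>\<^sup>+x. indicator A (x + y) * indicator (cball 0 1) x \<partial>\<nu>)"
      using AE_lam_Rn
    proof eventually_elim
      case (elim y)
      let ?S = "{z. z \<in> cball 0 1 \<and> z + y \<in> A}"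
      have S[measurable]: "?S \<in> sets borel" by measurable
      have S': "{x. x + (- y) \<in> ?S} \<in> sets borel" by measurable
      have "(\<integral>\<^sup>+x. ?f x y \<partial>\<nu>) = (\<integral>\<^sup>+x. indicator {x. x + (- y) \<in> ?S} x \<partial>\<nu>)"
        by (intro nn_integral_cong) (auto simp: indicator_def)
      also have "\<dots> = emeasure \<nu> {x. x + (- y) \<in> ?S}"
        using S' by (subst nn_integral_indicator) (simp_all add: sets)
      also have "\<dots> = emeasure \<nu> ?S"
        using elim subspace_neg[OF subspace_Rn] by (intro trans S) auto
      also have "\<dots> = (\<integral>\<^sup>+x. indicator ?S x \<partial>\<nu>)"
        using S by (subst nn_integral_indicator) (simp_all add: sets)
      also have "\<dots> = (\<integral>\<^sup>+x. indicator A (x + y) * indicator (cball 0 1) x \<partial>\<nu>)"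
        by (intro nn_integral_cong) (auto simp: indicator_def)
      finally show ?case .
    qed
  qed
  also have "\<dots> = (\<integral>\<^sup>+x. (\<integral>\<^sup>+y. indicator A (x + y) * indicator (cball 0 1) x \<partial>lam n) \<partial>\<nu>)"
    by (rule P.Fubini') measurable
  also have "\<dots> = (\<integral>\<^sup>+x. emeasure (lam n) A * indicator (cball 0 1) x \<partial>\<nu>)"
  proof (rule nn_integral_cong_AE)
    show "AE x in \<nu>. (\<integral>\<^sup>+y. indicator A (x + y) * indicator (cball 0 1) x \<partial>lam n)
      = emeasure (lam n) A * indicator (cball 0 1) x"
      using supp
    proof eventually_elim
      case (elim x)
      have S: "{y. y + x \<in> A} \<in> sets borel" by measurable
      have "(\<integral>\<^sup>+y. indicator A (x + y) * indicator (cball 0 1) x \<partial>lam n)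
        = (\<integral>\<^sup>+y. indicator (cball 0 1) x * indicator {y. y + x \<in> A} y \<partial>lam n)"
        by (intro nn_integral_cong) (auto simp: indicator_def add.commute)
      also have "\<dots> = indicator (cball 0 1) x * emeasure (lam n) {y. y + x \<in> A}"
        using S by (subst nn_integral_cmult_indicator) auto
      also have "\<dots> = emeasure (lam n) A * indicator (cball 0 1) x"
        using emeasure_lam_translate[OF A elim] by (simp add: mult.commute)
      finally show ?case .
    qed
  qed
  also have "\<dots> = emeasure (lam n) A * emeasure \<nu> (cball 0 1)"
    by (subst nn_integral_cmult_indicator) (auto simp: sets)
  finally show ?thesis using 1 by (simp add: mult.commute)
qed

lemma orthogonal_transformation_continuous:
  assumes "orthogonal_transformation (U :: fsvec \<Rightarrow> fsvec)"
  shows "continuous_on A U"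
proof (rule continuous_on_subset[OF _ subset_UNIV])
  have "dist (U x) (U y) = dist x y" for x y
    using orthogonal_transformation_norm[OF assms, of "x - y"] linear_diff[OF orthogonal_transformation_linear[OF assms], of x y]
    by (simp add: dist_norm)
  then show "continuous_on UNIV U"
    by (auto simp: continuous_on_iff)
qed

lemma orthogonal_group_measurable:
  "U \<in> orthogonal_group n \<Longrightarrow> U \<in> borel_measurable borel"
  unfolding orthogonal_group_def
  by (auto intro!: borel_measurable_continuous_onI orthogonal_transformation_continuous)

text \<open>No determinants: the image measure is translation invariant because \<open>U\<close>
  maps \<open>Rn n\<close> onto itself linearly, and it gives the unit ball the same mass, so the
  factor left open by uniqueness is 1.\<close>

lemma distr_lam_orthogonal:
  assumes U: "U \<in> orthogonal_group n"
  shows "distr (lam n) borel U = lam n"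
proof -
  have ot: "orthogonal_transformation U" and im: "U ` Rn n = Rn n"
    using U by (auto simp: orthogonal_group_def)
  have lin: "linear U" by (rule orthogonal_transformation_linear[OF ot])
  have [measurable]: "U \<in> borel_measurable borel" by (rule orthogonal_group_measurable[OF U])
  let ?N = "distr (lam n) borel U"
  have em: "emeasure ?N A = emeasure (lam n) {x. U x \<in> A}" if "A \<in> sets borel" for A
    using that by (subst emeasure_distr) (auto simp: vimage_def)
  have ball: "{x. U x \<in> cball 0 r} = cball 0 r" for r
    using orthogonal_transformation_norm[OF ot] by auto
  have main: "emeasure ?N A * ennreal (ball_vol n) = emeasure ?N (cball 0 1) * emeasure (lam n) A"
    if A: "A \<in> sets borel" for A
  proof (rule lam_unique[OF _ _ _ _ A])
    show "sigma_finite_measure ?N"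
    proof
      show "\<exists>A. countable A \<and> A \<subseteq> sets ?N \<and> \<Union>A = space ?N \<and> (\<forall>a\<in>A. emeasure ?N a \<noteq> \<infinity>)"
      proof (intro exI[of _ "range (\<lambda>m::nat. cball 0 (real m))"] conjI)
        show "\<Union>(range (\<lambda>m::nat. cball 0 (real m))) = space ?N"
          by (auto simp: real_arch_simple)
        have "emeasure ?N (cball 0 r) \<noteq> \<infinity>" for r
          using emeasure_lam_cball_finite[of n r] unfolding em[OF borel_closed[OF closed_cball]] ball by simp
        then show "\<forall>a\<in>range (\<lambda>m::nat. cball 0 (real m)). emeasure ?N a \<noteq> \<infinity>"
          by blast
      qed auto
    qed
    have "AE x in lam n. U x \<in> Rn n"
      using AE_lam_Rn[of n] by eventually_elim (use im in blast)
    then show "AE x in ?N. x \<in> Rn n"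
      by (subst AE_distr_iff) simp_all
    show "emeasure ?N {x. x + y \<in> A} = emeasure ?N A" if A[measurable]: "A \<in> sets borel" and y: "y \<in> Rn n" for A y
    proof -
      have "y \<in> U ` Rn n" unfolding im by (rule y)
      then obtain z where z: "z \<in> Rn n" "U z = y" by blast
      have *: "{x. U x \<in> A} \<in> sets borel" by measurable
      have "{x. x + y \<in> A} \<in> sets borel" by measurable
      then have "emeasure ?N {x. x + y \<in> A} = emeasure (lam n) {x. x + z \<in> {x. U x \<in> A}}"
        using z(2) by (simp add: em linear_add[OF lin])
      also have "\<dots> = emeasure (lam n) {x. U x \<in> A}"
        by (rule emeasure_lam_translate[OF * z(1)])
      finally show ?thesis using A by (simp add: em)
    qed
  qed auto
  show ?thesis
  proof (rule measure_eqI)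
    fix A assume "A \<in> sets ?N"
    then have "A \<in> sets borel" by simp
    note main[OF this]
    also have "emeasure ?N (cball 0 1) = ennreal (ball_vol n)"
      unfolding em[OF borel_closed[OF closed_cball]] ball by (rule emeasure_lam_cball_eq)
    finally have "ennreal (ball_vol n) * emeasure ?N A = ennreal (ball_vol n) * emeasure (lam n) A"
      by (simp add: mult.commute)
    then show "emeasure ?N A = emeasure (lam n) A"
      using ball_vol_pos[of n] by (simp add: ennreal_mult_cancel_left)
  qed simp
qed

section \<open>The invariant measure on the sphere\<close>

text \<open>Reflections are the only orthogonal maps constructed in the proof: they act transitively
  on each sphere, and those with \<open>u\<close> in a subspace preserve that subspace. For
  \<open>u = 0\<close> the division by zero yields the identity.\<close>

definition householder :: "fsvec \<Rightarrow> fsvec \<Rightarrow> fsvec" where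
  "householder u z = z - (2 * (z \<bullet> u) / (u \<bullet> u)) *\<^sub>R u"

lemma orthogonal_transformation_householder: "orthogonal_transformation (householder u)"
  unfolding orthogonal_transformation_def
proof (intro conjI allI)
  show "linear (householder u)"
  proof (rule linearI)
    fix x y
    have "2 * ((x + y) \<bullet> u) / (u \<bullet> u) = 2 * (x \<bullet> u) / (u \<bullet> u) + 2 * (y \<bullet> u) / (u \<bullet> u)"
      unfolding inner_add_left distrib_left add_divide_distrib ..
    then show "householder u (x + y) = householder u x + householder u y"
      by (simp add: householder_def scaleR_add_left)
  qed (simp add: householder_def scaleR_diff_right)
  show "householder u v \<bullet> householder u w = v \<bullet> w" for v w
  proof (cases "u = 0")
    case False
    then have u: "u \<bullet> u \<noteq> 0" by simp
    have "(v - a *\<^sub>R u) \<bullet> (w - b *\<^sub>R u) = v \<bullet> w - b * (v \<bullet> u) - a * (w \<bullet> u) + a * (b * (u \<bullet> u))" for a b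
      by (simp add: inner_diff_left inner_diff_right inner_commute[of u w] right_diff_distrib)
    then have "householder u v \<bullet> householder u w = v \<bullet> w - (2 * (w \<bullet> u) / (u \<bullet> u)) * (v \<bullet> u)
      - (2 * (v \<bullet> u) / (u \<bullet> u)) * (w \<bullet> u) + (2 * (v \<bullet> u) / (u \<bullet> u)) * ((2 * (w \<bullet> u) / (u \<bullet> u)) * (u \<bullet> u))"
      unfolding householder_def .
    also have "\<dots> = v \<bullet> w"
      using u by (simp add: field_simps)
    finally show ?thesis .
  qed (simp add: householder_def)
qed

lemma householder_householder [simp]: "householder u (householder u z) = z"
proof (cases "u = 0")
  case False
  then have "householder u z \<bullet> u = - (z \<bullet> u)" by (simp add: householder_def inner_diff_left)
  then have "householder u (householder u z) = householder u z + (2 * (z \<bullet> u) / (u \<bullet> u)) *\<^sub>R u"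
    by (subst householder_def) simp
  then show ?thesis by (simp add: householder_def)
qed (simp add: householder_def)

lemma householder_in_orthogonal_group:
  assumes "u \<in> Rn n"
  shows "householder u \<in> orthogonal_group n"
proof -
  have *: "householder u z \<in> Rn n" if "z \<in> Rn n" for z
    unfolding householder_def using subspace_Rn assms that by (auto intro: subspace_diff subspace_scale)
  have "householder u ` Rn n = Rn n"
  proof (intro equalityI subsetI)
    fix z assume "z \<in> Rn n"
    then show "z \<in> householder u ` Rn n" using * by (intro image_eqI[of _ _ "householder u z"]) auto
  qed (use * in auto)
  then show ?thesis
    by (simp add: orthogonal_group_def orthogonal_transformation_householder)
qed

lemma householder_swap:
  assumes "norm x = norm y"
  shows "householder (x - y) x = y"
proof (cases "x = y")
  case False
  have "x \<bullet> x = y \<bullet> y" using assms by (simp add: norm_eq)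
  then have "2 * (x \<bullet> (x - y)) = (x - y) \<bullet> (x - y)"
    by (simp add: inner_diff_left inner_diff_right inner_commute)
  moreover have "(x - y) \<bullet> (x - y) \<noteq> 0" using False by simp
  ultimately have "2 * (x \<bullet> (x - y)) / ((x - y) \<bullet> (x - y)) = 1" by (metis divide_self)
  then show ?thesis unfolding householder_def by (simp only: scaleR_one) simp
qed (simp add: householder_def)

section \<open>Uniqueness of the invariant probability on the sphere\<close>

text \<open>Counterpart of \<open>uniform_sphere_measure\<close> with the measure pushed to the full
  Borel algebra of \<open>fsvec\<close>; \<open>lift_sphere\<close> passes from one to the
  other.\<close>

definition sphere_invariant :: "nat \<Rightarrow> fsvec measure \<Rightarrow> bool" where
  "sphere_invariant n \<nu> \<longleftrightarrow> sets \<nu> = sets borel \<and> prob_space \<nu> \<and> (AE x in \<nu>. x \<in> unit_sphere n) \<and>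
    (\<forall>U\<in>orthogonal_group n. distr \<nu> borel U = \<nu>)"

lemma unit_sphere_iff: "x \<in> unit_sphere n \<longleftrightarrow> norm x = 1 \<and> x \<in> Rn n"
  by (auto simp: unit_sphere_def)

lemma sets_unit_sphere [measurable]: "unit_sphere n \<in> sets borel"
proof -
  have "closed {x :: fsvec. norm x = 1}" by (intro closed_Collect_eq continuous_intros)
  then have "closed ({x. norm x = 1} \<inter> Rn n)" by (intro closed_Int closed_Rn)
  also have "{x. norm x = 1} \<inter> Rn n = unit_sphere n" by (auto simp: unit_sphere_iff)
  finally show ?thesis by (rule borel_closed)
qed

lemma emeasure_orthogonal_invariant:
  assumes "sphere_invariant n \<nu>" "U \<in> orthogonal_group n" "A \<in> sets borel"
  shows "emeasure \<nu> {x. U x \<in> A} = emeasure \<nu> A"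
proof -
  have "U \<in> measurable \<nu> borel"
    using assms orthogonal_group_measurable[OF assms(2)] measurable_cong_sets[of \<nu> borel borel borel]
    by (auto simp: sphere_invariant_def)
  then have "emeasure (distr \<nu> borel U) A = emeasure \<nu> (U -` A \<inter> space \<nu>)"
    using assms(3) by (rule emeasure_distr)
  moreover have "space \<nu> = UNIV"
    using assms(1) sets_eq_imp_space_eq[of \<nu> borel] by (simp add: sphere_invariant_def)
  ultimately show ?thesis
    using assms by (simp add: sphere_invariant_def vimage_def)
qed

text \<open>The reflection exchanging the two centres is an isometry that preserves the
  measure.\<close>

lemma emeasure_ball_sphere_eq:
  assumes inv: "sphere_invariant n \<nu>" and xy: "x \<in> unit_sphere n" "y \<in> unit_sphere n"
  shows "emeasure \<nu> (ball x r) = emeasure \<nu> (ball y r)"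
proof -
  let ?U = "householder (x - y)"
  have U: "?U \<in> orthogonal_group n"
    using xy by (intro householder_in_orthogonal_group subspace_diff subspace_Rn) (auto simp: unit_sphere_iff)
  have "?U x = y" using xy by (intro householder_swap) (simp add: unit_sphere_iff)
  moreover have "dist (?U x) (?U z) = dist x z" for z
    using orthogonal_transformation_norm[OF orthogonal_transformation_householder, of "x - y" "x - z"]
      linear_diff[OF orthogonal_transformation_linear[OF orthogonal_transformation_householder], of "x - y" x z]
    by (simp add: dist_norm)
  ultimately have "{z. ?U z \<in> ball y r} = ball x r" by (simp add: ball_def)
  then show ?thesis using emeasure_orthogonal_invariant[OF inv U, of "ball y r"] by simp
qed

text \<open>If one ball were null, all balls of that radius centred on the sphere would be null, and
  countably many of them cover the sphere.\<close>

lemma emeasure_ball_sphere_pos: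
  assumes inv: "sphere_invariant n \<nu>" and x: "x \<in> unit_sphere n" and r: "r > 0"
  shows "emeasure \<nu> (ball x r) > 0"
proof (rule ccontr)
  assume "\<not> emeasure \<nu> (ball x r) > 0"
  then have 0: "emeasure \<nu> (ball y r) = 0" if "y \<in> unit_sphere n" for y
    using emeasure_ball_sphere_eq[OF inv x that, of r] by simp
  interpret prob_space \<nu> using inv by (simp add: sphere_invariant_def)
  have sets: "sets \<nu> = sets borel" using inv by (simp add: sphere_invariant_def)
  obtain F where F: "F \<subseteq> (\<lambda>y. ball y r) ` unit_sphere n" "countable F"
    "\<Union>F = \<Union>((\<lambda>y. ball y r) ` unit_sphere n)"
    using Lindelof[of "(\<lambda>y. ball y r) ` unit_sphere n"] by blast
  have "\<Union>F \<in> null_sets \<nu>"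
    using F(1) 0 by (intro null_sets_UN'[of F "\<lambda>X. X", simplified] F(2)) (auto simp: null_sets_def sets)
  moreover have "unit_sphere n \<subseteq> \<Union>F" using F(3) r by auto
  ultimately have "AE y in \<nu>. y \<notin> unit_sphere n"
    by (intro AE_I'[of "\<Union>F"]) auto
  moreover have "AE y in \<nu>. y \<in> unit_sphere n" using inv by (simp add: sphere_invariant_def)
  ultimately have "AE y in \<nu>. False" by eventually_elim simp
  then show False by simp
qed

text \<open>Christensen's argument for the uniqueness of uniformly distributed measures: both measures give
  the same mass to all balls of a fixed radius, and an open set is exhausted by the centres of the
  balls that it contains.\<close>

lemma sphere_invariant_open_le:
  assumes inv: "sphere_invariant n \<nu>" and inv': "sphere_invariant n \<nu>'" and n: "n \<ge> 1" and U: "open U"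
  shows "emeasure \<nu> U \<le> emeasure \<nu>' U"
proof -
  interpret N: prob_space \<nu> using inv by (simp add: sphere_invariant_def)
  interpret N': prob_space \<nu>' using inv' by (simp add: sphere_invariant_def)
  interpret P: pair_sigma_finite \<nu> \<nu>' ..
  have sets[measurable_cong]: "sets \<nu> = sets borel" "sets \<nu>' = sets borel"
    using inv inv' by (auto simp: sphere_invariant_def)
  have sp: "space \<nu> = UNIV" "space \<nu>' = UNIV"
    using sets_eq_imp_space_eq[OF sets(1)] sets_eq_imp_space_eq[OF sets(2)] by auto
  have [measurable]: "U \<in> sets borel" using U by simp
  define x0 where "x0 = unit_vec 0"
  have x0: "x0 \<in> unit_sphere n" using n by (auto simp: x0_def unit_sphere_iff unit_vec_Rn)
  let ?d = "\<lambda>r x y. indicator {z. dist (fst z) (snd z) < r} (x, y) :: ennreal"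
  have int1: "(\<integral>\<^sup>+x. ?d r x y \<partial>\<nu>) = emeasure \<nu> (ball x0 r)" if "y \<in> unit_sphere n" for y r
  proof -
    have "(\<integral>\<^sup>+x. ?d r x y \<partial>\<nu>) = (\<integral>\<^sup>+x. indicator (ball y r) x \<partial>\<nu>)"
      by (intro nn_integral_cong) (auto simp: indicator_def dist_commute)
    also have "\<dots> = emeasure \<nu> (ball x0 r)"
      using emeasure_ball_sphere_eq[OF inv that x0] by (subst nn_integral_indicator) (auto simp: sets)
    finally show ?thesis .
  qed
  have int2: "(\<integral>\<^sup>+y. ?d r x y \<partial>\<nu>') = emeasure \<nu>' (ball x0 r)" if "x \<in> unit_sphere n" for x r
  proof -
    have "(\<integral>\<^sup>+y. ?d r x y \<partial>\<nu>') = (\<integral>\<^sup>+y. indicator (ball x r) y \<partial>\<nu>')"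
      by (intro nn_integral_cong) (auto simp: indicator_def)
    also have "\<dots> = emeasure \<nu>' (ball x0 r)"
      using emeasure_ball_sphere_eq[OF inv' that x0] by (subst nn_integral_indicator) (auto simp: sets)
    finally show ?thesis .
  qed
  have ae: "AE x in \<nu>. x \<in> unit_sphere n" "AE y in \<nu>'. y \<in> unit_sphere n"
    using inv inv' by (auto simp: sphere_invariant_def)
  \<comment> \<open>The product measure of the pairs at distance less than \<open>r\<close>,
    evaluated in both orders; both measures have total mass 1.\<close>
  have same: "emeasure \<nu> (ball x0 r) = emeasure \<nu>' (ball x0 r)" for r
  proof -
    have "emeasure \<nu> (ball x0 r) = (\<integral>\<^sup>+y. emeasure \<nu> (ball x0 r) \<partial>\<nu>')"
      by (simp add: N'.emeasure_space_1)
    also have "\<dots> = (\<integral>\<^sup>+y. (\<integral>\<^sup>+x. ?d r x y \<partial>\<nu>) \<partial>\<nu>')"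
      using ae(2) int1 by (intro nn_integral_cong_AE) (auto elim!: eventually_mono)
    also have "\<dots> = (\<integral>\<^sup>+x. (\<integral>\<^sup>+y. ?d r x y \<partial>\<nu>') \<partial>\<nu>)"
      by (rule P.Fubini') measurable
    also have "\<dots> = (\<integral>\<^sup>+x. emeasure \<nu>' (ball x0 r) \<partial>\<nu>)"
      using ae(1) int2 by (intro nn_integral_cong_AE) (auto elim!: eventually_mono)
    also have "\<dots> = emeasure \<nu>' (ball x0 r)" by (simp add: N.emeasure_space_1)
    finally show ?thesis .
  qed
  \<comment> \<open>The centres whose balls of radius \<open>1 / (m + 1)\<close> stay inside
    \<open>U\<close>; these sets are closed and increase to \<open>U\<close>.\<close>
  define D where "D m = {x. \<forall>y. dist x y < 1 / real (Suc m) \<longrightarrow> y \<in> U}" for m :: nat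
  have D_closed: "closed (D m)" for m
  proof -
    have "D m = - (\<Union>y\<in>- U. ball y (1 / real (Suc m)))"
      by (auto simp: D_def dist_commute)
    also have "closed \<dots>" by (intro closed_Compl open_UN ballI open_ball)
    finally show ?thesis .
  qed
  then have D[measurable]: "D m \<in> sets borel" for m by (rule borel_closed)
  have D_le: "emeasure \<nu> (D m) \<le> emeasure \<nu>' U" for m
  proof -
    let ?r = "1 / real (Suc m)" and ?v = "emeasure \<nu> (ball x0 (1 / real (Suc m)))"
    have "emeasure \<nu> (D m) * ?v = (\<integral>\<^sup>+x. ?v * indicator (D m) x \<partial>\<nu>)"
      by (subst nn_integral_cmult_indicator) (auto simp: sets mult.commute)
    also have "\<dots> = (\<integral>\<^sup>+x. (\<integral>\<^sup>+y. indicator (D m) x * ?d ?r x y \<partial>\<nu>') \<partial>\<nu>)"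
    proof (rule nn_integral_cong_AE)
      show "AE x in \<nu>. ?v * indicator (D m) x = (\<integral>\<^sup>+y. indicator (D m) x * ?d ?r x y \<partial>\<nu>')"
        using ae(1)
      proof eventually_elim
        case (elim x)
        have "(\<integral>\<^sup>+y. indicator (D m) x * ?d ?r x y \<partial>\<nu>') = indicator (D m) x * (\<integral>\<^sup>+y. ?d ?r x y \<partial>\<nu>')"
          by (rule nn_integral_cmult) measurable
        then show ?case using int2[OF elim] same by (simp add: mult.commute)
      qed
    qed
    also have "\<dots> \<le> (\<integral>\<^sup>+x. (\<integral>\<^sup>+y. indicator U y * ?d ?r x y \<partial>\<nu>') \<partial>\<nu>)"
      by (intro nn_integral_mono) (auto simp: indicator_def D_def)
    also have "\<dots> = (\<integral>\<^sup>+y. (\<integral>\<^sup>+x. indicator U y * ?d ?r x y \<partial>\<nu>) \<partial>\<nu>')"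
      by (rule P.Fubini'[symmetric]) measurable
    also have "\<dots> = (\<integral>\<^sup>+y. ?v * indicator U y \<partial>\<nu>')"
    proof (rule nn_integral_cong_AE)
      show "AE y in \<nu>'. (\<integral>\<^sup>+x. indicator U y * ?d ?r x y \<partial>\<nu>) = ?v * indicator U y"
        using ae(2)
      proof eventually_elim
        case (elim y)
        have "(\<integral>\<^sup>+x. indicator U y * ?d ?r x y \<partial>\<nu>) = indicator U y * (\<integral>\<^sup>+x. ?d ?r x y \<partial>\<nu>)"
          by (rule nn_integral_cmult) measurable
        then show ?case using int1[OF elim] by (simp add: mult.commute)
      qed
    qed
    also have "\<dots> = ?v * emeasure \<nu>' U"
      by (subst nn_integral_cmult_indicator) (auto simp: sets)
    finally have "?v * emeasure \<nu> (D m) \<le> ?v * emeasure \<nu>' U" by (simp add: mult.commute)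
    moreover have "0 < ?v" using emeasure_ball_sphere_pos[OF inv x0] by simp
    moreover have "?v < \<infinity>" using N.emeasure_finite[of "ball x0 ?r"] by (simp add: less_top[symmetric])
    ultimately show ?thesis by (simp add: ennreal_mult_le_mult_iff)
  qed
  have "incseq D"
  proof (rule incseq_SucI, rule subsetI)
    fix m x assume "x \<in> D m"
    moreover have "1 / real (Suc (Suc m)) \<le> 1 / real (Suc m)" by (intro divide_left_mono) auto
    ultimately show "x \<in> D (Suc m)" unfolding D_def using less_le_trans by blast
  qed
  then have "(SUP m. emeasure \<nu> (D m)) = emeasure \<nu> (\<Union>m. D m)"
    using D by (intro SUP_emeasure_incseq) (auto simp: sets)
  also have "(\<Union>m. D m) = U"
  proof (intro equalityI subsetI)
    fix x assume "x \<in> U"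
    then obtain e where e: "e > 0" "ball x e \<subseteq> U" using U open_contains_ball by blast
    obtain m where "inverse (real (Suc m)) < e" using reals_Archimedean e by blast
    then have "x \<in> D m" using e by (auto simp: D_def inverse_eq_divide intro!: subsetD[OF e(2)])
    then show "x \<in> (\<Union>m. D m)" by blast
  qed (auto simp: D_def)
  finally show ?thesis using D_le by (metis SUP_least)
qed

lemma sphere_invariant_unique:
  assumes inv: "sphere_invariant n \<nu>" and inv': "sphere_invariant n \<nu>'" and n: "n \<ge> 1"
  shows "\<nu> = \<nu>'"
proof (rule measure_eqI_generator_eq[where E = "Collect open" and \<Omega> = UNIV and A = "\<lambda>_. UNIV"])
  show "Int_stable (Collect open :: fsvec set set)" by (auto simp: Int_stable_def)
  show "emeasure \<nu> X = emeasure \<nu>' X" if "X \<in> Collect open" for X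
    using that sphere_invariant_open_le[OF inv inv' n] sphere_invariant_open_le[OF inv' inv n]
    by (intro antisym) auto
  show "sets \<nu> = sigma_sets UNIV (Collect open)" "sets \<nu>' = sigma_sets UNIV (Collect open)"
    using inv inv' by (auto simp: sphere_invariant_def borel_def)
  interpret N: prob_space \<nu> using inv by (simp add: sphere_invariant_def)
  show "emeasure \<nu> UNIV \<noteq> \<infinity>" by simp
qed auto

section \<open>Cone measure and polar coordinates\<close>

lemma measurable_sgn_fsvec [measurable]: "(sgn :: fsvec \<Rightarrow> fsvec) \<in> borel_measurable borel"
proof -
  have "(sgn :: fsvec \<Rightarrow> fsvec) = (\<lambda>x. inverse (norm x) *\<^sub>R x)"
    by (simp add: fun_eq_iff sgn_div_norm)
  then show ?thesis by simp
qed

lemma emeasure_lam_coord_null: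
  assumes "n \<ge> 1"
  shows "emeasure (lam n) {x. coord x 0 = 0} = 0"
proof -
  have "{x. coord x 0 = 0} \<in> sets borel" by measurable
  then have "emeasure (lam n) {x. coord x 0 = 0} = emeasure (LM {..<n}) {x \<in> extensional {..<n}. coord (emb n x) 0 = 0}"
    by (simp add: emeasure_lam)
  also have "\<dots> = 0"
    using assms by (intro emeasure_LM_coordinate_hyperplanes) (auto intro!: bexI[of _ 0])
  finally show ?thesis .
qed

lemma orthogonal_group_sgn:
  "U \<in> orthogonal_group n \<Longrightarrow> sgn (U x) = U (sgn x)"
  using orthogonal_transformation_norm[of U x] orthogonal_transformation_scaleR[of U _ x]
  by (auto simp: orthogonal_group_def sgn_div_norm)

text \<open>Radial projection commutes with orthogonal maps, and the uniform distribution on the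
  ball is invariant under them.\<close>

lemma sphere_invariant_cone:
  assumes n: "n \<ge> 1"
  shows "sphere_invariant n (distr (uniform_measure (lam n) (cball 0 1)) borel sgn)"
proof -
  let ?u = "uniform_measure (lam n) (cball 0 1)"
  have fin: "emeasure (lam n) (cball 0 1) \<noteq> 0" "emeasure (lam n) (cball 0 1) \<noteq> \<infinity>"
    using ball_vol_pos[of n] by (auto simp: emeasure_lam_cball_eq)
  interpret u: prob_space ?u using fin by (rule prob_space_uniform_measure)
  have [measurable]: "sgn \<in> borel_measurable ?u" by simp
  \<comment> \<open>A null hyperplane through the origin suffices to discard the origin, the only
    point of \<open>Rn n\<close> that \<open>sgn\<close> does not send to the sphere.\<close>
  have "AE x in lam n. coord x 0 \<noteq> 0"
    using emeasure_lam_coord_null[OF n] by (intro AE_I[of _ _ "{x. coord x 0 = 0}"]) auto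
  with AE_lam_Rn have "AE x in lam n. sgn x \<in> unit_sphere n"
  proof eventually_elim
    case (elim x)
    then have "x \<noteq> 0" by auto
    then show ?case using elim subspace_scale[OF subspace_Rn, of x n]
      by (simp add: unit_sphere_iff norm_sgn) (simp add: sgn_div_norm)
  qed
  then have "AE x in ?u. sgn x \<in> unit_sphere n"
    by (intro AE_uniform_measureI) (auto elim: eventually_mono)
  moreover have "distr (distr ?u borel sgn) borel U = distr ?u borel sgn" if U: "U \<in> orthogonal_group n" for U
  proof -
    have [measurable]: "U \<in> borel_measurable borel" by (rule orthogonal_group_measurable[OF U])
    have ot: "orthogonal_transformation U" using U by (simp add: orthogonal_group_def)
    show ?thesis
    proof (rule measure_eqI)
      fix A assume "A \<in> sets (distr (distr ?u borel sgn) borel U)"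
      then have A[measurable]: "A \<in> sets borel" by simp
      have *: "cball 0 1 \<inter> {x. sgn x \<in> A} \<in> sets borel" by measurable
      have "emeasure (lam n) (cball 0 1 \<inter> {x. sgn x \<in> A}) = emeasure (distr (lam n) borel U) (cball 0 1 \<inter> {x. sgn x \<in> A})"
        by (simp add: distr_lam_orthogonal[OF U])
      also have "\<dots> = emeasure (lam n) {x. U x \<in> cball 0 1 \<inter> {x. sgn x \<in> A}}"
        using * by (subst emeasure_distr) (auto simp: vimage_def)
      also have "{x. U x \<in> cball 0 1 \<inter> {x. sgn x \<in> A}} = cball 0 1 \<inter> {x. U (sgn x) \<in> A}"
        using orthogonal_group_sgn[OF U] orthogonal_transformation_norm[OF ot] by auto
      finally have "emeasure ?u {x. U (sgn x) \<in> A} = emeasure ?u {x. sgn x \<in> A}"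
        by (simp add: emeasure_uniform_measure)
      then show "emeasure (distr (distr ?u borel sgn) borel U) A = emeasure (distr ?u borel sgn) A"
        using A by (simp add: emeasure_distr distr_distr vimage_def o_def)
    qed simp
  qed
  ultimately show ?thesis
    unfolding sphere_invariant_def by (auto simp: u.prob_space_distr AE_distr_iff)
qed

definition lift_sphere :: "fsvec measure \<Rightarrow> fsvec measure" where
  "lift_sphere \<sigma> = distr \<sigma> borel (\<lambda>x. x)"

lemma sphere_invariant_lift:
  assumes \<sigma>: "uniform_sphere_measure n \<sigma>"
  shows "sphere_invariant n (lift_sphere \<sigma>)" "(\<lambda>x. x) \<in> measurable \<sigma> borel" "space \<sigma> = unit_sphere n"
proof -
  have sets: "sets \<sigma> = sets (restrict_space borel (unit_sphere n))" and pr: "prob_space \<sigma>"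
    and inv: "\<And>U. U \<in> orthogonal_group n \<Longrightarrow> distr \<sigma> \<sigma> U = \<sigma>"
    using \<sigma> by (auto simp: uniform_sphere_measure_def)
  show sp: "space \<sigma> = unit_sphere n"
    using sets_eq_imp_space_eq[OF sets] by (simp add: space_restrict_space)
  have "(\<lambda>x. x) \<in> measurable (restrict_space borel (unit_sphere n)) borel"
    by (intro measurable_restrict_space1) simp
  then show id[measurable]: "(\<lambda>x. x) \<in> measurable \<sigma> borel"
    using measurable_cong_sets[OF sets refl] by blast
  interpret prob_space \<sigma> by fact
  have "distr (distr \<sigma> borel (\<lambda>x. x)) borel U = distr \<sigma> borel (\<lambda>x. x)" if U: "U \<in> orthogonal_group n" for U
  proof -
    have [measurable]: "U \<in> borel_measurable borel" by (rule orthogonal_group_measurable[OF U])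
    have "U \<in> measurable (restrict_space borel (unit_sphere n)) (restrict_space borel (unit_sphere n))"
    proof (rule measurable_restrict_space2)
      have "U x \<in> unit_sphere n" if "x \<in> unit_sphere n" for x
        using U that orthogonal_transformation_norm[of U x] by (auto simp: unit_sphere_iff orthogonal_group_def)
      then show "U \<in> space (restrict_space borel (unit_sphere n)) \<rightarrow> unit_sphere n"
        by (auto simp: space_restrict_space)
      show "U \<in> borel_measurable (restrict_space borel (unit_sphere n))"
        by (intro measurable_restrict_space1) simp
    qed
    then have [measurable]: "U \<in> measurable \<sigma> \<sigma>"
      using measurable_cong_sets[OF sets sets] by blast
    have "distr (distr \<sigma> borel (\<lambda>x. x)) borel U = distr \<sigma> borel U"
      by (subst distr_distr) (auto simp: o_def)
    also have "\<dots> = distr (distr \<sigma> \<sigma> U) borel (\<lambda>x. x)"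
      by (subst distr_distr) (auto simp: o_def)
    finally show ?thesis by (simp add: inv[OF U])
  qed
  moreover have "AE x in \<sigma>. x \<in> unit_sphere n"
    by (rule AE_I2) (simp add: sp)
  ultimately show "sphere_invariant n (lift_sphere \<sigma>)"
    unfolding sphere_invariant_def lift_sphere_def by (auto simp: prob_space_distr AE_distr_iff)
qed

text \<open>Polar coordinates in the only form needed: by uniqueness the measure of \<open>A\<close>
  is the share of the unit ball filled by the cone over \<open>A\<close>.\<close>

lemma emeasure_sphere_cone:
  assumes inv: "sphere_invariant n \<nu>" and n: "n \<ge> 1" and A: "A \<in> sets borel"
  shows "ennreal (ball_vol n) * emeasure \<nu> A = emeasure (lam n) (cball 0 1 \<inter> {x. sgn x \<in> A})"
proof -
  note [measurable] = A
  have "{x. sgn x \<in> A} \<in> sets borel" by measurable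
  moreover have "\<nu> = distr (uniform_measure (lam n) (cball 0 1)) borel sgn"
    by (rule sphere_invariant_unique[OF inv sphere_invariant_cone[OF n] n])
  ultimately have "emeasure \<nu> A = emeasure (lam n) (cball 0 1 \<inter> {x. sgn x \<in> A}) / ennreal (ball_vol n)"
    by (simp add: emeasure_distr vimage_def emeasure_lam_cball_eq)
  then show ?thesis
    using ball_vol_pos[of n] mult_divide_eq_ennreal[of "ennreal (ball_vol n)"]
    by (simp add: ennreal_times_divide mult.commute[of "ennreal (ball_vol n)"])
qed

text \<open>A reflection moves \<open>x0\<close> to \<open>unit_vec 0\<close>, and the cone over the
  resulting hyperplane section lies in a Lebesgue null hyperplane.\<close>

lemma AE_sphere_hyperplane:
  assumes inv: "sphere_invariant n \<nu>" and n: "n \<ge> 1" and x0: "x0 \<in> unit_sphere n"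
  shows "AE g in \<nu>. g \<bullet> x0 \<noteq> 0"
proof -
  let ?U = "householder (x0 - unit_vec 0)" and ?A = "{g. coord g 0 = 0}"
  have A: "?A \<in> sets borel" by measurable
  have "cball 0 1 \<inter> {x. sgn x \<in> ?A} \<subseteq> ?A"
    by (auto simp: sgn_div_norm)
  then have "emeasure (lam n) (cball 0 1 \<inter> {x. sgn x \<in> ?A}) \<le> emeasure (lam n) ?A"
    using A by (intro emeasure_mono) auto
  then have "ennreal (ball_vol n) * emeasure \<nu> ?A = 0"
    using emeasure_lam_coord_null[OF n] by (simp add: emeasure_sphere_cone[OF inv n A])
  then have "emeasure \<nu> ?A = 0" using ball_vol_pos[of n] by simp
  moreover have "unit_vec 0 \<in> Rn n" using n by (simp add: unit_vec_Rn)
  then have "?U \<in> orthogonal_group n"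
    using x0 by (intro householder_in_orthogonal_group subspace_diff subspace_Rn) (auto simp: unit_sphere_iff)
  then have "emeasure \<nu> {g. ?U g \<in> ?A} = emeasure \<nu> ?A"
    by (rule emeasure_orthogonal_invariant[OF inv _ A])
  moreover have "{g. ?U g \<in> ?A} = {g. g \<bullet> x0 = 0}"
  proof -
    have "?U x0 = unit_vec 0" using x0 by (intro householder_swap) (simp add: unit_sphere_iff)
    then have "coord (?U g) 0 = g \<bullet> x0" for g
      using orthogonal_transformation_householder[of "x0 - unit_vec 0"]
      by (metis inner_unit_vec orthogonal_transformation_def)
    then show ?thesis by simp
  qed
  moreover have "{g. g \<bullet> x0 = 0} \<in> sets \<nu>"
    using inv by (simp add: sphere_invariant_def)
  ultimately show ?thesis
    by (intro AE_I[of _ _ "{g. g \<bullet> x0 = 0}"]) auto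
qed

section \<open>Random subspaces\<close>

definition onb :: "fsvec set \<Rightarrow> fsvec set \<Rightarrow> bool" where
  "onb F B \<longleftrightarrow> finite B \<and> B \<subseteq> F \<and> (\<forall>b\<in>B. \<forall>c\<in>B. b \<bullet> c = (if b = c then 1 else 0)) \<and>
    (\<forall>x\<in>F. x = (\<Sum>b\<in>B. (x \<bullet> b) *\<^sub>R b))"

lemma orthonormal_independent:
  fixes B :: "fsvec set"
  assumes "\<forall>b\<in>B. \<forall>c\<in>B. b \<bullet> c = (if b = c then 1 else 0)"
  shows "independent B"
proof (rule pairwise_orthogonal_independent)
  show "pairwise orthogonal B"
    using assms by (auto simp: pairwise_def orthogonal_def)
  show "0 \<notin> B" using assms by force
qed

lemma inner_sum_orthonormal:
  fixes B :: "fsvec set"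
  assumes "finite B" "\<forall>b\<in>B. \<forall>c\<in>B. b \<bullet> c = (if b = c then 1 else 0)" "c \<in> B"
  shows "(\<Sum>b\<in>B. u b *\<^sub>R b) \<bullet> c = u c"
proof -
  have "(\<Sum>b\<in>B. u b *\<^sub>R b) \<bullet> c = (\<Sum>b\<in>B. if b = c then u b else 0)"
    unfolding inner_sum_left using assms by (intro sum.cong) auto
  then show ?thesis using assms by simp
qed

lemma onb_card:
  assumes "onb F B"
  shows "card B = dim F"
proof -
  have "F \<subseteq> span B"
  proof
    fix x assume "x \<in> F"
    then have "x = (\<Sum>b\<in>B. (x \<bullet> b) *\<^sub>R b)" using assms by (simp add: onb_def)
    also have "\<dots> \<in> span B" by (intro span_sum span_scale span_base)
    finally show "x \<in> span B" .
  qed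
  moreover have "B \<subseteq> span F" using assms span_superset by (auto simp: onb_def)
  ultimately have "span B = span F" by (meson span_mono span_span subset_antisym span_minimal subspace_span)
  moreover have "independent B" using assms by (intro orthonormal_independent) (simp add: onb_def)
  ultimately show ?thesis using dim_eq_card by metis
qed

text \<open>Take an orthonormal subset of \<open>F\<close> of maximal size, which exists because
  independence bounds the size by \<open>n\<close>. A nonzero residual of the expansion of some
  \<open>x\<close> would, once normalised, enlarge it.\<close>

lemma exists_onb:
  assumes F: "subspace F" "F \<subseteq> Rn n"
  shows "\<exists>B. onb F B"
proof -
  define ON where "ON B \<longleftrightarrow> finite B \<and> B \<subseteq> F \<and> (\<forall>b\<in>B. \<forall>c\<in>B. b \<bullet> c = (if b = c then 1 else 0))" for B
  have Rn_span: "Rn n \<subseteq> span (unit_vec ` {..<n})"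
  proof
    fix x assume "x \<in> Rn n"
    then have "x = (\<Sum>i<n. coord x i *\<^sub>R unit_vec i)" by (rule Rn_expand)
    also have "\<dots> \<in> span (unit_vec ` {..<n})" by (intro span_sum span_scale span_base) auto
    finally show "x \<in> span (unit_vec ` {..<n})" .
  qed
  have "card B < Suc n" if "ON B" for B
  proof -
    have "independent B" using that by (intro orthonormal_independent) (simp add: ON_def)
    moreover have "B \<subseteq> span (unit_vec ` {..<n})" using that F Rn_span by (auto simp: ON_def)
    ultimately have "card B \<le> card (unit_vec ` {..<n})"
      using independent_span_bound[of "unit_vec ` {..<n}" B] by simp
    also have "\<dots> \<le> n" using card_image_le[of "{..<n}" unit_vec] by simp
    finally show ?thesis by simp
  qed
  moreover have "ON {}" by (simp add: ON_def)
  ultimately obtain B where B: "ON B" "\<And>C. ON C \<Longrightarrow> card C \<le> card B"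
    using ex_has_greatest_nat[of ON "{}" card "Suc n"] by blast
  have fin: "finite B" and BF: "B \<subseteq> F" and orth: "\<forall>b\<in>B. \<forall>c\<in>B. b \<bullet> c = (if b = c then 1 else 0)"
    using B(1) by (auto simp: ON_def)
  have "x = (\<Sum>b\<in>B. (x \<bullet> b) *\<^sub>R b)" if x: "x \<in> F" for x
  proof (rule ccontr)
    define r where "r = x - (\<Sum>b\<in>B. (x \<bullet> b) *\<^sub>R b)"
    assume "x \<noteq> (\<Sum>b\<in>B. (x \<bullet> b) *\<^sub>R b)"
    then have r0: "r \<noteq> 0" by (simp add: r_def)
    have rF: "r \<in> F" unfolding r_def using x BF F(1) by (intro subspace_diff subspace_sum subspace_scale) auto
    have rc: "r \<bullet> c = 0" if "c \<in> B" for c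
      using inner_sum_orthonormal[OF fin orth that, of "\<lambda>b. x \<bullet> b"] by (simp add: r_def inner_diff_left)
    let ?s = "sgn r"
    have s1: "?s \<bullet> ?s = 1" using r0 by (simp add: norm_sgn flip: power2_norm_eq_inner)
    have sc: "?s \<bullet> c = 0" "c \<bullet> ?s = 0" if "c \<in> B" for c
      using rc[OF that] by (simp_all add: sgn_div_norm inner_commute)
    have sB: "?s \<notin> B" using s1 sc by force
    have "ON (insert ?s B)"
      unfolding ON_def using fin BF orth s1 sc sB subspace_scale[OF F(1) rF]
      by (auto simp: sgn_div_norm)
    then have "card (insert ?s B) \<le> card B" by (rule B(2))
    then show False using fin sB by simp
  qed
  then show ?thesis using fin BF orth unfolding onb_def by blast
qed

section \<open>Projections and measurability on the Grassmannian\<close>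

lemma grassD:
  assumes "F \<in> grassmannian n k"
  shows "subspace F" "F \<subseteq> Rn n" "dim F = k"
  using assms by (auto simp: grassmannian_def)

lemma orth_proj_eqI:
  assumes F: "subspace F" and y: "y \<in> F" "\<And>z. z \<in> F \<Longrightarrow> (x - y) \<bullet> z = 0"
  shows "orth_proj F x = y"
  unfolding orth_proj_def
proof (rule the_equality)
  fix y' assume y': "y' \<in> F \<and> (\<forall>z\<in>F. orthogonal (x - y') z)"
  have d: "y' - y \<in> F" using F y(1) y' by (blast intro: subspace_diff)
  have "(x - y) \<bullet> (y' - y) = 0" "(x - y') \<bullet> (y' - y) = 0" using y(2)[OF d] y' d by (auto simp: orthogonal_def)
  then have "(y' - y) \<bullet> (y' - y) = 0" by (simp add: inner_diff_left)
  then show "y' = y" by simp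
qed (use y in \<open>auto simp: orthogonal_def\<close>)

lemma orth_proj_props:
  assumes F: "F \<in> grassmannian n k"
  shows "orth_proj F x \<in> F" "z \<in> F \<Longrightarrow> (x - orth_proj F x) \<bullet> z = 0"
proof -
  obtain B where B: "onb F B" using exists_onb[OF grassD(1,2)[OF F]] by blast
  let ?y = "\<Sum>b\<in>B. (x \<bullet> b) *\<^sub>R b"
  have fin: "finite B" and BF: "B \<subseteq> F" and orth: "\<forall>b\<in>B. \<forall>c\<in>B. b \<bullet> c = (if b = c then 1 else 0)"
    using B by (auto simp: onb_def)
  have y: "?y \<in> F" using BF by (intro subspace_sum subspace_scale grassD(1)[OF F]) auto
  have z: "(x - ?y) \<bullet> z = 0" if "z \<in> F" for z
  proof -
    have "z = (\<Sum>b\<in>B. (z \<bullet> b) *\<^sub>R b)" using B that by (simp add: onb_def)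
    then have "(x - ?y) \<bullet> z = (\<Sum>b\<in>B. (z \<bullet> b) * ((x - ?y) \<bullet> b))"
      by (metis (no_types, lifting) inner_sum_right inner_scaleR_right sum.cong)
    also have "\<dots> = 0"
      using inner_sum_orthonormal[OF fin orth, of _ "\<lambda>b. x \<bullet> b"] by (simp add: inner_diff_left)
    finally show ?thesis .
  qed
  have "orth_proj F x = ?y" by (rule orth_proj_eqI[OF grassD(1)[OF F] y z])
  then show "orth_proj F x \<in> F" "z \<in> F \<Longrightarrow> (x - orth_proj F x) \<bullet> z = 0" using y z by auto
qed

lemma orth_proj_inner:
  assumes "F \<in> grassmannian n k" "z \<in> F"
  shows "orth_proj F x \<bullet> z = x \<bullet> z"
  using orth_proj_props(2)[OF assms] by (simp add: inner_diff_left)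

lemma linear_orth_proj:
  assumes F: "F \<in> grassmannian n k"
  shows "linear (orth_proj F)"
proof (rule linearI)
  note s = grassD(1)[OF F]
  show "orth_proj F (x + y) = orth_proj F x + orth_proj F y" for x y
    using orth_proj_props[OF F] orth_proj_inner[OF F]
    by (intro orth_proj_eqI[OF s] subspace_add[OF s]) (auto simp: inner_diff_left inner_add_left)
  show "orth_proj F (c *\<^sub>R x) = c *\<^sub>R orth_proj F x" for c x
    using orth_proj_props[OF F] orth_proj_inner[OF F]
    by (intro orth_proj_eqI[OF s] subspace_scale[OF s]) (auto simp: inner_diff_left)
qed

lemma norm_orth_proj_le:
  assumes F: "F \<in> grassmannian n k"
  shows "norm (orth_proj F x) \<le> norm x"
proof -
  let ?y = "orth_proj F x"
  have "norm ?y * norm ?y = x \<bullet> ?y"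
    using orth_proj_inner[OF F orth_proj_props(1)[OF F], of x x] by (simp add: power2_norm_eq_inner flip: power2_eq_square)
  also have "\<dots> \<le> norm x * norm ?y" by (rule norm_cauchy_schwarz)
  finally show ?thesis by (cases "norm ?y = 0") (auto simp: mult_le_cancel_right)
qed

lemma orth_proj_self:
  "F \<in> grassmannian n k \<Longrightarrow> x \<in> F \<Longrightarrow> orth_proj F x = x"
  by (intro orth_proj_eqI grassD(1)) auto

lemma image_grassmannian:
  assumes F: "F \<in> grassmannian n k" and U: "U \<in> orthogonal_group n"
  shows "U ` F \<in> grassmannian n k" "orth_proj (U ` F) (U x) = U (orth_proj F x)"
proof -
  have ot: "orthogonal_transformation U" and im: "U ` Rn n = Rn n"
    using U by (auto simp: orthogonal_group_def)
  have lin: "linear U" by (rule orthogonal_transformation_linear[OF ot])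
  have inner: "U x \<bullet> U y = x \<bullet> y" for x y using ot by (simp add: orthogonal_transformation_def)
  have sub: "subspace (U ` F)" by (rule linear_subspace_image[OF lin grassD(1)[OF F]])
  have inj: "inj U" by (rule orthogonal_transformation_inj[OF ot])
  obtain B where B: "onb F B" using exists_onb[OF grassD(1,2)[OF F]] by blast
  have injB: "inj_on U B" using inj by (rule inj_on_subset) simp
  have "onb (U ` F) (U ` B)"
    unfolding onb_def
  proof (intro conjI ballI)
    show "finite (U ` B)" "U ` B \<subseteq> U ` F" using B by (auto simp: onb_def)
    show "b \<bullet> c = (if b = c then 1 else 0)" if "b \<in> U ` B" "c \<in> U ` B" for b c
      using that B inj by (auto simp: onb_def inner inj_eq)
    show "x = (\<Sum>b\<in>U ` B. (x \<bullet> b) *\<^sub>R b)" if x: "x \<in> U ` F" for x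
    proof -
      obtain y where y: "y \<in> F" "x = U y" using x by blast
      have "(\<Sum>b\<in>U ` B. (x \<bullet> b) *\<^sub>R b) = (\<Sum>b\<in>B. (y \<bullet> b) *\<^sub>R U b)"
        unfolding y(2) by (simp add: sum.reindex[OF injB] inner)
      also have "\<dots> = U (\<Sum>b\<in>B. (y \<bullet> b) *\<^sub>R b)"
        by (simp add: linear_sum[OF lin] linear_scale[OF lin])
      also have "(\<Sum>b\<in>B. (y \<bullet> b) *\<^sub>R b) = y" using B y(1) by (simp add: onb_def)
      finally show ?thesis using y(2) by simp
    qed
  qed
  from onb_card[OF this] have "dim (U ` F) = card (U ` B)" by simp
  also have "\<dots> = card B" by (rule card_image[OF injB])
  also have "\<dots> = k" using onb_card[OF B] grassD(3)[OF F] by simp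
  finally have "dim (U ` F) = k" .
  moreover have "U ` F \<subseteq> U ` Rn n" by (rule image_mono[OF grassD(2)[OF F]])
  ultimately show "U ` F \<in> grassmannian n k"
    using sub unfolding im grassmannian_def by simp
  show "orth_proj (U ` F) (U x) = U (orth_proj F x)"
  proof (rule orth_proj_eqI[OF sub])
    show "U (orth_proj F x) \<in> U ` F" using orth_proj_props(1)[OF F] by blast
    show "(U x - U (orth_proj F x)) \<bullet> z = 0" if "z \<in> U ` F" for z
      using that orth_proj_props(2)[OF F] by (auto simp: inner linear_diff[OF lin, symmetric])
  qed
qed

lemma bdd_above_grassmannian_dist:
  assumes "E \<in> grassmannian n k" "F \<in> grassmannian n k"
  shows "bdd_above ((\<lambda>x. norm (orth_proj E x - orth_proj F x)) ` (cball 0 1 \<inter> Rn n))"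
proof (rule bdd_aboveI2)
  fix x assume "x \<in> cball 0 1 \<inter> Rn n"
  then have "norm x \<le> 1" by simp
  then show "norm (orth_proj E x - orth_proj F x) \<le> 2"
    using norm_triangle_ineq4[of "orth_proj E x" "orth_proj F x"]
      norm_orth_proj_le[OF assms(1), of x] norm_orth_proj_le[OF assms(2), of x] by linarith
qed

lemma norm_orth_proj_diff_le:
  assumes E: "E \<in> grassmannian n k" and F: "F \<in> grassmannian n k" and x: "x \<in> Rn n" "norm x \<le> 1"
  shows "norm (orth_proj E x - orth_proj F x) \<le> grassmannian_dist n E F"
  unfolding grassmannian_dist_def
  using x by (intro cSUP_upper bdd_above_grassmannian_dist[OF E F]) auto

lemma grassmannian_dist_image_le:
  assumes E: "E \<in> grassmannian n k" and F: "F \<in> grassmannian n k" and U: "U \<in> orthogonal_group n"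
  shows "grassmannian_dist n (U ` E) (U ` F) \<le> grassmannian_dist n E F"
  unfolding grassmannian_dist_def[of n "U ` E"]
proof (rule cSUP_least)
  have ot: "orthogonal_transformation U" and im: "U ` Rn n = Rn n"
    using U by (auto simp: orthogonal_group_def)
  have "0 \<in> cball 0 1 \<inter> Rn n" by simp
  then show "cball 0 1 \<inter> Rn n \<noteq> {}" by blast
  fix x assume x: "x \<in> cball 0 1 \<inter> Rn n"
  then have "x \<in> U ` Rn n" unfolding im by simp
  then obtain z where z: "z \<in> Rn n" "x = U z" by blast
  have "norm z \<le> 1" using x z(2) orthogonal_transformation_norm[OF ot] by simp
  have "orth_proj (U ` E) x - orth_proj (U ` F) x = U (orth_proj E z - orth_proj F z)"
    unfolding z(2) image_grassmannian(2)[OF E U] image_grassmannian(2)[OF F U]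
    by (simp add: linear_diff[OF orthogonal_transformation_linear[OF ot]])
  then have "norm (orth_proj (U ` E) x - orth_proj (U ` F) x) = norm (orth_proj E z - orth_proj F z)"
    by (simp add: orthogonal_transformation_norm[OF ot])
  also have "\<dots> \<le> grassmannian_dist n E F"
    by (rule norm_orth_proj_diff_le[OF E F z(1) \<open>norm z \<le> 1\<close>])
  finally show "norm (orth_proj (U ` E) x - orth_proj (U ` F) x) \<le> grassmannian_dist n E F" .
qed

definition grass_open :: "nat \<Rightarrow> nat \<Rightarrow> fsvec set set \<Rightarrow> bool" where
  "grass_open n k A \<longleftrightarrow> A \<subseteq> grassmannian n k \<and>
    (\<forall>E\<in>A. \<exists>e>0. \<forall>F\<in>grassmannian n k. grassmannian_dist n E F < e \<longrightarrow> F \<in> A)"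

lemma grassmannian_borel_eq: "grassmannian_borel n k = sigma (grassmannian n k) (Collect (grass_open n k))"
  unfolding grassmannian_borel_def grass_open_def ..

lemma grass_open_Pow: "Collect (grass_open n k) \<subseteq> Pow (grassmannian n k)"
  by (auto simp: grass_open_def)

lemma space_grassmannian_borel [simp]: "space (grassmannian_borel n k) = grassmannian n k"
  unfolding grassmannian_borel_eq using grass_open_Pow by (simp add: space_measure_of)

lemma sets_grass_open: "grass_open n k A \<Longrightarrow> A \<in> sets (grassmannian_borel n k)"
  unfolding grassmannian_borel_eq using grass_open_Pow by (simp add: sets_measure_of sigma_sets.Basic)

text \<open>Images under \<open>U\<close> do not increase the distance, so preimages of open sets
  are open. Measurability is what allows integrals over the image of the Haar measure to be
  transformed.\<close>

lemma measurable_image_grassmannian: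
  assumes U: "U \<in> orthogonal_group n"
  shows "(`) U \<in> measurable (grassmannian_borel n k) (grassmannian_borel n k)"
  unfolding measurable_cong_sets[OF refl arg_cong[OF grassmannian_borel_eq, of sets]]
proof (rule measurable_measure_of[OF grass_open_Pow])
  show "(`) U \<in> space (grassmannian_borel n k) \<rightarrow> grassmannian n k"
    using image_grassmannian(1)[OF _ U] by auto
  fix A assume "A \<in> Collect (grass_open n k)"
  then have A: "grass_open n k A" by simp
  have "grass_open n k {F \<in> grassmannian n k. U ` F \<in> A}"
    unfolding grass_open_def
  proof (intro conjI ballI)
    fix E assume "E \<in> {F \<in> grassmannian n k. U ` F \<in> A}"
    then have E: "E \<in> grassmannian n k" "U ` E \<in> A" by auto
    then obtain e where e: "e > 0" "\<And>F. F \<in> grassmannian n k \<Longrightarrow> grassmannian_dist n (U ` E) F < e \<Longrightarrow> F \<in> A"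
      using A unfolding grass_open_def by blast
    show "\<exists>e>0. \<forall>F\<in>grassmannian n k. grassmannian_dist n E F < e \<longrightarrow> F \<in> {F \<in> grassmannian n k. U ` F \<in> A}"
      using e image_grassmannian(1)[OF _ U] le_less_trans[OF grassmannian_dist_image_le[OF E(1) _ U]]
      by (intro exI[of _ e]) auto
  qed auto
  then have "{F \<in> grassmannian n k. U ` F \<in> A} \<in> sets (grassmannian_borel n k)" by (rule sets_grass_open)
  also have "{F \<in> grassmannian n k. U ` F \<in> A} = (`) U -` A \<inter> space (grassmannian_borel n k)" by auto
  finally show "(`) U -` A \<inter> space (grassmannian_borel n k) \<in> sets (grassmannian_borel n k)" .
qed

lemma measurable_orth_proj:
  assumes x: "x \<in> Rn n" "norm x \<le> 1"
  shows "(\<lambda>F. orth_proj F x) \<in> borel_measurable (grassmannian_borel n k)"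
proof (rule borel_measurableI)
  fix V :: "fsvec set" assume V: "open V"
  have "grass_open n k {F \<in> grassmannian n k. orth_proj F x \<in> V}"
    unfolding grass_open_def
  proof (intro conjI ballI)
    fix E assume "E \<in> {F \<in> grassmannian n k. orth_proj F x \<in> V}"
    then have E: "E \<in> grassmannian n k" "orth_proj E x \<in> V" by auto
    then obtain e where e: "e > 0" "ball (orth_proj E x) e \<subseteq> V" using V open_contains_ball by blast
    show "\<exists>e>0. \<forall>F\<in>grassmannian n k. grassmannian_dist n E F < e \<longrightarrow> F \<in> {F \<in> grassmannian n k. orth_proj F x \<in> V}"
    proof (intro exI[of _ e] conjI ballI impI e)
      fix F assume F: "F \<in> grassmannian n k" "grassmannian_dist n E F < e"
      have "dist (orth_proj E x) (orth_proj F x) < e"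
        using norm_orth_proj_diff_le[OF E(1) F(1) x] F(2) by (simp add: dist_norm)
      then show "F \<in> {F \<in> grassmannian n k. orth_proj F x \<in> V}" using e(2) F(1) by auto
    qed
  qed auto
  then have "{F \<in> grassmannian n k. orth_proj F x \<in> V} \<in> sets (grassmannian_borel n k)" by (rule sets_grass_open)
  also have "{F \<in> grassmannian n k. orth_proj F x \<in> V} = (\<lambda>F. orth_proj F x) -` V \<inter> space (grassmannian_borel n k)"
    by auto
  finally show "(\<lambda>F. orth_proj F x) -` V \<inter> space (grassmannian_borel n k) \<in> sets (grassmannian_borel n k)" .
qed

text \<open>On \<open>Rn n\<close> this is the orthogonal projection; as a sum of products of measurable functions it
  is visibly jointly measurable.\<close>

definition coord_proj :: "nat \<Rightarrow> fsvec set \<Rightarrow> fsvec \<Rightarrow> fsvec" where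
  "coord_proj n F g = (\<Sum>j<n. coord g j *\<^sub>R orth_proj F (unit_vec j))"

lemma coord_proj_eq:
  assumes F: "F \<in> grassmannian n k" and g: "g \<in> Rn n"
  shows "coord_proj n F g = orth_proj F g"
proof -
  have "orth_proj F g = orth_proj F (\<Sum>j<n. coord g j *\<^sub>R unit_vec j)" using Rn_expand[OF g] by simp
  also have "\<dots> = coord_proj n F g"
    unfolding coord_proj_def by (simp add: linear_sum[OF linear_orth_proj[OF F]] linear_scale[OF linear_orth_proj[OF F]])
  finally show ?thesis by simp
qed

lemma coord_proj_in:
  assumes F: "F \<in> grassmannian n k"
  shows "coord_proj n F g \<in> F"
  unfolding coord_proj_def by (intro subspace_sum subspace_scale grassD(1)[OF F] orth_proj_props(1)[OF F])

lemma measurable_coord_proj [measurable]: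
  "(\<lambda>(F, g). sgn (coord_proj n F g)) \<in> borel_measurable (grassmannian_borel n k \<Otimes>\<^sub>M borel)"
proof -
  have [measurable]: "(\<lambda>F. orth_proj F (unit_vec j)) \<in> borel_measurable (grassmannian_borel n k)" if "j \<in> {..<n}" for j
    using that by (intro measurable_orth_proj) (auto simp: unit_vec_Rn)
  show ?thesis unfolding coord_proj_def by measurable
qed

lemma measurable_coord_proj2: "(\<lambda>g. sgn (coord_proj n F g)) \<in> borel_measurable borel"
  unfolding coord_proj_def by measurable

lemma sgn_coord_proj_sphere:
  assumes F: "F \<in> grassmannian n k" and g: "coord_proj n F g \<noteq> 0"
  shows "sgn (coord_proj n F g) \<in> F \<inter> unit_sphere n"
proof -
  have "sgn (coord_proj n F g) \<in> F"
    unfolding sgn_div_norm by (intro subspace_scale grassD(1)[OF F] coord_proj_in[OF F])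
  then show ?thesis using g grassD(2)[OF F] by (auto simp: unit_sphere_iff norm_sgn)
qed

lemma grassmannian_unit_vector:
  assumes F: "F \<in> grassmannian n k" and k: "k \<ge> 1"
  shows "\<exists>x. x \<in> F \<inter> unit_sphere n"
proof -
  obtain B where B: "onb F B" using exists_onb[OF grassD(1,2)[OF F]] by blast
  then have "card B = k" using onb_card[OF B] grassD(3)[OF F] by simp
  then obtain b where "b \<in> B" using k by fastforce
  then have "b \<in> F" "b \<bullet> b = 1" using B by (auto simp: onb_def)
  then show ?thesis using grassD(2)[OF F] by (intro exI[of _ b]) (auto simp: unit_sphere_iff norm_eq_sqrt_inner)
qed

lemma sphere_invariant_AE:
  assumes "sphere_invariant n \<nu>"
  shows "AE x in \<nu>. x \<in> unit_sphere n" "AE x in \<nu>. x \<in> Rn n" "sets \<nu> = sets borel" "space \<nu> = UNIV" "prob_space \<nu>"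
proof -
  show 1: "AE x in \<nu>. x \<in> unit_sphere n" and s: "sets \<nu> = sets borel" and "prob_space \<nu>"
    using assms by (auto simp: sphere_invariant_def)
  from 1 show "AE x in \<nu>. x \<in> Rn n" by eventually_elim (simp add: unit_sphere_iff)
  show "space \<nu> = UNIV" using sets_eq_imp_space_eq[OF s] by simp
qed

text \<open>A vector with vanishing projection is orthogonal to a fixed unit vector
  \<open>x0\<close> of \<open>F\<close>, a null event.\<close>

lemma AE_coord_proj_nonzero:
  assumes inv: "sphere_invariant n \<nu>" and F: "F \<in> grassmannian n k" and k: "k \<ge> 1" and n: "n \<ge> 1"
  shows "AE g in \<nu>. coord_proj n F g \<noteq> 0"
proof -
  obtain x0 where x0: "x0 \<in> F" "x0 \<in> unit_sphere n" using grassmannian_unit_vector[OF F k] by blast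
  show ?thesis
    using AE_sphere_hyperplane[OF inv n x0(2)] sphere_invariant_AE(2)[OF inv]
  proof eventually_elim
    case (elim g)
    then show ?case using orth_proj_inner[OF F x0(1), of g] coord_proj_eq[OF F, of g] by auto
  qed
qed

lemma haarD:
  assumes "haar_grassmannian n k \<mu>"
  shows "prob_space \<mu>" "sets \<mu> = sets (grassmannian_borel n k)" "space \<mu> = grassmannian n k"
    "U \<in> orthogonal_group n \<Longrightarrow> distr \<mu> \<mu> ((`) U) = \<mu>"
proof -
  show "prob_space \<mu>" and s: "sets \<mu> = sets (grassmannian_borel n k)"
    and "U \<in> orthogonal_group n \<Longrightarrow> distr \<mu> \<mu> ((`) U) = \<mu>"
    using assms by (auto simp: haar_grassmannian_def)
  show "space \<mu> = grassmannian n k" using sets_eq_imp_space_eq[OF s] by simp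
qed

section \<open>Averaging over random subspaces and measures of caps\<close>

lemma emeasure_coord_proj_invariant:
  assumes inv: "sphere_invariant n \<nu>" and U: "U \<in> orthogonal_group n" and F: "F \<in> grassmannian n k"
    and A: "A \<in> sets borel"
  shows "emeasure \<nu> {g. U (sgn (coord_proj n F g)) \<in> A} = emeasure \<nu> {g. sgn (coord_proj n (U ` F) g) \<in> A}"
proof -
  have [measurable]: "U \<in> borel_measurable borel" by (rule orthogonal_group_measurable[OF U])
  note [measurable] = A measurable_coord_proj2
  have im: "U ` Rn n = Rn n" using U by (simp add: orthogonal_group_def)
  note s = sphere_invariant_AE[OF inv]
  have "emeasure \<nu> {g. U (sgn (coord_proj n F g)) \<in> A} = emeasure \<nu> {g. U g \<in> {g. sgn (coord_proj n (U ` F) g) \<in> A}}"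
  proof (rule emeasure_eq_AE)
    show "AE g in \<nu>. g \<in> {g. U (sgn (coord_proj n F g)) \<in> A} \<longleftrightarrow> g \<in> {g. U g \<in> {g. sgn (coord_proj n (U ` F) g) \<in> A}}"
      using s(2)
    proof eventually_elim
      case (elim g)
      have "U g \<in> U ` Rn n" using elim by blast
      then have "U g \<in> Rn n" unfolding im .
      then have "coord_proj n (U ` F) (U g) = U (coord_proj n F g)"
        using elim coord_proj_eq[OF F] coord_proj_eq[OF image_grassmannian(1)[OF F U]] image_grassmannian(2)[OF F U] by simp
      then show ?case using orthogonal_group_sgn[OF U] by simp
    qed
    show "{g. U (sgn (coord_proj n F g)) \<in> A} \<in> sets \<nu>" unfolding s(3) by measurable
    show "{g. U g \<in> {g. sgn (coord_proj n (U ` F) g) \<in> A}} \<in> sets \<nu>" unfolding s(3) by measurable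
  qed
  also have "\<dots> = emeasure \<nu> {g. sgn (coord_proj n (U ` F) g) \<in> A}"
    by (intro emeasure_orthogonal_invariant[OF inv U]) measurable
  finally show ?thesis .
qed

text \<open>The normalised projection of a random \<open>g\<close> plays the role of a uniform point
  on the sphere of \<open>F\<close>, so no measures on these spheres have to be constructed. For
  random \<open>F\<close> its law is rotation invariant and by uniqueness equal to
  \<open>\<nu>\<close>.\<close>

lemma random_subspace_marginal:
  assumes inv: "sphere_invariant n \<nu>" and haar: "haar_grassmannian n k \<mu>" and k: "k \<ge> 1" and n: "n \<ge> 1"
    and A: "A \<in> sets borel"
  shows "(\<integral>\<^sup>+F. emeasure \<nu> {g. sgn (coord_proj n F g) \<in> A} \<partial>\<mu>) = emeasure \<nu> A"
proof -
  note s = sphere_invariant_AE[OF inv] and h = haarD[OF haar]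
  note [measurable_cong] = s(3) h(2)
  interpret N: prob_space \<nu> by (rule s)
  interpret M: prob_space \<mu> by (rule h)
  interpret P: pair_prob_space \<mu> \<nu> ..
  let ?f = "\<lambda>(F, g). sgn (coord_proj n F g)"
  let ?\<rho> = "distr (\<mu> \<Otimes>\<^sub>M \<nu>) borel ?f"
  have f[measurable]: "?f \<in> borel_measurable (\<mu> \<Otimes>\<^sub>M \<nu>)"
    using measurable_coord_proj[of n k] measurable_cong_sets[OF sets_pair_measure_cong[OF h(2) s(3)] refl] by blast
  have sp: "space (\<mu> \<Otimes>\<^sub>M \<nu>) = grassmannian n k \<times> UNIV" by (simp add: space_pair_measure h(3) s(4))
  have pre: "{z \<in> space (\<mu> \<Otimes>\<^sub>M \<nu>). ?f z \<in> A} \<in> sets (\<mu> \<Otimes>\<^sub>M \<nu>)" if "A \<in> sets borel" for A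
    using measurable_sets[OF f that] by (simp add: vimage_def Int_def conj_commute)
  have meas: "(\<lambda>F. emeasure \<nu> {g. sgn (coord_proj n F g) \<in> A}) \<in> borel_measurable \<mu>"
    and em: "emeasure ?\<rho> A = (\<integral>\<^sup>+F. emeasure \<nu> {g. sgn (coord_proj n F g) \<in> A} \<partial>\<mu>)"
    if A: "A \<in> sets borel" for A
  proof -
    let ?S = "{z \<in> space (\<mu> \<Otimes>\<^sub>M \<nu>). ?f z \<in> A}"
    have slice: "Pair F -` ?S = {g. sgn (coord_proj n F g) \<in> A}" if "F \<in> space \<mu>" for F
      using that by (auto simp: sp h(3))
    have "(\<lambda>F. emeasure \<nu> (Pair F -` ?S)) \<in> borel_measurable \<mu>"
      by (rule N.measurable_emeasure_Pair[OF pre[OF A]])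
    then show "(\<lambda>F. emeasure \<nu> {g. sgn (coord_proj n F g) \<in> A}) \<in> borel_measurable \<mu>"
      using slice by (subst (asm) measurable_cong) auto
    have "emeasure ?\<rho> A = emeasure (\<mu> \<Otimes>\<^sub>M \<nu>) ?S"
      using A by (subst emeasure_distr) (auto simp: vimage_def Int_def conj_commute intro!: arg_cong2[where f = emeasure])
    also have "\<dots> = (\<integral>\<^sup>+F. emeasure \<nu> (Pair F -` ?S) \<partial>\<mu>)"
      by (rule N.emeasure_pair_measure_alt[OF pre[OF A]])
    also have "\<dots> = (\<integral>\<^sup>+F. emeasure \<nu> {g. sgn (coord_proj n F g) \<in> A} \<partial>\<mu>)"
      using slice by (intro nn_integral_cong) auto
    finally show "emeasure ?\<rho> A = (\<integral>\<^sup>+F. emeasure \<nu> {g. sgn (coord_proj n F g) \<in> A} \<partial>\<mu>)" .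
  qed
  have "sphere_invariant n ?\<rho>"
    unfolding sphere_invariant_def
  proof (intro conjI ballI)
    show "prob_space ?\<rho>" by (rule P.prob_space_distr[OF f])
    have "AE z in \<mu> \<Otimes>\<^sub>M \<nu>. ?f z \<in> unit_sphere n"
    proof (rule P.AE_pair_measure[OF pre])
      show "AE F in \<mu>. AE g in \<nu>. ?f (F, g) \<in> unit_sphere n"
      proof (rule AE_I2)
        fix F assume "F \<in> space \<mu>"
        then have F: "F \<in> grassmannian n k" by (simp add: h(3))
        show "AE g in \<nu>. ?f (F, g) \<in> unit_sphere n"
          using AE_coord_proj_nonzero[OF inv F k n] by eventually_elim (use sgn_coord_proj_sphere[OF F] in auto)
      qed
    qed simp
    then show "AE x in ?\<rho>. x \<in> unit_sphere n"
      by (subst AE_distr_iff[OF f]) auto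
    fix U assume U: "U \<in> orthogonal_group n"
    have U'[measurable]: "U \<in> borel_measurable borel" by (rule orthogonal_group_measurable[OF U])
    have imU: "(`) U \<in> measurable \<mu> \<mu>"
      using measurable_image_grassmannian[OF U, of k] measurable_cong_sets[OF h(2) h(2)] by blast
    show "distr ?\<rho> borel U = ?\<rho>"
    proof (rule measure_eqI)
      fix A assume "A \<in> sets (distr ?\<rho> borel U)"
      then have A: "A \<in> sets borel" by simp
      have A': "{x. U x \<in> A} \<in> sets borel" using A by measurable
      have "emeasure (distr ?\<rho> borel U) A = emeasure ?\<rho> {x. U x \<in> A}"
        using A by (subst emeasure_distr) (auto simp: vimage_def)
      also have "\<dots> = (\<integral>\<^sup>+F. emeasure \<nu> {g. U (sgn (coord_proj n F g)) \<in> A} \<partial>\<mu>)"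
        by (subst em[OF A']) simp
      \<comment> \<open>Invariance of \<open>\<nu>\<close> transfers \<open>U\<close> to the
        subspace; invariance of \<open>\<mu>\<close> then absorbs it.\<close>
      also have "\<dots> = (\<integral>\<^sup>+F. emeasure \<nu> {g. sgn (coord_proj n (U ` F) g) \<in> A} \<partial>\<mu>)"
        by (intro nn_integral_cong emeasure_coord_proj_invariant[OF inv U _ A]) (simp add: h(3))
      also have "\<dots> = (\<integral>\<^sup>+F. emeasure \<nu> {g. sgn (coord_proj n F g) \<in> A} \<partial>distr \<mu> \<mu> ((`) U))"
        using meas[OF A] by (subst nn_integral_distr[OF imU]) auto
      also have "\<dots> = emeasure ?\<rho> A" by (simp only: h(4)[OF U] em[OF A])
      finally show "emeasure (distr ?\<rho> borel U) A = emeasure ?\<rho> A" .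
    qed simp
  qed simp
  then have "?\<rho> = \<nu>" by (rule sphere_invariant_unique[OF _ inv n])
  then show "(\<integral>\<^sup>+F. emeasure \<nu> {g. sgn (coord_proj n F g) \<in> A} \<partial>\<mu>) = emeasure \<nu> A"
    using em[OF A] by simp
qed

text \<open>Packing by volume: the balls of radius \<open>\<delta> / 2\<close> around the points are
  disjoint and lie in the ball of radius 3/2.\<close>

lemma separated_card_le:
  assumes F: "F \<in> grassmannian n k" and \<delta>: "0 < \<delta>" "\<delta> \<le> 1"
    and T: "finite T" "T \<subseteq> F \<inter> unit_sphere n" "\<And>x y. x \<in> T \<Longrightarrow> y \<in> T \<Longrightarrow> x \<noteq> y \<Longrightarrow> dist x y > \<delta>"
  shows "real (card T) \<le> (3 / \<delta>) ^ k"
proof -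
  obtain B where B: "onb F B" using exists_onb[OF grassD(1,2)[OF F]] by blast
  have fin: "finite B" and orth: "\<forall>b\<in>B. \<forall>c\<in>B. b \<bullet> c = (if b = c then 1 else 0)" using B by (auto simp: onb_def)
  have card: "card B = k" using onb_card[OF B] grassD(3)[OF F] by simp
  then obtain b where b: "bij_betw b {..<k} B"
    using ex_bij_betw_nat_finite[OF fin] by (auto simp: atLeast0LessThan)
  \<comment> \<open>Coordinates in an orthonormal basis: an isometry of \<open>F\<close> into
    \<open>Rn k\<close>, where \<open>lam k\<close> measures volume.\<close>
  define \<phi> where "\<phi> x = emb k (\<lambda>i. x \<bullet> b i)" for x
  have \<phi>_diff: "\<phi> x - \<phi> y = \<phi> (x - y)" for x y
    by (rule fsvec_eqI) (simp add: \<phi>_def inner_diff_left)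
  have \<phi>_norm: "norm (\<phi> x) = norm x" if "x \<in> F" for x
  proof -
    have "x \<bullet> x = x \<bullet> (\<Sum>c\<in>B. (x \<bullet> c) *\<^sub>R c)" using B that by (simp add: onb_def)
    also have "\<dots> = (\<Sum>c\<in>B. (x \<bullet> c)\<^sup>2)" by (simp add: inner_sum_right power2_eq_square)
    also have "\<dots> = (\<Sum>i<k. (x \<bullet> b i)\<^sup>2)" by (rule sum.reindex_bij_betw[OF b, symmetric])
    finally have "x \<bullet> x = (\<Sum>i<k. (x \<bullet> b i)\<^sup>2)" .
    then show ?thesis unfolding \<phi>_def norm_emb by (simp add: norm_eq_sqrt_inner)
  qed
  have \<phi>_dist: "dist (\<phi> x) (\<phi> y) = dist x y" if "x \<in> T" "y \<in> T" for x y
    using that T(2) subspace_diff[OF grassD(1)[OF F], of x y] by (simp add: dist_norm \<phi>_diff \<phi>_norm subset_eq)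
  let ?C = "\<lambda>x. cball (\<phi> x) (\<delta> / 2)"
  have "disjoint_family_on ?C T"
    unfolding disjoint_family_on_def
  proof (intro ballI impI)
    fix x y assume xy: "x \<in> T" "y \<in> T" "x \<noteq> y"
    show "?C x \<inter> ?C y = {}"
    proof (rule ccontr)
      assume "?C x \<inter> ?C y \<noteq> {}"
      then obtain z where "dist (\<phi> x) z \<le> \<delta> / 2" "dist (\<phi> y) z \<le> \<delta> / 2" by auto
      then have "dist (\<phi> x) (\<phi> y) \<le> \<delta>" using dist_triangle2[of "\<phi> x" "\<phi> y" z] by simp
      then show False using T(3)[OF xy] \<phi>_dist[OF xy(1,2)] by simp
    qed
  qed
  then have "(\<Sum>x\<in>T. emeasure (lam k) (?C x)) = emeasure (lam k) (\<Union>x\<in>T. ?C x)"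
    using T(1) by (intro sum_emeasure) auto
  also have "\<dots> \<le> emeasure (lam k) (cball 0 (3 / 2))"
  proof (intro emeasure_mono UN_least)
    fix x assume x: "x \<in> T"
    then have "x \<in> F" "norm x = 1" using T(2) by (auto simp: unit_sphere_iff subset_eq)
    then have "norm (\<phi> x) = 1" by (simp add: \<phi>_norm)
    show "?C x \<subseteq> cball 0 (3 / 2)"
    proof
      fix z assume "z \<in> ?C x"
      then have "norm (z - \<phi> x) \<le> 1 / 2" using \<delta>(2) by (simp add: dist_norm norm_minus_commute)
      then show "z \<in> cball 0 (3 / 2)"
        using norm_triangle_sub[of z "\<phi> x"] \<open>norm (\<phi> x) = 1\<close> by simp
    qed
  qed simp
  finally have "(\<Sum>x\<in>T. ennreal ((\<delta> / 2) ^ k * ball_vol k)) \<le> ennreal ((3 / 2) ^ k * ball_vol k)"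
    using \<delta> emb_Rn by (simp add: emeasure_lam_cball \<phi>_def)
  then have "ennreal (real (card T) * ((\<delta> / 2) ^ k * ball_vol k)) \<le> ennreal ((3 / 2) ^ k * ball_vol k)"
    using \<delta> ball_vol_pos[of k] by (simp add: ennreal_mult ennreal_of_nat_eq_real_of_nat)
  then have "real (card T) * ((\<delta> / 2) ^ k * ball_vol k) \<le> (3 / 2) ^ k * ball_vol k"
    using ball_vol_pos[of k] by (subst (asm) ennreal_le_iff) auto
  then have "real (card T) * (\<delta> / 2) ^ k \<le> (3 / 2) ^ k" using ball_vol_pos[of k] by simp
  then have "real (card T) \<le> (3 / 2) ^ k / (\<delta> / 2) ^ k" using \<delta> by (simp add: pos_le_divide_eq)
  also have "\<dots> = (3 / \<delta>) ^ k" by (simp add: power_divide[symmetric])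
  finally show ?thesis .
qed

text \<open>The caps around a maximal separated set cover the sphere of \<open>F\<close> and all have the same measure.\<close>

lemma cap_measure_ge:
  assumes inv: "sphere_invariant n \<nu>" and F: "F \<in> grassmannian n k" and k: "k \<ge> 1" and n: "n \<ge> 1"
    and x0: "x0 \<in> F \<inter> unit_sphere n" and \<delta>: "0 < \<delta>" "\<delta> \<le> 1"
  shows "ennreal ((\<delta> / 3) ^ k) \<le> emeasure \<nu> {g. sgn (coord_proj n F g) \<in> cball x0 \<delta>}"
proof -
  note s = sphere_invariant_AE[OF inv]
  interpret N: prob_space \<nu> by (rule s)
  note [measurable] = measurable_coord_proj2
  let ?S = "\<lambda>x. {g. sgn (coord_proj n F g) \<in> cball x \<delta>}"
  have meas: "?S x \<in> sets \<nu>" for x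
  proof -
    have [measurable]: "cball x \<delta> \<in> sets borel" by simp
    show ?thesis unfolding s(3) by measurable
  qed
  define sep where "sep T \<longleftrightarrow> finite T \<and> T \<subseteq> F \<inter> unit_sphere n \<and> (\<forall>x\<in>T. \<forall>y\<in>T. x \<noteq> y \<longrightarrow> dist x y > \<delta>)" for T
  have "card T < Suc (nat \<lfloor>(3 / \<delta>) ^ k\<rfloor>)" if "sep T" for T
    using separated_card_le[OF F \<delta>, of T] that by (auto simp: sep_def le_nat_floor less_Suc_eq_le)
  moreover have "sep {}" by (simp add: sep_def)
  ultimately obtain T where T: "sep T" "\<And>T'. sep T' \<Longrightarrow> card T' \<le> card T"
    using ex_has_greatest_nat[of sep "{}" card] by blast
  have fin: "finite T" and TF: "T \<subseteq> F \<inter> unit_sphere n" using T(1) by (auto simp: sep_def)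
  have cover: "\<exists>x\<in>T. dist x y \<le> \<delta>" if y: "y \<in> F \<inter> unit_sphere n" for y
  proof (rule ccontr)
    assume "\<not> (\<exists>x\<in>T. dist x y \<le> \<delta>)"
    then have far: "dist x y > \<delta>" "dist y x > \<delta>" if "x \<in> T" for x using that by (auto simp: dist_commute not_le)
    then have "y \<notin> T" using \<delta> by force
    moreover have "sep (insert y T)" using T(1) far y by (auto simp: sep_def)
    ultimately show False using T(2)[of "insert y T"] fin by simp
  qed
  have same: "emeasure \<nu> (?S x) = emeasure \<nu> (?S x0)" if x: "x \<in> F \<inter> unit_sphere n" for x
  proof -
    \<comment> \<open>Since \<open>x - x0\<close> lies in \<open>F\<close>, this reflection maps
      \<open>F\<close> onto itself while it carries the cap at \<open>x\<close> to the cap at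
      \<open>x0\<close>.\<close>
    let ?U = "householder (x - x0)"
    have uF: "x - x0 \<in> F" using x x0 by (intro subspace_diff grassD(1)[OF F]) auto
    have U: "?U \<in> orthogonal_group n" using uF grassD(2)[OF F] by (intro householder_in_orthogonal_group) auto
    have UF: "?U z \<in> F" if "z \<in> F" for z
      unfolding householder_def
      by (rule subspace_diff[OF grassD(1)[OF F] that subspace_scale[OF grassD(1)[OF F] uF]])
    have imF: "?U ` F = F"
    proof (intro equalityI subsetI)
      fix z assume "z \<in> F"
      then show "z \<in> ?U ` F" using UF by (intro image_eqI[of _ _ "?U z"]) auto
    qed (use UF in auto)
    have Ux: "?U x = x0" using x x0 by (intro householder_swap) (simp add: unit_sphere_iff)
    have "dist (?U x) (?U z) = dist x z" for z
      using orthogonal_transformation_norm[OF orthogonal_transformation_householder, of "x - x0" "x - z"]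
        linear_diff[OF orthogonal_transformation_linear[OF orthogonal_transformation_householder], of "x - x0" x z]
      by (simp add: dist_norm)
    then have "?S x = {g. ?U (sgn (coord_proj n F g)) \<in> cball x0 \<delta>}" by (simp add: Ux)
    also have "emeasure \<nu> \<dots> = emeasure \<nu> {g. sgn (coord_proj n (?U ` F) g) \<in> cball x0 \<delta>}"
      by (rule emeasure_coord_proj_invariant[OF inv U F]) simp
    finally show ?thesis by (simp add: imF)
  qed
  have "emeasure \<nu> UNIV \<le> emeasure \<nu> (\<Union>x\<in>T. ?S x)"
  proof (rule emeasure_mono_AE)
    show "AE g in \<nu>. g \<in> UNIV \<longrightarrow> g \<in> (\<Union>x\<in>T. ?S x)"
      using AE_coord_proj_nonzero[OF inv F k n] by eventually_elim (use cover sgn_coord_proj_sphere[OF F] in auto)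
    show "(\<Union>x\<in>T. ?S x) \<in> sets \<nu>" using fin meas by auto
  qed
  also have "\<dots> \<le> (\<Sum>x\<in>T. emeasure \<nu> (?S x))" using fin meas by (intro emeasure_subadditive_finite) auto
  also have "\<dots> = (\<Sum>x\<in>T. emeasure \<nu> (?S x0))" using same TF by (intro sum.cong) auto
  also have "\<dots> = ennreal (real (card T)) * emeasure \<nu> (?S x0)"
    by (simp add: ennreal_of_nat_eq_real_of_nat)
  also have "\<dots> \<le> ennreal ((3 / \<delta>) ^ k) * emeasure \<nu> (?S x0)"
    using separated_card_le[OF F \<delta>, of T] T(1) by (intro mult_right_mono ennreal_leI) (auto simp: sep_def)
  finally have "1 \<le> ennreal ((3 / \<delta>) ^ k) * emeasure \<nu> (?S x0)"
    using N.emeasure_space_1 by (simp add: s(4))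
  then have "ennreal ((\<delta> / 3) ^ k) * 1 \<le> ennreal ((\<delta> / 3) ^ k) * (ennreal ((3 / \<delta>) ^ k) * emeasure \<nu> (?S x0))"
    by (intro mult_left_mono) auto
  also have "\<dots> = ennreal ((\<delta> / 3) ^ k * (3 / \<delta>) ^ k) * emeasure \<nu> (?S x0)"
    using \<delta> by (simp add: ennreal_mult' mult.assoc)
  also have "(\<delta> / 3) ^ k * (3 / \<delta>) ^ k = 1" using \<delta> by (simp add: power_mult_distrib[symmetric])
  finally show ?thesis by simp
qed

text \<open>Each \<open>F\<close> in \<open>M\<close> contributes at least the measure of one cap to
  an average over all \<open>F\<close> that equals the measure of \<open>A\<close>.\<close>

lemma random_subspace_small_ball:
  assumes inv: "sphere_invariant n \<nu>" and haar: "haar_grassmannian n k \<mu>" and k: "k \<ge> 1" and n: "n \<ge> 1"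
    and A: "A \<in> sets borel" and M: "M \<in> sets \<mu>" and \<delta>: "0 < \<delta>" "\<delta> \<le> 1"
    and MA: "\<And>F. F \<in> M \<Longrightarrow> \<exists>x0\<in>F \<inter> unit_sphere n. cball x0 \<delta> \<inter> unit_sphere n \<subseteq> A"
  shows "emeasure \<mu> M * ennreal ((\<delta> / 3) ^ k) \<le> emeasure \<nu> A"
proof -
  note s = sphere_invariant_AE[OF inv] and h = haarD[OF haar]
  note [measurable] = measurable_coord_proj2 A
  have "emeasure \<mu> M * ennreal ((\<delta> / 3) ^ k) = (\<integral>\<^sup>+F. ennreal ((\<delta> / 3) ^ k) * indicator M F \<partial>\<mu>)"
    using M by (subst nn_integral_cmult_indicator) (auto simp: mult.commute)
  also have "\<dots> \<le> (\<integral>\<^sup>+F. emeasure \<nu> {g. sgn (coord_proj n F g) \<in> A} \<partial>\<mu>)"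
  proof (rule nn_integral_mono)
    fix F assume "F \<in> space \<mu>"
    then have F: "F \<in> grassmannian n k" by (simp add: h(3))
    show "ennreal ((\<delta> / 3) ^ k) * indicator M F \<le> emeasure \<nu> {g. sgn (coord_proj n F g) \<in> A}"
    proof (cases "F \<in> M")
      case True
      then obtain x0 where x0: "x0 \<in> F \<inter> unit_sphere n" "cball x0 \<delta> \<inter> unit_sphere n \<subseteq> A" using MA by blast
      have "ennreal ((\<delta> / 3) ^ k) \<le> emeasure \<nu> {g. sgn (coord_proj n F g) \<in> cball x0 \<delta>}"
        by (rule cap_measure_ge[OF inv F k n x0(1) \<delta>])
      also have "\<dots> \<le> emeasure \<nu> {g. sgn (coord_proj n F g) \<in> A}"
      proof (rule emeasure_mono_AE)
        show "AE g in \<nu>. g \<in> {g. sgn (coord_proj n F g) \<in> cball x0 \<delta>} \<longrightarrow> g \<in> {g. sgn (coord_proj n F g) \<in> A}"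
          using AE_coord_proj_nonzero[OF inv F k n] by eventually_elim (use x0(2) sgn_coord_proj_sphere[OF F] in blast)
        show "{g. sgn (coord_proj n F g) \<in> A} \<in> sets \<nu>" unfolding s(3) by measurable
      qed
      finally show ?thesis using True by simp
    qed simp
  qed
  also have "\<dots> = emeasure \<nu> A" by (rule random_subspace_marginal[OF inv haar k n A])
  finally show ?thesis .
qed

section \<open>Inradii of projections\<close>

lemma support_fun_bounds:
  assumes L: "L \<noteq> {}" "L \<subseteq> cball 0 R"
  shows "y \<in> L \<Longrightarrow> x \<bullet> y \<le> support_fun L x"
    and "support_fun L x \<le> c \<longleftrightarrow> (\<forall>y\<in>L. x \<bullet> y \<le> c)"
    and "\<bar>support_fun L x - support_fun L z\<bar> \<le> R * norm (x - z)"
proof -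
  have le: "x \<bullet> y \<le> R * norm x" if "y \<in> L" for x y
  proof -
    have "x \<bullet> y \<le> norm x * norm y" by (rule norm_cauchy_schwarz)
    also have "\<dots> \<le> norm x * R" using that L by (intro mult_left_mono) auto
    finally show ?thesis by (simp add: mult.commute)
  qed
  then have bdd: "bdd_above ((\<bullet>) x ` L)" for x by (rule bdd_aboveI2)
  show up: "y \<in> L \<Longrightarrow> x \<bullet> y \<le> support_fun L x" for x y
    unfolding support_fun_def by (intro cSUP_upper bdd)
  show iff: "support_fun L x \<le> c \<longleftrightarrow> (\<forall>y\<in>L. x \<bullet> y \<le> c)" for x c
    unfolding support_fun_def by (rule cSUP_le_iff[OF L(1) bdd])
  have "support_fun L x \<le> support_fun L z + R * norm (x - z)" for x z
    unfolding iff
  proof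
    fix y assume "y \<in> L"
    then show "x \<bullet> y \<le> support_fun L z + R * norm (x - z)"
      using le[of y "x - z"] up[of y z] by (simp add: inner_diff_left)
  qed
  from this[of x z] this[of z x] show "\<bar>support_fun L x - support_fun L z\<bar> \<le> R * norm (x - z)"
    by (simp add: norm_minus_commute abs_le_iff)
qed

lemma measurable_support_fun:
  assumes L: "L \<noteq> {}" "L \<subseteq> cball 0 R"
  shows "support_fun L \<in> borel_measurable borel"
proof (rule borel_measurable_continuous_onI)
  have "R \<ge> 0" using L by (metis all_not_in_conv cball_eq_empty not_le subset_empty)
  have "dist (support_fun L x) (support_fun L z) \<le> R * dist x z" for x z
    using support_fun_bounds(3)[OF L, of x z] by (simp add: dist_norm)
  then have "R-lipschitz_on UNIV (support_fun L)"
    using \<open>R \<ge> 0\<close> by (intro lipschitz_onI) auto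
  then show "continuous_on UNIV (support_fun L)" by (rule lipschitz_on_continuous_on)
qed

lemma emeasure_lam_bounded:
  assumes "L \<subseteq> cball 0 R"
  shows "emeasure (lam n) L = ennreal (measure (lam n) L)"
proof -
  have "emeasure (lam n) L \<le> emeasure (lam n) (cball 0 R)" using assms by (intro emeasure_mono) auto
  also have "\<dots> < \<infinity>" by (rule emeasure_lam_cball_finite)
  finally show ?thesis by (intro emeasure_eq_ennreal_measure) auto
qed

text \<open>In \<open>santalo_unconditional\<close> the factor 4 collects the two sign factors 2 per
  coordinate, and \<open>exp 7\<close> comes from \<open>exp (6 * n) * exp n\<close>.\<close>

definition santalo_const :: real where "santalo_const = 4 * exp 7"

lemma santalo_const_ge: "santalo_const \<ge> 4"
  by (simp add: santalo_const_def)

text \<open>By homogeneity the part in the unit ball of the cone over the sublevel set lies in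
  \<open>s\<close> times the polar of \<open>L\<close>, to which Santalo applies.\<close>

lemma measure_polar_cone:
  assumes inv: "sphere_invariant n \<nu>" and n: "n \<ge> 1"
    and L: "L \<in> sets borel" "L \<noteq> {}" "L \<subseteq> cball 0 \<rho>" and sym: "\<And>y. y \<in> L \<Longrightarrow> - y \<in> L"
    and s: "s > 0"
  shows "ball_vol n * measure \<nu> {x. support_fun L x \<le> s} * measure (lam n) L \<le> (s * santalo_const / real n) ^ n"
proof -
  note si = sphere_invariant_AE[OF inv]
  interpret N: prob_space \<nu> by (rule si)
  note [measurable] = measurable_support_fun[OF L(2,3)]
  let ?A = "\<lambda>s. {x. support_fun L x \<le> s}"
  have meas: "?A s \<in> sets borel" for s by measurable
  have sub: "cball 0 1 \<inter> {x. sgn x \<in> ?A s} \<subseteq> ?A s"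
  proof
    fix x assume x: "x \<in> cball 0 1 \<inter> {x. sgn x \<in> ?A s}"
    have "x \<bullet> y \<le> s" if "y \<in> L" for y
    proof -
      have "sgn x \<bullet> y \<le> s" using x that by (simp add: support_fun_bounds(2)[OF L(2,3)])
      then have "norm x * (sgn x \<bullet> y) \<le> norm x * s" by (intro mult_left_mono) auto
      also have "\<dots> \<le> 1 * s" using x s by (intro mult_right_mono) auto
      also have "norm x * (sgn x \<bullet> y) = x \<bullet> y" by (cases "x = 0") (auto simp: sgn_div_norm)
      finally show ?thesis by simp
    qed
    then show "x \<in> ?A s" by (simp add: support_fun_bounds(2)[OF L(2,3)])
  qed
  have "?A s = {x. x /\<^sub>R s \<in> ?A 1}"
    using s by (auto simp: support_fun_bounds(2)[OF L(2,3)] field_simps)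
  then have scale: "emeasure (lam n) (?A s) = ennreal (s ^ n) * emeasure (lam n) (?A 1)"
    using emeasure_lam_scale[OF meas s] by simp
  have "ennreal (ball_vol n) * emeasure \<nu> (?A s) * emeasure (lam n) L
    = emeasure (lam n) (cball 0 1 \<inter> {x. sgn x \<in> ?A s}) * emeasure (lam n) L"
    by (simp add: emeasure_sphere_cone[OF inv n meas])
  also have "\<dots> \<le> emeasure (lam n) (?A s) * emeasure (lam n) L"
    using sub meas by (intro mult_right_mono emeasure_mono) auto
  also have "\<dots> = ennreal (s ^ n) * (emeasure (lam n) (?A 1) * emeasure (lam n) L)"
    by (simp add: scale mult.assoc)
  also have "\<dots> \<le> ennreal (s ^ n) * ennreal ((4 * exp 7 / real n) ^ n)"
    using L meas sym n by (intro mult_left_mono santalo_lam) (auto simp: support_fun_bounds(2)[OF L(2,3)])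
  also have "\<dots> = ennreal ((s * santalo_const / real n) ^ n)"
    using s by (simp add: santalo_const_def power_mult_distrib power_divide flip: ennreal_mult')
  finally have "ennreal (ball_vol n * measure \<nu> (?A s) * measure (lam n) L) \<le> ennreal ((s * santalo_const / real n) ^ n)"
    using ball_vol_pos[of n] by (simp add: N.emeasure_eq_measure emeasure_lam_bounded[OF L(3)] ennreal_mult)
  then show ?thesis
    using s santalo_const_ge by (subst (asm) ennreal_le_iff) auto
qed

text \<open>Cancels the power of \<open>n\<close> in the Santalo bound: one ball volume comes from
  polar coordinates, the other from the volume hypothesis on \<open>L\<close>.\<close>

lemma ball_vol_square_ge: "n \<ge> 1 \<Longrightarrow> (4 / real n) ^ n \<le> ball_vol n * ball_vol n"
proof -
  assume n: "n \<ge> 1"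
  have "(4 / real n) ^ n = (2 / sqrt (real n)) ^ n * (2 / sqrt (real n)) ^ n"
    using n by (simp add: power_mult_distrib[symmetric])
  also have "\<dots> \<le> ball_vol n * ball_vol n" by (intro mult_mono ball_vol_ge) (auto intro: less_imp_le[OF ball_vol_pos])
  finally show ?thesis .
qed

text \<open>The parameter \<open>a\<close> measures the volume radius of \<open>L\<close> relative
  to \<open>\<rho>\<close>. Small caps bound the measure of \<open>M\<close> times
  \<open>(\<delta> / 3) ^ k\<close> by the measure of a sublevel set of the support function, and
  the polar volume bounds the latter by an \<open>n\<close>-th power.\<close>

lemma small_support_probability:
  assumes inv: "sphere_invariant n \<nu>" and haar: "haar_grassmannian n k \<mu>" and k: "k \<ge> 1" and n: "n \<ge> 2 * k"
    and L: "L \<in> sets borel" "L \<noteq> {}" "L \<subseteq> cball 0 \<rho>" and sym: "\<And>y. y \<in> L \<Longrightarrow> - y \<in> L"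
    and \<rho>: "\<rho> > 0" and a: "a > 0" and vol: "(a * \<rho>) ^ n * ball_vol n \<le> measure (lam n) L"
    and M: "M \<in> sets \<mu>"
    and bad: "\<And>F. F \<in> M \<Longrightarrow> \<exists>x0\<in>F \<inter> unit_sphere n. support_fun L x0 < a\<^sup>2 * \<rho> / (3 * santalo_const\<^sup>2)"
  shows "measure \<mu> M \<le> (1 / 4) ^ k"
proof -
  note si = sphere_invariant_AE[OF inv]
  interpret N: prob_space \<nu> by (rule si)
  interpret M: prob_space \<mu> by (rule haarD(1)[OF haar])
  have n1: "n \<ge> 1" using n k by simp
  have C: "santalo_const \<ge> 4" by (rule santalo_const_ge)
  \<comment> \<open>Chosen so that \<open>(\<epsilon> * a * santalo_const / 2)\<^sup>2\<close>
    equals \<open>\<delta> / 3\<close> times 1/4: the cap factor cancels and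
    \<open>(1 / 4) ^ k\<close> remains.\<close>
  define \<epsilon> where "\<epsilon> = 1 / (3 * santalo_const\<^sup>2)"
  have \<epsilon>: "\<epsilon> > 0" using C by (simp add: \<epsilon>_def)
  define t where "t = \<epsilon> * a\<^sup>2 * \<rho>"
  have t: "t > 0" using \<epsilon> a \<rho> by (simp add: t_def)
  define \<delta> where "\<delta> = \<epsilon> * a\<^sup>2"
  \<comment> \<open>Comparing volumes forces \<open>a\<close> to be at most 1; hence the cap radius
    \<open>\<delta>\<close> is at most 1, and so is the base of the final power.\<close>
  have "measure (lam n) L \<le> measure (lam n) (cball 0 \<rho>)"
  proof -
    have "emeasure (lam n) L \<le> emeasure (lam n) (cball 0 \<rho>)" using L(3) by (intro emeasure_mono) auto
    then show ?thesis
      by (simp add: emeasure_lam_bounded[OF L(3)] emeasure_lam_bounded[OF order_refl])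
  qed
  also have "measure (lam n) (cball 0 \<rho>) = \<rho> ^ n * ball_vol n"
    using emeasure_lam_cball[OF \<rho> zero_Rn[of n]] \<rho> ball_vol_pos[of n] by (simp add: measure_def)
  finally have "(a * \<rho>) ^ n * ball_vol n \<le> \<rho> ^ n * ball_vol n" using vol by simp
  then have "(a * \<rho>) ^ n \<le> \<rho> ^ n" by (rule mult_right_le_imp_le) (rule ball_vol_pos)
  then have "a ^ n * \<rho> ^ n \<le> 1 * \<rho> ^ n" by (simp add: power_mult_distrib)
  then have "a ^ n \<le> 1" by (rule mult_right_le_imp_le) (use \<rho> in simp)
  then have a1: "a \<le> 1" using a n1 power_le_one_iff[of a n] by auto
  have "1 * 1 \<le> santalo_const * santalo_const" using C by (intro mult_mono) auto
  then have "\<epsilon> \<le> 1" using C by (simp add: \<epsilon>_def power2_eq_square)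
  then have \<delta>: "0 < \<delta>" "\<delta> \<le> 1"
    using \<epsilon> a a1 by (auto simp: \<delta>_def mult_le_one power_le_one)
  let ?A = "{x. support_fun L x \<le> 2 * t}"
  note [measurable] = measurable_support_fun[OF L(2,3)]
  have A: "?A \<in> sets borel" by measurable
  have "emeasure \<mu> M * ennreal ((\<delta> / 3) ^ k) \<le> emeasure \<nu> ?A"
  proof (rule random_subspace_small_ball[OF inv haar k n1 A M \<delta>])
    fix F assume "F \<in> M"
    then obtain x0 where x0: "x0 \<in> F \<inter> unit_sphere n" "support_fun L x0 < t"
      using bad by (auto simp: t_def \<epsilon>_def)
    have "cball x0 \<delta> \<subseteq> ?A"
    proof
      fix x assume "x \<in> cball x0 \<delta>"
      then have "\<rho> * norm (x - x0) \<le> \<rho> * \<delta>" using \<rho> by (simp add: dist_norm norm_minus_commute)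
      also have "\<rho> * \<delta> = t" by (simp add: t_def \<delta>_def)
      finally show "x \<in> ?A" using support_fun_bounds(3)[OF L(2,3), of x x0] x0(2) by (simp add: abs_le_iff)
    qed
    then show "\<exists>x0\<in>F \<inter> unit_sphere n. cball x0 \<delta> \<inter> unit_sphere n \<subseteq> ?A" using x0(1) by blast
  qed
  then have "ennreal (measure \<mu> M * (\<delta> / 3) ^ k) \<le> ennreal (measure \<nu> ?A)"
    using \<delta> by (simp add: N.emeasure_eq_measure M.emeasure_eq_measure ennreal_mult')
  then have 1: "measure \<mu> M * (\<delta> / 3) ^ k \<le> measure \<nu> ?A" by simp
  have "measure \<nu> ?A * (a * \<rho> * (4 / real n)) ^ n = measure \<nu> ?A * (a * \<rho>) ^ n * (4 / real n) ^ n"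
    by (simp only: power_mult_distrib mult.assoc)
  also have "\<dots> \<le> measure \<nu> ?A * (a * \<rho>) ^ n * (ball_vol n * ball_vol n)"
    using ball_vol_square_ge[OF n1] a \<rho> by (intro mult_left_mono) auto
  also have "\<dots> = ball_vol n * measure \<nu> ?A * ((a * \<rho>) ^ n * ball_vol n)" by (simp only: mult_ac)
  also have "\<dots> \<le> ball_vol n * measure \<nu> ?A * measure (lam n) L"
    using vol ball_vol_pos[of n] by (intro mult_left_mono) auto
  also have "\<dots> \<le> (2 * t * santalo_const / real n) ^ n"
    using t by (intro measure_polar_cone[OF inv n1 L sym]) auto
  also have "2 * t * santalo_const / real n = (\<epsilon> * a * santalo_const / 2) * (a * \<rho> * (4 / real n))"
    by (simp add: t_def power2_eq_square)
  finally have "measure \<nu> ?A * (a * \<rho> * (4 / real n)) ^ n \<le> (\<epsilon> * a * santalo_const / 2) ^ n * (a * \<rho> * (4 / real n)) ^ n"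
    by (simp only: power_mult_distrib)
  then have 2: "measure \<nu> ?A \<le> (\<epsilon> * a * santalo_const / 2) ^ n"
    using a \<rho> n1 by (simp add: mult_le_cancel_right)
  have "\<epsilon> * santalo_const \<le> 1" using C by (simp add: \<epsilon>_def power2_eq_square)
  then have "\<epsilon> * santalo_const * a \<le> 1 * 1" using a a1 by (intro mult_mono) auto
  then have "\<epsilon> * a * santalo_const / 2 \<le> 1" by (simp add: mult_ac)
  \<comment> \<open>The place where \<open>n \<ge> 2 * k\<close> enters: the two powers of
    \<open>a\<close> match the \<open>a\<^sup>2\<close> in the cap radius.\<close>
  then have "(\<epsilon> * a * santalo_const / 2) ^ n \<le> (\<epsilon> * a * santalo_const / 2) ^ (2 * k)"
    using n \<epsilon> a C by (intro power_decreasing) auto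
  also have "\<dots> = ((\<epsilon> * a * santalo_const / 2)\<^sup>2) ^ k" by (simp add: power_mult)
  also have "(\<epsilon> * a * santalo_const / 2)\<^sup>2 = 1 / 4 * (\<delta> / 3)"
    using C by (simp add: \<delta>_def \<epsilon>_def power2_eq_square field_simps)
  also have "(1 / 4 * (\<delta> / 3)) ^ k = (1 / 4) ^ k * (\<delta> / 3) ^ k" by (rule power_mult_distrib)
  finally have "measure \<mu> M * (\<delta> / 3) ^ k \<le> (1 / 4) ^ k * (\<delta> / 3) ^ k" using 1 2 by linarith
  then show ?thesis using \<delta> by (simp add: mult_le_cancel_right)
qed

section \<open>Support function and inradius of projections of a symmetric body\<close>

text \<open>The radii \<open>r\<close> and \<open>R\<close> are qualitative: they ensure positivity,
  finiteness and continuity and appear in none of the probability or volume bounds.\<close>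

locale sym_body =
  fixes n :: nat and K :: "fsvec set" and r R :: real
  assumes K_Rn: "K \<subseteq> Rn n" and K_compact: "compact K" and K_convex: "convex K"
    and K_sym: "\<And>y. y \<in> K \<Longrightarrow> - y \<in> K"
    and r_pos: "r > 0" and ball_K: "cball 0 r \<inter> Rn n \<subseteq> K" and R_pos: "R > 0" and K_ball: "K \<subseteq> cball 0 R"
    and n_pos: "n \<ge> 1"
begin

lemma zero_K: "0 \<in> K"
  using ball_K r_pos by (auto intro!: subsetD[OF ball_K])

lemma K_ne: "K \<noteq> {}"
  using zero_K by blast

lemma K_borel [measurable]: "K \<in> sets borel"
  using K_compact by (rule borel_compact)

lemmas supp = support_fun_bounds[OF K_ne K_ball]

lemma support_fun_ge:
  assumes "x \<in> Rn n"
  shows "r * norm x \<le> support_fun K x"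
proof (cases "x = 0")
  case False
  have "(r / norm x) *\<^sub>R x \<in> K"
    using assms False r_pos by (intro subsetD[OF ball_K]) (auto intro: subspace_scale[OF subspace_Rn])
  from supp(1)[OF this, of x] show ?thesis using False by (simp add: power2_norm_eq_inner[symmetric] power2_eq_square)
qed (use supp(1)[OF zero_K, of 0] in simp)

text \<open>Duality: on \<open>F\<close> the support functions of \<open>K\<close> and of its
  projection coincide. If a point \<open>z\<close> of the scaled ball missed the compact convex
  projection, the difference \<open>u\<close> to its nearest point \<open>p\<close> would give
  \<open>t * norm u \<le> u \<bullet> p < u \<bullet> z \<le> t * norm u\<close>.\<close>

lemma inradius_set_iff:
  assumes F: "F \<in> grassmannian n k" and t: "t > 0"
  shows "(*\<^sub>R) t ` (cball 0 1 \<inter> F) \<subseteq> orth_proj F ` K \<longleftrightarrow> (\<forall>x\<in>F \<inter> unit_sphere n. t \<le> support_fun K x)"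
proof
  assume sub: "(*\<^sub>R) t ` (cball 0 1 \<inter> F) \<subseteq> orth_proj F ` K"
  show "\<forall>x\<in>F \<inter> unit_sphere n. t \<le> support_fun K x"
  proof
    fix x assume x: "x \<in> F \<inter> unit_sphere n"
    then have "t *\<^sub>R x \<in> orth_proj F ` K" by (intro subsetD[OF sub]) (auto simp: unit_sphere_iff)
    then obtain q where q: "q \<in> K" "t *\<^sub>R x = orth_proj F q" by blast
    have "q \<bullet> x = (t *\<^sub>R x) \<bullet> x" using orth_proj_inner[OF F, of x q] x q(2) by simp
    also have "\<dots> = t" using x by (simp add: unit_sphere_iff norm_eq_1)
    finally show "t \<le> support_fun K x" using supp(1)[OF q(1), of x] by (simp add: inner_commute)
  qed
next
  assume ge: "\<forall>x\<in>F \<inter> unit_sphere n. t \<le> support_fun K x"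
  let ?L = "orth_proj F ` K"
  have sF: "subspace F" by (rule grassD(1)[OF F])
  have lin: "linear (orth_proj F)" by (rule linear_orth_proj[OF F])
  have "1-lipschitz_on UNIV (orth_proj F)"
    using norm_orth_proj_le[OF F] by (intro lipschitz_onI) (auto simp: dist_norm linear_diff[OF lin, symmetric])
  then have "continuous_on K (orth_proj F)"
    using lipschitz_on_continuous_on continuous_on_subset by blast
  then have cL: "compact ?L" using K_compact by (rule compact_continuous_image)
  have vL: "convex ?L" using K_convex lin by (rule convex_linear_image[rotated])
  show "(*\<^sub>R) t ` (cball 0 1 \<inter> F) \<subseteq> ?L"
  proof (rule subsetI, rule ccontr)
    fix z assume z: "z \<in> (*\<^sub>R) t ` (cball 0 1 \<inter> F)" "z \<notin> ?L"
    then obtain y where y: "norm y \<le> 1" "y \<in> F" "z = t *\<^sub>R y" by auto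
    have "continuous_on ?L (dist z)" by (intro continuous_intros)
    then obtain p where p: "p \<in> ?L" "\<And>q. q \<in> ?L \<Longrightarrow> dist z p \<le> dist z q"
      using continuous_attains_inf[OF cL, of "dist z"] K_ne by auto
    define u where "u = z - p"
    have u0: "u \<noteq> 0" using z(2) p(1) by (auto simp: u_def)
    have uF: "u \<in> F" unfolding u_def y(3)
      using p(1) y(2) orth_proj_props(1)[OF F] sF by (auto intro!: subspace_diff subspace_scale)
    have sep: "u \<bullet> q \<le> u \<bullet> p" if q: "q \<in> ?L" for q
    proof (rule ccontr)
      assume "\<not> u \<bullet> q \<le> u \<bullet> p"
      then have pos: "u \<bullet> (q - p) > 0" by (simp add: inner_diff_right)
      then have qp: "q \<noteq> p" by auto
      \<comment> \<open>The minimiser of the quadratic distance along the line from \<open>p\<close>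
        to \<open>q\<close>, capped to stay on the segment; it would come closer to \<open>z\<close>
        than \<open>p\<close> does.\<close>
      define s where "s = min 1 (u \<bullet> (q - p) / (norm (q - p))\<^sup>2)"
      have s: "0 < s" "s \<le> 1" "s * (norm (q - p))\<^sup>2 \<le> u \<bullet> (q - p)"
      proof -
        show "0 < s" "s \<le> 1" using pos qp by (auto simp: s_def)
        have "s * (norm (q - p))\<^sup>2 \<le> u \<bullet> (q - p) / (norm (q - p))\<^sup>2 * (norm (q - p))\<^sup>2"
          by (intro mult_right_mono) (auto simp: s_def)
        then show "s * (norm (q - p))\<^sup>2 \<le> u \<bullet> (q - p)" using qp by simp
      qed
      have "(1 - s) *\<^sub>R p + s *\<^sub>R q \<in> ?L" using s p(1) q by (intro convexD[OF vL]) auto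
      then have "dist z p \<le> dist z ((1 - s) *\<^sub>R p + s *\<^sub>R q)" by (rule p(2))
      then have "(norm u)\<^sup>2 \<le> (norm (u - s *\<^sub>R (q - p)))\<^sup>2"
        by (intro power_mono) (auto simp: dist_norm u_def algebra_simps)
      also have "\<dots> = (norm u)\<^sup>2 - 2 * s * (u \<bullet> (q - p)) + s * (s * (norm (q - p))\<^sup>2)"
        unfolding power2_norm_eq_inner
        by (simp add: inner_diff_left inner_diff_right inner_commute algebra_simps)
      also have "\<dots> \<le> (norm u)\<^sup>2 - 2 * s * (u \<bullet> (q - p)) + s * (u \<bullet> (q - p))"
        using s by (intro add_left_mono mult_left_mono) auto
      finally have "s * (u \<bullet> (q - p)) \<le> 0" by simp
      then show False using s(1) pos by (simp add: mult_le_0_iff)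
    qed
    have "u \<bullet> q \<le> u \<bullet> p" if "q \<in> K" for q
      using sep[of "orth_proj F q"] that orth_proj_inner[OF F uF, of q] by (simp add: inner_commute)
    then have "support_fun K (sgn u) \<le> (u \<bullet> p) / norm u"
      unfolding supp(2) using u0 by (auto simp: sgn_div_norm divide_right_mono divide_inverse_commute[symmetric] inverse_eq_divide)
    moreover have "sgn u \<in> F \<inter> unit_sphere n"
    proof -
      have "sgn u \<in> F" unfolding sgn_div_norm by (rule subspace_scale[OF sF uF])
      then show ?thesis using u0 grassD(2)[OF F] by (auto simp: unit_sphere_iff norm_sgn)
    qed
    ultimately have "t \<le> (u \<bullet> p) / norm u" using ge by force
    then have 1: "t * norm u \<le> u \<bullet> p" using u0 by (simp add: pos_le_divide_eq)
    have "u \<bullet> p = u \<bullet> z - u \<bullet> u" by (simp add: u_def inner_diff_right)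
    also have "\<dots> < u \<bullet> z" using u0 by simp
    also have "u \<bullet> z \<le> norm u * (t * norm y)" using norm_cauchy_schwarz[of u z] t by (simp add: y(3))
    also have "\<dots> \<le> norm u * (t * 1)" using y(1) t by (intro mult_left_mono) auto
    finally show False using 1 by (simp add: mult.commute)
  qed
qed

text \<open>The bound by the support function is a closed condition on \<open>t\<close>, so the
  supremum behaves like a maximum.\<close>

lemma inradius_ge_iff:
  assumes F: "F \<in> grassmannian n k" and k: "k \<ge> 1" and t: "t > 0"
  shows "t \<le> inradius F (orth_proj F ` K) \<longleftrightarrow> (\<forall>x\<in>F \<inter> unit_sphere n. t \<le> support_fun K x)"
proof -
  define S where "S = {s. s > 0 \<and> (*\<^sub>R) s ` (cball 0 1 \<inter> F) \<subseteq> orth_proj F ` K}"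
  have S: "s \<in> S \<longleftrightarrow> s > 0 \<and> (\<forall>x\<in>F \<inter> unit_sphere n. s \<le> support_fun K x)" for s
    using inradius_set_iff[OF F, of s] by (auto simp: S_def)
  have inr: "inradius F (orth_proj F ` K) = Sup S" by (simp add: inradius_def S_def)
  have "r \<in> S" using r_pos support_fun_ge by (auto simp: S unit_sphere_iff) (metis mult.right_neutral)
  then have ne: "S \<noteq> {}" by blast
  obtain x where x: "x \<in> F \<inter> unit_sphere n" using grassmannian_unit_vector[OF F k] by blast
  then have bdd: "bdd_above S" by (intro bdd_aboveI[of _ "support_fun K x"]) (simp add: S)
  show ?thesis
    unfolding inr
  proof
    assume "t \<le> Sup S"
    moreover have "Sup S \<le> support_fun K x" if "x \<in> F \<inter> unit_sphere n" for x
      using that by (intro cSup_least[OF ne]) (simp add: S)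
    ultimately show "\<forall>x\<in>F \<inter> unit_sphere n. t \<le> support_fun K x" by (meson order_trans)
  next
    assume "\<forall>x\<in>F \<inter> unit_sphere n. t \<le> support_fun K x"
    then have "t \<in> S" using t by (simp add: S)
    then show "t \<le> Sup S" by (rule cSup_upper[OF _ bdd])
  qed
qed

text \<open>Makes the bad event measurable. A witness \<open>x\<close> in \<open>E\<close>,
  projected to a nearby \<open>F\<close> and normalised again, moves by less than
  \<open>2 * e\<close>, and the support function is \<open>R\<close>-Lipschitz.\<close>

lemma grass_open_small_support:
  "grass_open n k {F \<in> grassmannian n k. \<exists>x\<in>F \<inter> unit_sphere n. support_fun K x < t}"
  unfolding grass_open_def
proof (intro conjI ballI)
  fix E assume "E \<in> {F \<in> grassmannian n k. \<exists>x\<in>F \<inter> unit_sphere n. support_fun K x < t}"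
  then obtain x where E: "E \<in> grassmannian n k" and x: "x \<in> E" "norm x = 1" "x \<in> Rn n" "support_fun K x < t"
    by (auto simp: unit_sphere_iff)
  \<comment> \<open>The bound 1/2 keeps the projected vector nonzero; the other keeps the Lipschitz
    error \<open>2 * e * R\<close> within the slack.\<close>
  define e where "e = min (1 / 2) ((t - support_fun K x) / (2 * R))"
  show "\<exists>e>0. \<forall>F\<in>grassmannian n k. grassmannian_dist n E F < e \<longrightarrow>
      F \<in> {F \<in> grassmannian n k. \<exists>x\<in>F \<inter> unit_sphere n. support_fun K x < t}"
  proof (intro exI[of _ e] conjI ballI impI)
    show "e > 0" using x(4) R_pos by (simp add: e_def)
    fix F assume F: "F \<in> grassmannian n k" and d: "grassmannian_dist n E F < e"
    let ?y = "orth_proj F x"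
    have xy: "norm (x - ?y) < e"
      using norm_orth_proj_diff_le[OF E F x(3)] x(2) d orth_proj_self[OF E x(1)] by simp
    then have "norm (x - ?y) < 1 / 2" by (simp add: e_def)
    then have y0: "?y \<noteq> 0" using x(2) by auto
    have "sgn ?y \<in> F"
      unfolding sgn_div_norm by (rule subspace_scale[OF grassD(1)[OF F] orth_proj_props(1)[OF F]])
    then have sF: "sgn ?y \<in> F \<inter> unit_sphere n"
      using y0 grassD(2)[OF F] by (auto simp: unit_sphere_iff norm_sgn)
    have "norm ?y *\<^sub>R sgn ?y = ?y" using y0 by (simp add: sgn_div_norm)
    then have "?y - sgn ?y = (norm ?y - 1) *\<^sub>R sgn ?y" by (simp only: scaleR_diff_left scaleR_one)
    then have "norm (?y - sgn ?y) = \<bar>norm ?y - 1\<bar>" using y0 by (simp add: norm_sgn)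
    also have "\<dots> \<le> norm (x - ?y)" using norm_triangle_ineq3[of x ?y] x(2) by (simp add: abs_minus_commute)
    finally have "norm (sgn ?y - x) < 2 * e"
      using xy norm_triangle_ineq[of "x - ?y" "?y - sgn ?y"] by (simp add: norm_minus_commute)
    then have "R * norm (sgn ?y - x) < R * (2 * e)" using R_pos by simp
    also have "\<dots> \<le> R * (2 * ((t - support_fun K x) / (2 * R)))"
      using R_pos by (intro mult_left_mono) (auto simp: e_def)
    also have "\<dots> = t - support_fun K x" using R_pos by simp
    finally have "support_fun K (sgn ?y) < t" using supp(3)[of "sgn ?y" x] by (simp add: abs_le_iff)
    then show "F \<in> {F \<in> grassmannian n k. \<exists>x\<in>F \<inter> unit_sphere n. support_fun K x < t}" using F sF by blast
  qed
qed auto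

lemma inradius_probability:
  assumes inv: "sphere_invariant n \<nu>" and haar: "haar_grassmannian n k \<mu>" and k: "k \<ge> 1" and n: "n \<ge> 2 * k"
    and \<rho>: "\<rho> > 0" and a: "a > 0" and vol: "(a * \<rho>) ^ n * ball_vol n \<le> measure (lam n) (K \<inter> cball 0 \<rho>)"
    and t: "0 < t" "t \<le> a\<^sup>2 * \<rho> / (3 * santalo_const\<^sup>2)"
  shows "measure \<mu> {F \<in> space \<mu>. inradius F (orth_proj F ` K) \<ge> t} \<ge> 1 - exp (- real k)"
proof -
  note h = haarD[OF haar]
  interpret M: prob_space \<mu> by (rule h)
  let ?M = "{F \<in> grassmannian n k. \<exists>x\<in>F \<inter> unit_sphere n. support_fun K x < t}"
  have M: "?M \<in> sets \<mu>" unfolding h(2) by (rule sets_grass_open[OF grass_open_small_support])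
  have "measure \<mu> ?M \<le> (1 / 4) ^ k"
  proof (rule small_support_probability[OF inv haar k n _ _ _ _ \<rho> a vol M])
    show "K \<inter> cball 0 \<rho> \<in> sets borel" by measurable
    show ne: "K \<inter> cball 0 \<rho> \<noteq> {}" using zero_K \<rho> by auto
    show "- y \<in> K \<inter> cball 0 \<rho>" if "y \<in> K \<inter> cball 0 \<rho>" for y using that K_sym by auto
    fix F assume "F \<in> ?M"
    then obtain x where x: "x \<in> F \<inter> unit_sphere n" "support_fun K x < t" by blast
    have "support_fun (K \<inter> cball 0 \<rho>) x \<le> support_fun K x"
      using supp(1) by (subst support_fun_bounds(2)[OF ne]) auto
    then show "\<exists>x0\<in>F \<inter> unit_sphere n. support_fun (K \<inter> cball 0 \<rho>) x0 < a\<^sup>2 * \<rho> / (3 * santalo_const\<^sup>2)"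
      using x t by (intro bexI[of _ x]) auto
  qed auto
  \<comment> \<open>Source of \<open>c' = 1\<close> in the theorem.\<close>
  also have "(1 / 4 :: real) ^ k \<le> exp (- 1) ^ k"
  proof (rule power_mono)
    have "exp 1 \<le> (4 :: real)" using exp_le by simp
    then show "1 / 4 \<le> exp (- 1 :: real)" by (simp add: exp_minus field_simps)
  qed simp
  also have "exp (- 1) ^ k = exp (- real k)" by (simp flip: exp_of_nat_mult)
  finally have "1 - exp (- real k) \<le> 1 - measure \<mu> ?M" by simp
  also have "\<dots> = measure \<mu> (space \<mu> - ?M)" using M.prob_compl[OF M] by simp
  also have "space \<mu> - ?M = {F \<in> space \<mu>. inradius F (orth_proj F ` K) \<ge> t}"
  proof -
    have "(\<exists>x\<in>F \<inter> unit_sphere n. support_fun K x < t) \<longleftrightarrow> \<not> t \<le> inradius F (orth_proj F ` K)"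
      if "F \<in> grassmannian n k" for F
      using inradius_ge_iff[OF that k t(1)] by (meson not_le)
    then show ?thesis by (auto simp: h(3))
  qed
  finally show ?thesis .
qed

end

section \<open>Volumes of the cuts of the body with balls\<close>

lemma emeasure_lift_sphere:
  assumes \<sigma>: "uniform_sphere_measure n \<sigma>" and A: "A \<in> sets borel"
  shows "emeasure (lift_sphere \<sigma>) A = emeasure \<sigma> (A \<inter> unit_sphere n)"
  unfolding lift_sphere_def using sphere_invariant_lift(2,3)[OF \<sigma>] A by (simp add: emeasure_distr)

text \<open>Markov at twice the mean. The Borel set \<open>A\<close> stands for the sublevel set,
  since \<open>f\<close> is only known to be measurable on the sphere.\<close>

lemma sphere_markov:
  fixes f :: "fsvec \<Rightarrow> real"
  assumes \<sigma>: "uniform_sphere_measure n \<sigma>" and f: "integrable \<sigma> f" "\<And>x. x \<in> unit_sphere n \<Longrightarrow> 0 \<le> f x"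
    and m: "(LINT x|\<sigma>. f x) = m" "m > 0" and A: "A \<in> sets borel"
    and fA: "\<And>x. x \<in> unit_sphere n \<Longrightarrow> f x < 2 * m \<Longrightarrow> x \<in> A"
  shows "ennreal (1 / 2) \<le> emeasure (lift_sphere \<sigma>) A"
proof -
  interpret prob_space \<sigma> using \<sigma> by (simp add: uniform_sphere_measure_def)
  note sp = sphere_invariant_lift(3)[OF \<sigma>]
  have [measurable]: "f \<in> borel_measurable \<sigma>" using f(1) by simp
  have A': "A \<inter> unit_sphere n \<in> sets \<sigma>"
    using measurable_sets[OF sphere_invariant_lift(2)[OF \<sigma>] A] by (simp add: sp)
  have "prob {x \<in> space \<sigma>. f x \<ge> 2 * m} \<le> (LINT x|\<sigma>. f x) / (2 * m)"
    using f m(2) by (intro integral_Markov_inequality_measure[where A = "{}"]) (auto simp: sp intro!: AE_I2)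
  also have "\<dots> = 1 / 2" using m by simp
  finally have "1 / 2 \<le> 1 - prob {x \<in> space \<sigma>. f x \<ge> 2 * m}" by simp
  also have "\<dots> = prob (space \<sigma> - {x \<in> space \<sigma>. f x \<ge> 2 * m})"
    by (subst prob_compl) auto
  also have "\<dots> \<le> prob (A \<inter> unit_sphere n)"
  proof (rule finite_measure_mono[OF _ A'], rule subsetI)
    fix x assume "x \<in> space \<sigma> - {x \<in> space \<sigma>. f x \<ge> 2 * m}"
    then have "x \<in> unit_sphere n" "f x < 2 * m" by (auto simp: sp)
    then show "x \<in> A \<inter> unit_sphere n" using fA by blast
  qed
  finally show ?thesis
    unfolding emeasure_lift_sphere[OF \<sigma> A] emeasure_eq_measure by (rule ennreal_leI)
qed

lemma emeasure_cone_scaled_ge: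
  assumes \<sigma>: "uniform_sphere_measure n \<sigma>" and n: "n \<ge> 1" and A: "A \<in> sets borel" and s: "s > 0"
    and half: "ennreal (1 / 2) \<le> emeasure (lift_sphere \<sigma>) A"
  shows "ennreal (1 / 2 * s ^ n * ball_vol n) \<le> emeasure (lam n) {x. x /\<^sub>R s \<in> cball 0 1 \<inter> {x. sgn x \<in> A}}"
proof -
  note [measurable] = A
  have "cball 0 1 \<inter> {x. sgn x \<in> A} \<in> sets borel" by measurable
  then have "emeasure (lam n) {x. x /\<^sub>R s \<in> cball 0 1 \<inter> {x. sgn x \<in> A}}
    = ennreal (s ^ n) * (ennreal (ball_vol n) * emeasure (lift_sphere \<sigma>) A)"
    using s by (simp only: emeasure_lam_scale emeasure_sphere_cone[OF sphere_invariant_lift(1)[OF \<sigma>] n A])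
  moreover have "ennreal (s ^ n) * (ennreal (ball_vol n) * ennreal (1 / 2))
    \<le> ennreal (s ^ n) * (ennreal (ball_vol n) * emeasure (lift_sphere \<sigma>) A)"
    using half by (intro mult_left_mono) auto
  moreover have "ennreal (s ^ n) * (ennreal (ball_vol n) * ennreal (1 / 2)) = ennreal (1 / 2 * s ^ n * ball_vol n)"
  proof -
    have "ennreal (ball_vol n * (1 / 2)) = ennreal (ball_vol n) * ennreal (1 / 2)"
      using ball_vol_pos[of n] by (intro ennreal_mult') simp
    moreover have "ennreal (s ^ n * (ball_vol n * (1 / 2))) = ennreal (s ^ n) * ennreal (ball_vol n * (1 / 2))"
      using s by (intro ennreal_mult') simp
    moreover have "1 / 2 * s ^ n * ball_vol n = s ^ n * (ball_vol n * (1 / 2))" by simp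
    ultimately show ?thesis by simp
  qed
  ultimately show ?thesis by simp
qed

context sym_body
begin

text \<open>Rational dilation factors suffice, as \<open>K\<close> is star-shaped about 0; this
  makes \<open>gauge_cone\<close> a countable union of compact sets.\<close>

lemma gauge_fun_less_iff:
  assumes x: "x \<in> Rn n" and s: "s > 0"
  shows "gauge_fun K x < s \<longleftrightarrow> (\<exists>q\<in>\<rat>. 0 < q \<and> q < s \<and> x \<in> (*\<^sub>R) q ` K)"
proof -
  let ?T = "{t. t > 0 \<and> x \<in> (*\<^sub>R) t ` K}"
  have bdd: "bdd_below ?T" by (intro bdd_belowI[of _ 0]) auto
  have ne: "?T \<noteq> {}"
  proof -
    define t where "t = (norm x + 1) / r"
    have t: "t > 0" using r_pos by (simp add: t_def add_nonneg_pos)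
    have "norm (x /\<^sub>R t) \<le> r"
      using r_pos t by (simp add: t_def field_simps)
    then have "x /\<^sub>R t \<in> K" using x by (intro subsetD[OF ball_K]) (auto intro: subspace_scale[OF subspace_Rn])
    then have "x \<in> (*\<^sub>R) t ` K" using t by (intro image_eqI[of _ _ "x /\<^sub>R t"]) auto
    then show ?thesis using t by blast
  qed
  show ?thesis
  proof
    assume "gauge_fun K x < s"
    then obtain t where t: "t > 0" "x \<in> (*\<^sub>R) t ` K" "t < s"
      unfolding gauge_fun_def using cInf_less_iff[OF ne bdd] by auto
    obtain q where q: "q \<in> \<rat>" "t < q" "q < s" using Rats_dense_in_real[OF t(3)] by blast
    obtain y where y: "y \<in> K" "x = t *\<^sub>R y" using t(2) by blast
    have "(t / q) *\<^sub>R y + (1 - t / q) *\<^sub>R 0 \<in> K"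
      using t q y(1) zero_K by (intro convexD[OF K_convex]) (auto simp: field_simps)
    then have "x \<in> (*\<^sub>R) q ` K"
      using t q y(2) by (intro image_eqI[of _ _ "(t / q) *\<^sub>R y"]) auto
    then show "\<exists>q\<in>\<rat>. 0 < q \<and> q < s \<and> x \<in> (*\<^sub>R) q ` K" using q t(1) by (intro bexI[of _ q]) auto
  next
    assume "\<exists>q\<in>\<rat>. 0 < q \<and> q < s \<and> x \<in> (*\<^sub>R) q ` K"
    then show "gauge_fun K x < s" unfolding gauge_fun_def using cInf_less_iff[OF ne bdd] by auto
  qed
qed

lemma gauge_fun_bounds:
  assumes x: "x \<in> unit_sphere n"
  shows "1 / R \<le> gauge_fun K x" "gauge_fun K x \<le> 1 / r"
proof -
  let ?T = "{t. t > 0 \<and> x \<in> (*\<^sub>R) t ` K}"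
  have "r *\<^sub>R x \<in> K"
    using x r_pos by (intro subsetD[OF ball_K]) (auto simp: unit_sphere_iff intro: subspace_scale[OF subspace_Rn])
  then have "x \<in> (*\<^sub>R) (1 / r) ` K" using r_pos by (intro image_eqI[of _ _ "r *\<^sub>R x"]) auto
  then have T: "1 / r \<in> ?T" using r_pos by simp
  show "gauge_fun K x \<le> 1 / r"
    unfolding gauge_fun_def using T by (intro cInf_lower bdd_belowI[of _ 0]) auto
  show "1 / R \<le> gauge_fun K x"
    unfolding gauge_fun_def
  proof (rule cInf_greatest)
    fix t assume "t \<in> ?T"
    then obtain y where t: "t > 0" and y: "y \<in> K" "x = t *\<^sub>R y" by blast
    have "1 = t * norm y" using x y t by (simp add: unit_sphere_iff)
    also have "\<dots> \<le> t * R" using y K_ball t by (intro mult_left_mono) auto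
    finally show "1 / R \<le> t" using R_pos by (simp add: field_simps)
  qed (use T in blast)
qed

definition gauge_cone :: "real \<Rightarrow> fsvec set" where
  "gauge_cone s = (\<Union>q\<in>{q\<in>\<rat>. 0 < q \<and> q < s}. (*\<^sub>R) q ` K)"

lemma gauge_cone_borel: "gauge_cone s \<in> sets borel"
  unfolding gauge_cone_def
proof (rule sets.countable_UN'')
  show "countable {q \<in> \<rat>. 0 < q \<and> q < s}" using countable_rat by (rule countable_subset[rotated]) auto
  show "(*\<^sub>R) q ` K \<in> sets borel" for q using compact_scaling[OF K_compact] by (rule borel_compact)
qed

lemma gauge_cone_iff:
  "x \<in> Rn n \<Longrightarrow> s > 0 \<Longrightarrow> x \<in> gauge_cone s \<longleftrightarrow> gauge_fun K x < s"
  unfolding gauge_cone_def gauge_fun_less_iff by blast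

lemma integrable_gauge:
  assumes \<sigma>: "uniform_sphere_measure n \<sigma>"
  shows "integrable \<sigma> (gauge_fun K)"
proof -
  interpret prob_space \<sigma> using \<sigma> by (simp add: uniform_sphere_measure_def)
  note sp = sphere_invariant_lift(3)[OF \<sigma>]
  have "{x \<in> space \<sigma>. gauge_fun K x < s} \<in> sets \<sigma>" for s
  proof (cases "s > 0")
    case True
    then have "{x \<in> space \<sigma>. gauge_fun K x < s} = (\<lambda>x. x) -` gauge_cone s \<inter> space \<sigma>"
      using gauge_cone_iff by (auto simp: sp unit_sphere_iff)
    then show ?thesis
      using measurable_sets[OF sphere_invariant_lift(2)[OF \<sigma>] gauge_cone_borel] by simp
  next
    case False
    then have "{x \<in> space \<sigma>. gauge_fun K x < s} = {}"
    proof -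
      have "s \<le> gauge_fun K x" if "x \<in> space \<sigma>" for x
      proof -
        have "s \<le> 1 / R" using False R_pos by (simp add: not_less order_trans[of s 0])
        then show ?thesis using gauge_fun_bounds(1)[of x] that by (simp add: sp)
      qed
      then show ?thesis by (auto simp: not_less)
    qed
    then show ?thesis by (simp only: sets.empty_sets)
  qed
  then have "gauge_fun K \<in> borel_measurable \<sigma>" by (rule borel_measurableI_less)
  moreover have "norm (gauge_fun K x) \<le> 1 / r" if "x \<in> space \<sigma>" for x
  proof -
    have x: "x \<in> unit_sphere n" using that by (simp add: sp)
    have "0 \<le> 1 / R" using R_pos by simp
    also note gauge_fun_bounds(1)[OF x]
    finally have "norm (gauge_fun K x) = gauge_fun K x" by simp
    then show ?thesis using gauge_fun_bounds(2)[OF x] by (simp only:)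
  qed
  ultimately show ?thesis by (intro integrable_const_bound[where B = "1 / r"]) (auto intro!: AE_I2)
qed

lemma integrable_support:
  assumes \<sigma>: "uniform_sphere_measure n \<sigma>"
  shows "integrable \<sigma> (support_fun K)"
proof -
  interpret prob_space \<sigma> using \<sigma> by (simp add: uniform_sphere_measure_def)
  note sp = sphere_invariant_lift(3)[OF \<sigma>]
  have "support_fun K \<in> borel_measurable \<sigma>"
    using measurable_comp[OF sphere_invariant_lift(2)[OF \<sigma>] measurable_support_fun[OF K_ne K_ball]]
    by (simp add: o_def)
  moreover have "norm (support_fun K x) \<le> R" if "x \<in> space \<sigma>" for x
  proof -
    have "norm x = 1" using that by (simp add: sp unit_sphere_iff)
    moreover have "support_fun K 0 = 0"
    proof (rule antisym)
      show "support_fun K 0 \<le> 0" unfolding supp(2) by simp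
      show "0 \<le> support_fun K 0" using supp(1)[OF zero_K, of 0] by simp
    qed
    ultimately show ?thesis using supp(3)[of x 0] by simp
  qed
  ultimately show ?thesis by (intro integrable_const_bound[where B = R]) (auto intro!: AE_I2)
qed

lemma mean_M_pos:
  assumes \<sigma>: "uniform_sphere_measure n \<sigma>"
  shows "mean_M \<sigma> K > 0"
proof -
  interpret prob_space \<sigma> using \<sigma> by (simp add: uniform_sphere_measure_def)
  have "1 / R \<le> mean_M \<sigma> K"
    unfolding mean_M_def using gauge_fun_bounds(1)
    by (intro integral_ge_const integrable_gauge[OF \<sigma>] AE_I2) (simp add: sphere_invariant_lift(3)[OF \<sigma>])
  moreover have "1 / R > 0" using R_pos by simp
  ultimately show ?thesis by linarith
qed

lemma mean_w_pos:
  assumes \<sigma>: "uniform_sphere_measure n \<sigma>"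
  shows "mean_w \<sigma> K > 0"
proof -
  interpret prob_space \<sigma> using \<sigma> by (simp add: uniform_sphere_measure_def)
  have "r \<le> mean_w \<sigma> K"
    unfolding mean_w_def
  proof (intro integral_ge_const integrable_support[OF \<sigma>] AE_I2)
    fix x assume "x \<in> space \<sigma>"
    then show "r \<le> support_fun K x"
      using support_fun_ge[of x] by (simp add: sphere_invariant_lift(3)[OF \<sigma>] unit_sphere_iff)
  qed
  then show ?thesis using r_pos by linarith
qed

text \<open>In at least half of the directions the gauge is below \<open>2 * m\<close>, so
  \<open>K\<close> contains the segments of length \<open>1 / (2 * m)\<close> in them; these also
  stay within radius \<open>\<rho>\<close>.\<close>

lemma volume_cut_mean_M:
  assumes \<sigma>: "uniform_sphere_measure n \<sigma>"
  defines "\<rho> \<equiv> 1 / mean_M \<sigma> K"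
  shows "(1 / 4 * \<rho>) ^ n * ball_vol n \<le> measure (lam n) (K \<inter> cball 0 \<rho>)"
proof -
  define m where "m = mean_M \<sigma> K"
  have m: "m > 0" unfolding m_def by (rule mean_M_pos[OF \<sigma>])
  let ?A = "gauge_cone (2 * m)"
  have "ennreal (1 / 2) \<le> emeasure (lift_sphere \<sigma>) ?A"
  proof (rule sphere_markov[OF \<sigma> integrable_gauge[OF \<sigma>] _ _ m gauge_cone_borel])
    show "0 \<le> gauge_fun K x" if "x \<in> unit_sphere n" for x
      using gauge_fun_bounds(1)[OF that] R_pos by (meson divide_nonneg_pos order_trans zero_le_one)
    show "x \<in> ?A" if "x \<in> unit_sphere n" "gauge_fun K x < 2 * m" for x
      using that m by (simp add: gauge_cone_iff unit_sphere_iff)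
  qed (simp add: m_def mean_M_def)
  then have "ennreal (1 / 2 * (1 / (2 * m)) ^ n * ball_vol n)
    \<le> emeasure (lam n) {x. x /\<^sub>R (1 / (2 * m)) \<in> cball 0 1 \<inter> {x. sgn x \<in> ?A}}"
    using m by (intro emeasure_cone_scaled_ge[OF \<sigma> n_pos gauge_cone_borel]) auto
  also have "\<dots> \<le> emeasure (lam n) (K \<inter> cball 0 \<rho>)"
  proof (rule emeasure_mono)
    show "{x. x /\<^sub>R (1 / (2 * m)) \<in> cball 0 1 \<inter> {x. sgn x \<in> ?A}} \<subseteq> K \<inter> cball 0 \<rho>"
    proof
      fix x assume x: "x \<in> {x. x /\<^sub>R (1 / (2 * m)) \<in> cball 0 1 \<inter> {x. sgn x \<in> ?A}}"
      have "sgn (x /\<^sub>R (1 / (2 * m))) = sgn x" using m by (simp add: sgn_scaleR)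
      then have x1: "2 * m * norm x \<le> 1" and x2: "sgn x \<in> ?A" using x m by auto
      obtain q y where q: "0 < q" "q < 2 * m" and y: "y \<in> K" "sgn x = q *\<^sub>R y"
        using x2 by (auto simp: gauge_cone_def)
      have "norm x * q \<le> norm x * (2 * m)" using q by (intro mult_left_mono) auto
      then have le: "norm x * q \<le> 1" using x1 by (simp add: mult.commute)
      have "(norm x * q) *\<^sub>R y + (1 - norm x * q) *\<^sub>R 0 \<in> K"
        using le q y(1) zero_K by (intro convexD[OF K_convex]) auto
      moreover have "x = norm x *\<^sub>R sgn x" by (cases "x = 0") (auto simp: sgn_div_norm)
      then have "x = (norm x * q) *\<^sub>R y" using y(2) by simp
      ultimately have "x \<in> K" by simp
      moreover have "norm x \<le> \<rho>"
      proof -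
        have "norm x * m \<le> 2 * m * norm x" using m by simp
        then show ?thesis using x1 m by (simp add: \<rho>_def m_def[symmetric] field_simps)
      qed
      ultimately show "x \<in> K \<inter> cball 0 \<rho>" by simp
    qed
  qed simp
  also have "\<dots> = ennreal (measure (lam n) (K \<inter> cball 0 \<rho>))"
    by (rule emeasure_lam_bounded[of _ \<rho>]) auto
  finally have 1: "1 / 2 * (1 / (2 * m)) ^ n * ball_vol n \<le> measure (lam n) (K \<inter> cball 0 \<rho>)"
    by (subst (asm) ennreal_le_iff) auto
  \<comment> \<open>The probability 1/2 is absorbed into the radius as \<open>(1 / 2) ^ n\<close>,
    which turns the factor 1/2 of \<open>\<rho>\<close> into 1/4.\<close>
  have "(1 / 4 * \<rho>) ^ n = (1 / 2) ^ n * (1 / (2 * m)) ^ n"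
    by (simp add: \<rho>_def m_def power_mult_distrib[symmetric])
  also have "\<dots> \<le> 1 / 2 * (1 / (2 * m)) ^ n"
    using m n_pos power_decreasing[of 1 n "1 / 2 :: real"] by (intro mult_right_mono) auto
  finally have "(1 / 4 * \<rho>) ^ n * ball_vol n \<le> 1 / 2 * (1 / (2 * m)) ^ n * ball_vol n"
    using ball_vol_pos[of n] by (intro mult_right_mono) auto
  with 1 show ?thesis by linarith
qed

text \<open>The cuts at \<open>x\<close> and \<open>- x\<close> are reflections of each other, hence
  of equal volume, and their midpoints lie in the cut at 0.\<close>

lemma emeasure_translate_cut_le:
  "emeasure (lam n) (K \<inter> cball x w) \<le> emeasure (lam n) (K \<inter> cball 0 w)"
proof -
  have meas: "K \<inter> cball x w \<in> sets borel" "K \<inter> cball (- x) w \<in> sets borel" "K \<inter> cball 0 w \<in> sets borel"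
    by measurable
  have "emeasure (lam n) (K \<inter> cball x w) * emeasure (lam n) (K \<inter> cball (- x) w) \<le> (emeasure (lam n) (K \<inter> cball 0 w))\<^sup>2"
  proof (rule emeasure_lam_midpoint[OF meas])
    fix a b assume a: "a \<in> K \<inter> cball x w" and b: "b \<in> K \<inter> cball (- x) w"
    have "(1 / 2) *\<^sub>R a + (1 / 2) *\<^sub>R b \<in> K" using a b by (intro convexD[OF K_convex]) auto
    then have "(a + b) /\<^sub>R 2 \<in> K" by (simp add: scaleR_add_right)
    moreover have "norm (a + b) \<le> 2 * w"
      using a b norm_triangle_ineq[of "a - x" "b - (- x)"] by (simp add: dist_norm norm_minus_commute)
    ultimately show "(a + b) /\<^sub>R 2 \<in> K \<inter> cball 0 w" by simp
  qed
  moreover have "emeasure (lam n) (K \<inter> cball (- x) w) = emeasure (lam n) (K \<inter> cball x w)"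
  proof -
    have "{y. - y \<in> K \<inter> cball x w} = K \<inter> cball (- x) w"
    proof -
      have "dist (- x) y = dist x (- y)" for y using dist_minus[of x "- y"] by simp
      moreover have "- y \<in> K \<longleftrightarrow> y \<in> K" for y using K_sym[of y] K_sym[of "- y"] by auto
      ultimately show ?thesis by auto
    qed
    then show ?thesis using emeasure_lam_uminus[OF meas(1), of n] by (simp only:)
  qed
  ultimately have "emeasure (lam n) (K \<inter> cball x w) * emeasure (lam n) (K \<inter> cball x w)
    \<le> (emeasure (lam n) (K \<inter> cball 0 w))\<^sup>2"
    by (simp only:)
  then show ?thesis by (rule ennreal_le_of_square_le)
qed

text \<open>The base is written as \<open>a * w\<close> to match \<open>inradius_probability\<close>
  with \<open>\<rho> = w\<close> and \<open>a = sqrt n / (3 * santalo_const * w)\<close>.\<close>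

lemma volume_cut_mean_w:
  assumes \<sigma>: "uniform_sphere_measure n \<sigma>" and vol: "emeasure (lam n) K = 1"
  defines "w \<equiv> mean_w \<sigma> K"
  shows "(sqrt (real n) / (3 * santalo_const * w) * w) ^ n * ball_vol n \<le> measure (lam n) (K \<inter> cball 0 w)"
proof -
  have w: "w > 0" unfolding w_def by (rule mean_w_pos[OF \<sigma>])
  have C: "santalo_const \<ge> 4" by (rule santalo_const_ge)
  note [measurable] = measurable_support_fun[OF K_ne K_ball]
  let ?H = "{x. support_fun K x \<le> 2 * w}"
  have H[measurable]: "?H \<in> sets borel" by measurable
  have half: "ennreal (1 / 2) \<le> emeasure (lift_sphere \<sigma>) ?H"
  proof (rule sphere_markov[OF \<sigma> integrable_support[OF \<sigma>] _ _ w H])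
    show "0 \<le> support_fun K x" if "x \<in> unit_sphere n" for x
      using supp(1)[OF zero_K, of x] by simp
  qed (auto simp: w_def mean_w_def)
  \<comment> \<open>A subset of the polar of \<open>K + w B\<close> that is large by Markov: the
    radius is \<open>1 / (3 * w)\<close> because the support function is at most
    \<open>2 * w\<close> in these directions and the ball adds \<open>w\<close>.\<close>
  define Q where "Q = {x. x /\<^sub>R (1 / (3 * w)) \<in> cball 0 1 \<inter> {x. sgn x \<in> ?H}}"
  define q where "q = 1 / 2 * (1 / (3 * w)) ^ n * ball_vol n"
  have q: "q > 0" using w ball_vol_pos[of n] by (simp add: q_def)
  have lamQ: "ennreal q \<le> emeasure (lam n) Q"
    unfolding q_def Q_def using w by (intro emeasure_cone_scaled_ge[OF \<sigma> n_pos H _ half]) auto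
  have Q_borel: "Q \<in> sets borel"
  proof -
    have "(\<lambda>x :: fsvec. x /\<^sub>R (1 / (3 * w))) \<in> borel_measurable borel"
      by (intro borel_measurable_continuous_onI continuous_intros)
    moreover have "cball 0 1 \<inter> {x. sgn x \<in> ?H} \<in> sets borel" by measurable
    ultimately show ?thesis
      unfolding Q_def using measurable_sets[of "\<lambda>x :: fsvec. x /\<^sub>R (1 / (3 * w))" borel borel] by (simp only: vimage_def Int_UNIV_right space_borel)
  qed
  have Q_iff: "x \<in> Q \<longleftrightarrow> 3 * w * norm x \<le> 1 \<and> support_fun K (sgn x) \<le> 2 * w" for x
  proof -
    have "sgn (x /\<^sub>R (1 / (3 * w))) = sgn x" using w by (simp add: sgn_scaleR)
    then show ?thesis using w by (simp add: Q_def)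
  qed
  have Q_sym: "- x \<in> Q" if "x \<in> Q" for x
  proof -
    have "support_fun K (- sgn x) \<le> support_fun K (sgn x)"
      unfolding supp(2) using supp(1)[OF K_sym] by fastforce
    then show ?thesis using that by (simp add: Q_iff sgn_minus)
  qed
  \<comment> \<open>The polar of \<open>Q\<close>, a closed set containing \<open>K + w B\<close>,
    is used in place of the sum.\<close>
  define T where "T = (\<Inter>x\<in>Q. {y. y \<bullet> x \<le> 1})"
  have "closed T" unfolding T_def by (intro closed_INT ballI closed_Collect_le continuous_intros)
  then have T[measurable]: "T \<in> sets borel" by (rule borel_closed)
  have "emeasure (lam n) T * emeasure (lam n) Q \<le> ennreal ((4 * exp 7 / real n) ^ n)"
    using Q_sym by (intro santalo_lam T Q_borel n_pos) (auto simp: T_def)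
  then have TQ: "emeasure (lam n) T * ennreal q \<le> ennreal ((santalo_const / real n) ^ n)"
    unfolding santalo_const_def using lamQ by (meson mult_left_mono order_trans zero_le)
  have in_T: "x \<in> T" if y: "y \<in> K" "dist x y \<le> w" for x y
    unfolding T_def
  proof (intro INT_I CollectI)
    fix z assume z: "z \<in> Q"
    have "z \<bullet> y \<le> norm z * (2 * w)"
    proof -
      have "sgn z \<bullet> y \<le> 2 * w" using supp(1)[OF y(1), of "sgn z"] z by (simp add: Q_iff)
      then have "norm z * (sgn z \<bullet> y) \<le> norm z * (2 * w)" by (intro mult_left_mono) auto
      moreover have "norm z * (sgn z \<bullet> y) = z \<bullet> y" by (cases "z = 0") (auto simp: sgn_div_norm)
      ultimately show ?thesis by simp
    qed
    moreover have "z \<bullet> (x - y) \<le> norm z * w"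
      using norm_cauchy_schwarz[of z "x - y"] y(2) mult_left_mono[of "norm (x - y)" w "norm z"]
      by (simp add: dist_norm)
    moreover have "x \<bullet> z = z \<bullet> y + z \<bullet> (x - y)" by (simp add: inner_diff_right inner_commute)
    ultimately show "x \<bullet> z \<le> 1" using z by (simp add: Q_iff mult_ac)
  qed
  let ?L = "K \<inter> cball 0 w"
  have L: "emeasure (lam n) ?L = ennreal (measure (lam n) ?L)" by (rule emeasure_lam_bounded[of _ w]) auto
  interpret S: sigma_finite_measure "lam n" by (rule sigma_finite_lam)
  interpret P: pair_sigma_finite "lam n" "lam n" ..
  let ?d = "\<lambda>x y. indicator K y * indicator {z. dist (fst z) (snd z) \<le> w} (x, y) :: ennreal"
  \<comment> \<open>By volume one this is the measure of the pairs with \<open>y\<close> in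
    \<open>K\<close> and \<open>dist x y \<le> w\<close>. In the other order only \<open>x\<close>
    in \<open>T\<close> contribute, each at most the volume of the central cut.\<close>
  have "ennreal (w ^ n * ball_vol n) = (\<integral>\<^sup>+y. ennreal (w ^ n * ball_vol n) * indicator K y \<partial>lam n)"
    using vol by (subst nn_integral_cmult_indicator) auto
  also have "\<dots> = (\<integral>\<^sup>+y. (\<integral>\<^sup>+x. ?d x y \<partial>lam n) \<partial>lam n)"
  proof (rule nn_integral_cong)
    fix y
    have "(\<integral>\<^sup>+x. ?d x y \<partial>lam n) = (\<integral>\<^sup>+x. indicator K y * indicator (cball y w) x \<partial>lam n)"
      by (intro nn_integral_cong) (auto simp: indicator_def dist_commute)
    also have "\<dots> = indicator K y * emeasure (lam n) (cball y w)"
      by (subst nn_integral_cmult_indicator) auto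
    also have "\<dots> = ennreal (w ^ n * ball_vol n) * indicator K y"
      using emeasure_lam_cball[OF w, of y n] K_Rn by (auto simp: indicator_def)
    finally show "ennreal (w ^ n * ball_vol n) * indicator K y = (\<integral>\<^sup>+x. ?d x y \<partial>lam n)" by simp
  qed
  also have "\<dots> = (\<integral>\<^sup>+x. (\<integral>\<^sup>+y. ?d x y \<partial>lam n) \<partial>lam n)"
    by (rule P.Fubini') measurable
  also have "\<dots> \<le> (\<integral>\<^sup>+x. emeasure (lam n) ?L * indicator T x \<partial>lam n)"
  proof (rule nn_integral_mono)
    fix x
    have "(\<integral>\<^sup>+y. ?d x y \<partial>lam n) = (\<integral>\<^sup>+y. indicator (K \<inter> cball x w) y \<partial>lam n)"
      by (intro nn_integral_cong) (auto simp: indicator_def)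
    also have "\<dots> = emeasure (lam n) (K \<inter> cball x w)" by (subst nn_integral_indicator) auto
    also have "\<dots> \<le> emeasure (lam n) ?L * indicator T x"
    proof (cases "K \<inter> cball x w = {}")
      case False
      then have "x \<in> T" using in_T by auto
      then show ?thesis using emeasure_translate_cut_le[of x w] by simp
    qed simp
    finally show "(\<integral>\<^sup>+y. ?d x y \<partial>lam n) \<le> emeasure (lam n) ?L * indicator T x" .
  qed
  also have "\<dots> = emeasure (lam n) ?L * emeasure (lam n) T"
    by (subst nn_integral_cmult_indicator) auto
  finally have "ennreal (w ^ n * ball_vol n) * ennreal q \<le> emeasure (lam n) ?L * (emeasure (lam n) T * ennreal q)"
    by (simp add: mult_right_mono mult.assoc[symmetric])
  also have "\<dots> \<le> ennreal (measure (lam n) ?L) * ennreal ((santalo_const / real n) ^ n)"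
    unfolding L using TQ by (intro mult_left_mono) auto
  finally have "ennreal (w ^ n * ball_vol n * q) \<le> ennreal (measure (lam n) ?L * (santalo_const / real n) ^ n)"
    using w ball_vol_pos[of n] q C by (simp add: ennreal_mult)
  then have 1: "w ^ n * ball_vol n * q \<le> measure (lam n) ?L * (santalo_const / real n) ^ n"
    using C by (subst (asm) ennreal_le_iff) auto
  have "w ^ n * ball_vol n * q = 1 / 2 * (w * (1 / (3 * w))) ^ n * ball_vol n * ball_vol n"
    unfolding q_def power_mult_distrib by (simp only: mult_ac)
  also have "w * (1 / (3 * w)) = 1 / 3" using w by simp
  finally have eq: "w ^ n * ball_vol n * q = 1 / 2 * (1 / 3) ^ n * ball_vol n * ball_vol n" .
  \<comment> \<open>One ball volume stays for the conclusion, the other is replaced by the inscribed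
    cube; the Markov factor 1/2 turns 1/3 into 1/6.\<close>
  have "(1 / 6) ^ n * (2 / sqrt (real n)) ^ n * ball_vol n \<le> (1 / 2 * (1 / 3) ^ n) * ball_vol n * ball_vol n"
  proof (intro mult_mono ball_vol_ge)
    have "(1 / 6 :: real) ^ n = (1 / 2) ^ n * (1 / 3) ^ n" by (simp add: power_mult_distrib[symmetric])
    also have "\<dots> \<le> 1 / 2 * (1 / 3) ^ n"
      using n_pos power_decreasing[of 1 n "1 / 2 :: real"] by (intro mult_right_mono) auto
    finally show "(1 / 6 :: real) ^ n \<le> 1 / 2 * (1 / 3) ^ n" .
  qed (auto simp: less_imp_le[OF ball_vol_pos])
  with 1 eq have 2: "(1 / 6) ^ n * (2 / sqrt (real n)) ^ n * ball_vol n \<le> measure (lam n) ?L * (santalo_const / real n) ^ n"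
    by simp
  have "(1 / 6) * (2 / sqrt (real n)) = sqrt (real n) / (3 * santalo_const * w) * w * (santalo_const / real n)"
  proof -
    have "1 / sqrt (real n) = sqrt (real n) / real n" using n_pos by (simp add: field_simps)
    then show ?thesis using C w by (simp add: field_simps)
  qed
  then have "(1 / 6) ^ n * (2 / sqrt (real n)) ^ n = (sqrt (real n) / (3 * santalo_const * w) * w) ^ n * (santalo_const / real n) ^ n"
    by (simp only: power_mult_distrib[symmetric])
  with 2 have "((sqrt (real n) / (3 * santalo_const * w) * w) ^ n * ball_vol n) * (santalo_const / real n) ^ n \<le> measure (lam n) ?L * (santalo_const / real n) ^ n"
    by (simp only: mult_ac)
  then show ?thesis using C n_pos by (simp add: mult_le_cancel_right del: times_divide_eq_left)
qed

end

section \<open>Transfer to convex bodies and choice of the constants\<close>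

text \<open>A ball around an interior point \<open>x\<close> moves to the origin: \<open>y\<close>
  is the midpoint of \<open>x + y\<close> and \<open>- (x - y)\<close>, both in \<open>K\<close> by
  symmetry.\<close>

lemma convex_body_sym_body:
  assumes K: "convex_body n K" "symmetric_set K" and n: "n \<ge> 1"
  shows "\<exists>r R. sym_body n K r R"
proof -
  have K_Rn: "K \<subseteq> Rn n" and K_compact: "compact K" and K_convex: "convex K"
    and int: "top_of_set (Rn n) interior_of K \<noteq> {}" using K(1) by (auto simp: convex_body_def)
  have K_sym: "- y \<in> K" if "y \<in> K" for y using K(2) that by (auto simp: symmetric_set_def)
  obtain R where R: "R > 0" "\<And>x. x \<in> K \<Longrightarrow> norm x \<le> R"
    using compact_imp_bounded[OF K_compact] bounded_pos by blast
  obtain x T where T: "openin (top_of_set (Rn n)) T" "x \<in> T" "T \<subseteq> K"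
    using int by (auto simp: interior_of_def)
  then obtain V where V: "open V" "T = Rn n \<inter> V" by (auto simp: openin_open)
  then obtain e where e: "e > 0" "ball x e \<subseteq> V" using T(2) open_contains_ball by blast
  have xRn: "x \<in> Rn n" using T V by auto
  have "cball 0 (e / 2) \<inter> Rn n \<subseteq> K"
  proof
    fix y assume y: "y \<in> cball 0 (e / 2) \<inter> Rn n"
    have in_K: "x + z \<in> K" if "z \<in> Rn n" "norm z < e" for z
    proof -
      have "x + z \<in> ball x e" using that by (simp add: dist_norm)
      then have "x + z \<in> T" using V(2) e(2) subspace_add[OF subspace_Rn xRn that(1)] by auto
      then show ?thesis using T(3) by blast
    qed
    have "x + y \<in> K" "x + - y \<in> K"
      using y e(1) subspace_neg[OF subspace_Rn, of y n] by (auto intro!: in_K simp del: add_uminus_conv_diff)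
    moreover from this(2) have "- (x + - y) \<in> K" by (rule K_sym)
    ultimately have "(1 / 2) *\<^sub>R (x + y) + (1 / 2) *\<^sub>R (- (x + - y)) \<in> K"
      by (intro convexD[OF K_convex]) auto
    also have "(1 / 2) *\<^sub>R (x + y) + (1 / 2) *\<^sub>R (- (x + - y)) = y"
      by (rule fsvec_eqI) (simp add: field_simps)
    finally show "y \<in> K" .
  qed
  then have "sym_body n K (e / 2) R"
    using K_Rn K_compact K_convex K_sym e(1) R n by unfold_locales auto
  then show ?thesis by blast
qed

lemma vol_Rn_emeasure:
  assumes K: "K \<subseteq> Rn n" "compact K" and vol: "vol_Rn n K = 1"
  shows "emeasure (lam n) K = 1"
proof -
  have "(\<lambda>x. \<lambda>i\<in>{..<n}. coord x i) ` K = {x \<in> extensional {..<n}. emb n x \<in> K}"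
  proof (intro equalityI subsetI)
    fix x assume x: "x \<in> {x \<in> extensional {..<n}. emb n x \<in> K}"
    then have "x = (\<lambda>i\<in>{..<n}. coord (emb n x) i)" by (auto simp: fun_eq_iff extensional_def)
    then show "x \<in> (\<lambda>x. \<lambda>i\<in>{..<n}. coord x i) ` K" using x by blast
  qed (use K emb_coord in auto)
  then have "measure (LM {..<n}) {x \<in> extensional {..<n}. emb n x \<in> K} = 1"
    using vol by (simp add: vol_Rn_def)
  \<comment> \<open>\<open>measure\<close> is 0 on sets of infinite measure, so the value 1
    determines \<open>emeasure\<close>.\<close>
  then have "emeasure (LM {..<n}) {x \<in> extensional {..<n}. emb n x \<in> K} = 1"
    by (metis emeasure_eq_ennreal_measure ennreal_1 measure_zero_top zero_neq_one)
  then show ?thesis using borel_compact[OF K(2)] by (simp add: emeasure_lam)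
qed

theorem theorem1p2:
  shows "\<exists>c>0. \<exists>c'>0. \<forall>(n::nat) (k::nat) (K::fsvec set) (\<sigma>::fsvec measure) (\<mu>::fsvec set measure).
    convex_body n K \<and> symmetric_set K \<and> vol_Rn n K = 1 \<and>
    1 \<le> k \<and> real k < (real n - 1) / 4 \<and>
    uniform_sphere_measure n \<sigma> \<and> haar_grassmannian n k \<mu> \<longrightarrow>
    measure \<mu> {F \<in> space \<mu>.
        inradius F (orth_proj F ` K) \<ge> c * max (real n / mean_w \<sigma> K) (1 / mean_M \<sigma> K)}
      \<ge> 1 - exp (- c' * real k)"
proof -
  have C: "santalo_const \<ge> 4" by (rule santalo_const_ge)
  \<comment> \<open>With \<open>a = sqrt n / (3 * santalo_const * w)\<close> the threshold
    \<open>a\<^sup>2 * w / (3 * santalo_const\<^sup>2)\<close> is exactly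
    \<open>c * (n / w)\<close>. The other case has \<open>a = 1 / 4\<close> and allows the larger
    constant \<open>1 / (48 * santalo_const\<^sup>2)\<close>.\<close>
  define c where "c = 1 / (27 * santalo_const ^ 4)"
  have c: "c > 0" using C by (simp add: c_def)
  have main: "measure \<mu> {F \<in> space \<mu>. inradius F (orth_proj F ` K) \<ge> c * max (real n / mean_w \<sigma> K) (1 / mean_M \<sigma> K)}
      \<ge> 1 - exp (- 1 * real k)"
    if K: "convex_body n K" "symmetric_set K" "vol_Rn n K = 1" and k: "1 \<le> k" "real k < (real n - 1) / 4"
      and \<sigma>: "uniform_sphere_measure n \<sigma>" and \<mu>: "haar_grassmannian n k \<mu>"
    for n k K \<sigma> \<mu>
  proof -
    have "real (4 * k + 1) < real n" using k(2) by simp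
    then have "4 * k + 1 < n" by (simp only: of_nat_less_iff)
    then have n: "n \<ge> 1" "n \<ge> 2 * k" by simp_all
    obtain r R where "sym_body n K r R" using convex_body_sym_body[OF K(1,2) n(1)] by blast
    then interpret sym_body n K r R .
    note inv = sphere_invariant_lift(1)[OF \<sigma>]
    have vol: "emeasure (lam n) K = 1" by (rule vol_Rn_emeasure[OF K_Rn K_compact K(3)])
    let ?w = "mean_w \<sigma> K" and ?m = "mean_M \<sigma> K"
    have w: "?w > 0" and m: "?m > 0" by (rule mean_w_pos[OF \<sigma>], rule mean_M_pos[OF \<sigma>])
    show ?thesis
    proof (cases "1 / ?m \<le> real n / ?w")
      case True
      define a where "a = sqrt (real n) / (3 * santalo_const * ?w)"
      have a: "a > 0" using n C w by (simp add: a_def)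
      have alg: "N / (9 * D * v\<^sup>2) * v / (3 * D) = 1 / (27 * (D * D)) * (N / v)"
        if "D > 0" "v > 0" for D v N :: real
        using that by (simp add: field_simps power2_eq_square)
      have "a\<^sup>2 = real n / (9 * santalo_const\<^sup>2 * ?w\<^sup>2)"
        by (simp add: a_def power_divide power_mult_distrib)
      moreover have "santalo_const ^ 4 = santalo_const\<^sup>2 * santalo_const\<^sup>2" by (simp flip: power_add)
      ultimately have "a\<^sup>2 * ?w / (3 * santalo_const\<^sup>2) = c * (real n / ?w)"
        using alg[of "santalo_const\<^sup>2" ?w "real n"] w C by (simp only: c_def) simp
      then have "1 - exp (- real k) \<le> measure \<mu> {F \<in> space \<mu>. c * (real n / ?w) \<le> inradius F (orth_proj F ` K)}"
        using w c n volume_cut_mean_w[OF \<sigma> vol]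
        by (intro inradius_probability[OF inv \<mu> k(1) n(2) w a]) (auto simp: a_def)
      then show ?thesis unfolding max_absorb1[OF True] by simp
    next
      case False
      have m': "1 / ?m > 0" using m by simp
      have "c \<le> (1 / 4)\<^sup>2 / (3 * santalo_const\<^sup>2)"
      proof -
        have "4 * 4 \<le> santalo_const * santalo_const" using C by (intro mult_mono) auto
        then have "48 * santalo_const\<^sup>2 \<le> 27 * santalo_const ^ 4"
          using mult_right_mono[of 48 "27 * (santalo_const * santalo_const)" "santalo_const\<^sup>2"] by (simp add: power2_eq_square power4_eq_xxxx)
        then have "1 / (27 * santalo_const ^ 4) \<le> 1 / (48 * santalo_const\<^sup>2)" using C by (intro divide_left_mono) auto
        then show ?thesis by (simp add: c_def power2_eq_square)
      qed
      then have "c * (1 / ?m) \<le> (1 / 4)\<^sup>2 / (3 * santalo_const\<^sup>2) * (1 / ?m)" using m by (intro mult_right_mono) auto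
      then have "c * (1 / ?m) \<le> (1 / 4)\<^sup>2 * (1 / ?m) / (3 * santalo_const\<^sup>2)" by (simp add: mult_ac)
      moreover have "0 < c * (1 / ?m)" using c m by simp
      ultimately have "1 - exp (- real k) \<le> measure \<mu> {F \<in> space \<mu>. c * (1 / ?m) \<le> inradius F (orth_proj F ` K)}"
        using volume_cut_mean_M[OF \<sigma>]
        by (intro inradius_probability[OF inv \<mu> k(1) n(2) m', of "1 / 4"]) auto
      moreover have "real n / ?w \<le> 1 / ?m" using False by simp
      ultimately show ?thesis by (simp only: max_absorb2 mult_minus1)
    qed
  qed
  show ?thesis
    by (rule exI[of _ c], rule conjI[OF c], rule exI[of _ 1], rule conjI[OF zero_less_one])
      (use main in blast)
qed

end
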